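(* Let $\Omega\subset\mathbb{R}^n$ be a smooth bounded domain, let $m\in C(\overline{\Omega})$ change sign in $\Omega$, and let $k\ge 1$ be an integer. For $1<p<\infty$ let $\lambda_{k,p}$ be the $k$-th (positive, variational) eigenvalue of the $p$-Laplacian problem $-\Delta_p u=\lambda m|u|^{p-2}u$ in $\Omega$, $u=0$ on $\partial\Omega$, defined by $$\lambda_{k,p}=\inf_{A\in\Sigma_k}\ \sup_{u\in A}\int_\Omega|\nabla u|^p .$$ Then $$\lim_{p\to\infty}\left(\lambda_{k,p}\right)^{1/p}\le\frac{1}{R_{k,+}},$$ where $$R_{k,+}:=\sup\{r>0:\ \text{there are } k \text{ disjoint balls of radius } r \text{ contained in } \Omega \text{ and centered at points } x_1,\dots,x_k\in\Omega_+\}.$$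
   Context: "$m$ changes sign in $\Omega$" means that both $\{m>0\}:=\{x\in\Omega: m(x)>0\}$ and $\{x\in\Omega: m(x)<0\}$ are nonempty. We set $\Omega_+:=\overline{\{m>0\}}$. Balls are open Euclidean balls. $\Delta_p u:=\mathrm{div}(|\nabla u|^{p-2}\nabla u)$. Let $\mathcal{A}^+(m):=\{u\in W^{1,p}_0(\Omega):\int_\Omega m|u|^p=1\}$. For a real Banach space $E$ and a closed symmetric set $A\subset E$ (i.e. $v\in A\Rightarrow -v\in A$), the (Krasnoselskii) genus $\gamma(A)$ is the smallest integer $j$ such that there exists a continuous odd mapping $\phi:A\to\mathbb{R}^j\setminus\{0\}$; if no such integer exists, $\gamma(A)=\infty$. For fixed $p$, $\Sigma_k$ is the collection of all symmetric compact subsets $A\subset\mathcal{A}^+(m)$ (in $E=W^{1,p}_0(\Omega)$) with $\gamma(A)\ge k$. *)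

theory Defs
  imports "HOL-Analysis.Analysis" "HOL-Library.Extended_Nat"
begin

primrec Ck_fun :: "nat \<Rightarrow> ('a::euclidean_space \<Rightarrow> real) \<Rightarrow> bool" where
  "Ck_fun 0 f \<longleftrightarrow> continuous_on UNIV f"
| "Ck_fun (Suc k) f \<longleftrightarrow>
     (\<forall>x. f differentiable (at x)) \<and>
     (\<forall>b\<in>Basis. Ck_fun k (\<lambda>x. frechet_derivative f (at x) b))"

definition smooth_fun :: "('a::euclidean_space \<Rightarrow> real) \<Rightarrow> bool" where
  "smooth_fun f \<longleftrightarrow> (\<forall>k. Ck_fun k f)"

text \<open>Near each boundary point the domain is the strict epigraph, in some direction \<open>\<nu>\<close>, of a
  smooth function of the component orthogonal to \<open>\<nu>\<close>. Only the values of \<open>\<gamma>\<close> on the hyperplane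
  orthogonal to \<open>\<nu>\<close> matter; every smooth function there extends to the whole space.\<close>

definition smooth_boundary :: "'a::euclidean_space set \<Rightarrow> bool" where
  "smooth_boundary \<Omega> \<longleftrightarrow>
     (\<forall>x0\<in>frontier \<Omega>. \<exists>r>0. \<exists>\<nu> \<gamma>. norm \<nu> = 1 \<and> smooth_fun \<gamma> \<and>
        \<Omega> \<inter> ball x0 r = {x \<in> ball x0 r. x \<bullet> \<nu> > \<gamma> (x - (x \<bullet> \<nu>) *\<^sub>R \<nu>)})"

definition smooth_bounded_domain :: "'a::euclidean_space set \<Rightarrow> bool" where
  "smooth_bounded_domain \<Omega> \<longleftrightarrow>
     open \<Omega> \<and> connected \<Omega> \<and> \<Omega> \<noteq> {} \<and> bounded \<Omega> \<and> smooth_boundary \<Omega>"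

definition changes_sign :: "'a set \<Rightarrow> ('a \<Rightarrow> real) \<Rightarrow> bool" where
  "changes_sign \<Omega> m \<longleftrightarrow> {x\<in>\<Omega>. m x > 0} \<noteq> {} \<and> {x\<in>\<Omega>. m x < 0} \<noteq> {}"

definition positivity_set :: "'a::euclidean_space set \<Rightarrow> ('a \<Rightarrow> real) \<Rightarrow> 'a set" where
  "positivity_set \<Omega> m = closure {x\<in>\<Omega>. m x > 0}"

definition packing_radius :: "'a::euclidean_space set \<Rightarrow> ('a \<Rightarrow> real) \<Rightarrow> nat \<Rightarrow> real" where
  "packing_radius \<Omega> m k =
     Sup {r. r > 0 \<and> (\<exists>c :: nat \<Rightarrow> 'a.
            (\<forall>i\<in>{1..k}. c i \<in> positivity_set \<Omega> m \<and> ball (c i) r \<subseteq> \<Omega>) \<and>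
            disjoint_family_on (\<lambda>i. ball (c i) r) {1..k})}"

definition test_functions :: "'a::euclidean_space set \<Rightarrow> ('a \<Rightarrow> real) set" where
  "test_functions \<Omega> =
     {\<phi>. smooth_fun \<phi> \<and> compact (closure {x. \<phi> x \<noteq> 0}) \<and> closure {x. \<phi> x \<noteq> 0} \<subseteq> \<Omega>}"

text \<open>Elements of Lebesgue and Sobolev spaces are represented by functions on the whole space; all
  notions below only depend on their restriction to \<open>\<Omega>\<close> up to null sets. No quotient is
  formed, so \<open>sobolev_norm\<close> is a seminorm. Functions that agree almost everywhere on \<open>\<Omega>\<close> are
  topologically indistinguishable, hence are identified by every continuous map into a Hausdorff
  space, and compactness and genus are those of the images in the quotient.\<close>

definition Lp_space :: "'a::euclidean_space set \<Rightarrow> real \<Rightarrow> ('a \<Rightarrow> 'b::euclidean_space) set" where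
  "Lp_space \<Omega> p = {f \<in> borel_measurable (lebesgue_on \<Omega>).
                     integrable (lebesgue_on \<Omega>) (\<lambda>x. norm (f x) powr p)}"

definition locally_integrable ::
    "'a::euclidean_space set \<Rightarrow> ('a \<Rightarrow> 'b::euclidean_space) \<Rightarrow> bool" where
  "locally_integrable \<Omega> f \<longleftrightarrow> (\<forall>K. compact K \<and> K \<subseteq> \<Omega> \<longrightarrow> integrable (lebesgue_on K) f)"

definition has_weak_gradient ::
    "'a::euclidean_space set \<Rightarrow> ('a \<Rightarrow> real) \<Rightarrow> ('a \<Rightarrow> 'a) \<Rightarrow> bool" where
  "has_weak_gradient \<Omega> u g \<longleftrightarrow>
     locally_integrable \<Omega> u \<and> locally_integrable \<Omega> g \<and>
     (\<forall>\<phi>\<in>test_functions \<Omega>. \<forall>b\<in>Basis.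
        (\<integral>x. u x * frechet_derivative \<phi> (at x) b \<partial>lebesgue_on \<Omega>) =
        - (\<integral>x. (g x \<bullet> b) * \<phi> x \<partial>lebesgue_on \<Omega>))"

definition weak_gradient :: "'a::euclidean_space set \<Rightarrow> ('a \<Rightarrow> real) \<Rightarrow> 'a \<Rightarrow> 'a" where
  "weak_gradient \<Omega> u = (SOME g. has_weak_gradient \<Omega> u g)"

definition sobolev_space :: "'a::euclidean_space set \<Rightarrow> real \<Rightarrow> ('a \<Rightarrow> real) set" where
  "sobolev_space \<Omega> p = {u \<in> Lp_space \<Omega> p. \<exists>g\<in>Lp_space \<Omega> p. has_weak_gradient \<Omega> u g}"

definition dirichlet_energy :: "'a::euclidean_space set \<Rightarrow> real \<Rightarrow> ('a \<Rightarrow> real) \<Rightarrow> real" where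
  "dirichlet_energy \<Omega> p u = (\<integral>x. norm (weak_gradient \<Omega> u x) powr p \<partial>lebesgue_on \<Omega>)"

definition sobolev_norm :: "'a::euclidean_space set \<Rightarrow> real \<Rightarrow> ('a \<Rightarrow> real) \<Rightarrow> real" where
  "sobolev_norm \<Omega> p u =
     ((\<integral>x. \<bar>u x\<bar> powr p \<partial>lebesgue_on \<Omega>) + dirichlet_energy \<Omega> p u) powr (1 / p)"

definition sobolev_topology :: "'a::euclidean_space set \<Rightarrow> real \<Rightarrow> ('a \<Rightarrow> real) topology" where
  "sobolev_topology \<Omega> p = topology_generated_by
     {{v \<in> sobolev_space \<Omega> p. sobolev_norm \<Omega> p (v - u) < r} |u r. u \<in> sobolev_space \<Omega> p \<and> r > 0}"

definition sobolev_space0 :: "'a::euclidean_space set \<Rightarrow> real \<Rightarrow> ('a \<Rightarrow> real) set" where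
  "sobolev_space0 \<Omega> p = sobolev_topology \<Omega> p closure_of test_functions \<Omega>"

definition symmetric_set :: "'e::uminus set \<Rightarrow> bool" where
  "symmetric_set A \<longleftrightarrow> (\<forall>v\<in>A. - v \<in> A)"

text \<open>\<open>Euclidean_space j\<close> realises \<open>\<real>\<close>-valued \<open>j\<close>-tuples as functions on \<^typ>\<open>nat\<close> vanishing from
  index \<open>j\<close> on. If no \<open>j\<close> is admissible, the infimum is \<open>\<infinity>\<close>; only the empty set has genus \<open>0\<close>.\<close>

definition genus :: "'e::uminus topology \<Rightarrow> 'e set \<Rightarrow> enat" where
  "genus T A = Inf {enat j |j. \<exists>\<phi>.
     continuous_map (subtopology T A) (subtopology (Euclidean_space j) (- {\<lambda>_. 0})) \<phi> \<and>
     (\<forall>v\<in>A. \<phi> (- v) = - \<phi> v)}"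

definition constraint_set ::
    "'a::euclidean_space set \<Rightarrow> ('a \<Rightarrow> real) \<Rightarrow> real \<Rightarrow> ('a \<Rightarrow> real) set" where
  "constraint_set \<Omega> m p =
     {u \<in> sobolev_space0 \<Omega> p. (\<integral>x. m x * \<bar>u x\<bar> powr p \<partial>lebesgue_on \<Omega>) = 1}"

definition admissible_sets ::
    "'a::euclidean_space set \<Rightarrow> ('a \<Rightarrow> real) \<Rightarrow> nat \<Rightarrow> real \<Rightarrow> ('a \<Rightarrow> real) set set" where
  "admissible_sets \<Omega> m k p =
     {A. A \<subseteq> constraint_set \<Omega> m p \<and> symmetric_set A \<and>
         compactin (subtopology (sobolev_topology \<Omega> p) (sobolev_space0 \<Omega> p)) A \<and>
         genus (subtopology (sobolev_topology \<Omega> p) (sobolev_space0 \<Omega> p)) A \<ge> enat k}"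

definition variational_eigenvalue ::
    "'a::euclidean_space set \<Rightarrow> ('a \<Rightarrow> real) \<Rightarrow> nat \<Rightarrow> real \<Rightarrow> real" where
  "variational_eigenvalue \<Omega> m k p =
     (INF A\<in>admissible_sets \<Omega> m k p. SUP u\<in>A. dirichlet_energy \<Omega> p u)"

end

(* Upper bound: k disjoint balls of radius r with centres c_i in Omega_+ carry the tents
   max(0, r - |x - c_i|); the combinations of these with coefficient vectors on the boundary of the
   cube [-1,1]^k form a compact symmetric family of 1-Lipschitz functions, of genus at least k by
   Borsuk-Ulam.  Any compact symmetric family of genus >= k of L-Lipschitz functions which are at
   most eta off Omega and reach b > eta somewhere on {m > 0} becomes, after truncation,
   mollification and normalisation, an admissible set for every large p, with energies at most B^p
   for every B > L / (b - eta).

   Existence of the limit: if an admissible set for one large exponent q has energies at most G^q,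
   then averaging over small cubes is an odd continuous map of it onto a family of the above kind
   with L / (b - eta) close to G, by Morrey's inequality.  So a bound on the q-th root of the
   eigenvalue at a single large q transfers to all large p, and limsup <= liminf. *)
theory Submission
  imports Defs "HOL-Homology.Homology" "HOL-Library.Z2" "HOL-Computational_Algebra.Polynomial"
begin

text \<open>The obstacle is that admissible sets for different exponents live in different spaces.
  Bounded continuous functions with the sup norm are the common ground: averaging leads into it from
  exponent \<open>q\<close>, mollification leads out of it into the test functions for every
  \<open>p\<close>. Both maps are odd and continuous, and the genus cannot drop under such maps.
  Factors independent of \<open>p\<close> are harmless throughout, because their \<open>p\<close>-th
  roots tend to 1; only the bases of the exponentials count. This is also how the negative part of
  \<open>m\<close> is overcome: it suffices that the functions are smaller, by a fixed ratio, where
  \<open>m\<close> is not positive than on some small ball where it is. At a fixed side length,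
  averages over cubes depend on \<open>u\<close> continuously from the Sobolev norm to the sup norm.
  This is why every estimate can be proved for test functions and then passed on to all of
  \<open>W0\<close>, where no pointwise values are available. Borsuk-Ulam enters through mod-2 cup
  products of sign cochains: for an odd map into too few coordinates the top product would vanish on
  a finely subdivided hemisphere, although its value there is 1.\<close>

section \<open>The Borsuk--Ulam theorem\<close>

text \<open>Otherwise the simplifier turns ring operations on bits into Boolean ones.\<close>

declare add_bit_eq_xor [simp del] mult_bit_eq_and [simp del] power_bit_unfold [simp del]

section \<open>Mod-2 cochains evaluated on integral singular chains\<close>

lemma bit_add_self [simp]: "(x::bit) + x = 0"
  by (cases x) auto

lemma bit_add_self_left [simp]: "(x::bit) + (x + y) = y"
  by (simp flip: add.assoc)

text \<open>The pairing of a mod-2 cochain with an integral chain. Coefficients are reduced only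
  here, so the chains, boundaries and subdivisions of integral homology apply unchanged while all
  signs disappear from the values.\<close>

definition chain_eval :: "('b \<Rightarrow> bit) \<Rightarrow> ('b \<Rightarrow>\<^sub>0 int) \<Rightarrow> bit" where
  "chain_eval w c = (\<Sum>f\<in>Poly_Mapping.keys c. of_int (Poly_Mapping.lookup c f) * w f)"

lemma chain_eval_superset:
  assumes "finite K" "Poly_Mapping.keys c \<subseteq> K"
  shows "chain_eval w c = (\<Sum>f\<in>K. of_int (Poly_Mapping.lookup c f) * w f)"
  unfolding chain_eval_def
  by (rule sum.mono_neutral_left) (use assms in \<open>auto simp: in_keys_iff\<close>)

lemma chain_eval_0 [simp]: "chain_eval w 0 = 0"
  by (simp add: chain_eval_def)

lemma chain_eval_of [simp]: "chain_eval w (frag_of f) = w f"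
  by (simp add: chain_eval_def)

lemma chain_eval_add: "chain_eval w (c + d) = chain_eval w c + chain_eval w d"
proof -
  let ?K = "Poly_Mapping.keys c \<union> Poly_Mapping.keys d"
  have "chain_eval w (c + d) = (\<Sum>f\<in>?K. of_int (Poly_Mapping.lookup (c + d) f) * w f)"
    by (rule chain_eval_superset) (auto simp: keys_add)
  moreover have "chain_eval w c = (\<Sum>f\<in>?K. of_int (Poly_Mapping.lookup c f) * w f)"
    by (rule chain_eval_superset) auto
  moreover have "chain_eval w d = (\<Sum>f\<in>?K. of_int (Poly_Mapping.lookup d f) * w f)"
    by (rule chain_eval_superset) auto
  ultimately show ?thesis
    by (simp add: lookup_add sum.distrib distrib_right)
qed

lemma chain_eval_cmul: "chain_eval w (frag_cmul a c) = of_int a * chain_eval w c"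
proof -
  have "chain_eval w (frag_cmul a c)
      = (\<Sum>f\<in>Poly_Mapping.keys c. of_int (Poly_Mapping.lookup (frag_cmul a c) f) * w f)"
    by (rule chain_eval_superset) (auto simp: keys_cmul)
  then show ?thesis
    by (simp add: chain_eval_def sum_distrib_left mult.assoc)
qed

lemma chain_eval_sum: "chain_eval w (sum g I) = (\<Sum>i\<in>I. chain_eval w (g i))"
  by (induction I rule: infinite_finite_induct) (simp_all add: chain_eval_add)

lemma chain_eval_extend: "chain_eval w (frag_extend F c) = chain_eval (\<lambda>f. chain_eval w (F f)) c"
proof -
  have "chain_eval w (frag_extend F c)
      = (\<Sum>i\<in>Poly_Mapping.keys c. of_int (Poly_Mapping.lookup c i) * chain_eval w (F i))"
    by (simp add: frag_extend_def chain_eval_sum chain_eval_cmul)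
  then show ?thesis
    by (simp only: chain_eval_def[of "\<lambda>f. chain_eval w (F f)"])
qed

lemma chain_eval_cong:
  "(\<And>f. f \<in> Poly_Mapping.keys c \<Longrightarrow> w f = w' f) \<Longrightarrow> chain_eval w c = chain_eval w' c"
  by (simp add: chain_eval_def)

lemma chain_eval_fun_add:
  "chain_eval (\<lambda>f. w f + w' f) c = chain_eval w c + chain_eval w' c"
  by (simp add: chain_eval_def distrib_left sum.distrib)

section \<open>Cup products of coboundaries and the antipodal map\<close>

lemma simplicial_vertex_face:
  assumes "k \<le> Suc p" "i \<le> p"
  shows "simplicial_vertex i (singular_face (Suc p) k f)
       = simplicial_vertex (if i < k then i else Suc i) f"
proof -
  have "simplical_face k (\<lambda>j. if j = i then 1 else 0)
      = (\<lambda>j. if j = (if i < k then i else Suc i) then 1 else (0::real))"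
    using assms by (auto simp: simplical_face_def fun_eq_iff)
  then show ?thesis
    using assms by (simp add: simplicial_vertex_def singular_face_def)
qed

lemma simplicial_vertex_simplex_map:
  "i \<le> p \<Longrightarrow> simplicial_vertex i (simplex_map p g f) = g (simplicial_vertex i f)"
  by (simp add: simplicial_vertex_def simplex_map_def)

text \<open>The cup product of the coboundaries of the mod-2 cochains \<open>a 0, \<dots>, a (d - 1)\<close>,
  on a simplex with vertices \<open>v 0, \<dots>, v d\<close>. When each \<open>a i\<close> records the sign of an odd function,
  this represents a power of the generator of the first cohomology of projective space.\<close>

definition cup_coboundary :: "(nat \<Rightarrow> 'a \<Rightarrow> bit) \<Rightarrow> nat \<Rightarrow> (nat \<Rightarrow> 'a) \<Rightarrow> bit" where
  "cup_coboundary a d v = (\<Prod>i<d. a i (v i) + a i (v (Suc i)))"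

text \<open>Induction on \<open>d\<close>. Omitting one of the vertices \<open>0, ..., d\<close>
  leaves the new last factor unchanged. The two remaining faces agree in all other factors, and
  their last factors add up to that same factor, so it can be pulled out of the whole sum.\<close>

lemma cup_coboundary_cocycle:
  "(\<Sum>k\<le>Suc d. cup_coboundary a d (\<lambda>i. v (if i < k then i else Suc i))) = 0"
proof (induction d)
  case 0
  show ?case by (simp add: cup_coboundary_def)
next
  case (Suc d)
  let ?x = "\<lambda>k i. v (if i < k then i else Suc i)"
  let ?W = "\<lambda>d k. cup_coboundary a d (?x k)"
  let ?b = "a d (v (Suc d)) + a d (v (Suc (Suc d)))"
  have low: "?W (Suc d) k = ?W d k * ?b" if "k \<le> d" for k
    using that by (simp add: cup_coboundary_def mult.commute)
  have top: "?W d (Suc d) = ?W d (Suc (Suc d))"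
    unfolding cup_coboundary_def by (rule prod.cong) auto
  have 1: "?W (Suc d) (Suc d) = ?W d (Suc d) * (a d (v d) + a d (v (Suc (Suc d))))"
    by (simp add: cup_coboundary_def mult.commute)
  have 2: "?W (Suc d) (Suc (Suc d)) = ?W d (Suc (Suc d)) * (a d (v d) + a d (v (Suc d)))"
    by (simp add: cup_coboundary_def mult.commute)
  have "?W (Suc d) (Suc d) + ?W (Suc d) (Suc (Suc d)) = ?W d (Suc d) * ?b"
    unfolding 1 2 top by (cases "a d (v d)"; cases "a d (v (Suc d))"; cases "a d (v (Suc (Suc d)))") auto
  then have "(\<Sum>k\<le>Suc (Suc d). ?W (Suc d) k) = (\<Sum>k\<le>d. ?W d k * ?b) + ?W d (Suc d) * ?b"
    by (simp add: add.assoc) (rule sum.cong, auto simp: low)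
  also have "\<dots> = (\<Sum>k\<le>Suc d. ?W d k) * ?b"
    by (simp add: sum_distrib_right distrib_right)
  finally show ?case using Suc by simp
qed

text \<open>The Leibniz rule: the first factor is a cocycle, so only \<open>a d\<close>, evaluated
  at the last vertex of each face, is differentiated. That last vertex is \<open>Suc d\<close> on
  every face except the one that omits it.\<close>

lemma cup_coboundary_coboundary:
  "(\<Sum>k\<le>Suc d. cup_coboundary a d (\<lambda>i. v (if i < k then i else Suc i))
        * a d (v (if d < k then d else Suc d)))
   = cup_coboundary a (Suc d) v"
proof -
  let ?W = "\<lambda>k. cup_coboundary a d (\<lambda>i. v (if i < k then i else Suc i))"
  have top: "?W (Suc d) = cup_coboundary a d v"
    unfolding cup_coboundary_def by (rule prod.cong) auto
  have "(\<Sum>k\<le>d. ?W k) + ?W (Suc d) = 0"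
    using cup_coboundary_cocycle[of a d v] by simp
  then have low: "(\<Sum>k\<le>d. ?W k) = ?W (Suc d)"
    by (cases "?W (Suc d)"; cases "(\<Sum>k\<le>d. ?W k)") auto
  have "(\<Sum>k\<le>Suc d. ?W k * a d (v (if d < k then d else Suc d)))
      = (\<Sum>k\<le>d. ?W k) * a d (v (Suc d)) + ?W (Suc d) * a d (v d)"
    by (simp add: sum_distrib_right)
  also have "\<dots> = cup_coboundary a (Suc d) v"
    unfolding low top by (simp add: cup_coboundary_def algebra_simps)
  finally show ?thesis .
qed

text \<open>Its coboundary is \<open>cup_coboundary a (Suc d)\<close>, and it changes by \<open>cup_coboundary a d\<close> under
  the antipodal map; so the value of \<open>cup_coboundary\<close> on a hemisphere does not depend on the dimension.\<close>

definition hemisphere_cochain :: "(nat \<Rightarrow> 'a \<Rightarrow> bit) \<Rightarrow> nat \<Rightarrow> ((nat \<Rightarrow> real) \<Rightarrow> 'a) \<Rightarrow> bit" where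
  "hemisphere_cochain a d f = cup_coboundary a d (\<lambda>i. simplicial_vertex i f) * a d (simplicial_vertex d f)"

lemma cup_coboundary_cong:
  "(\<And>i. i \<le> d \<Longrightarrow> v i = v' i) \<Longrightarrow> cup_coboundary a d v = cup_coboundary a d v'"
  unfolding cup_coboundary_def by (rule prod.cong) auto

text \<open>Stokes' formula for the hemisphere cochain; the alternating signs of the boundary are
  all 1 modulo 2.\<close>

lemma chain_eval_boundary:
  "chain_eval (hemisphere_cochain a d) (chain_boundary (Suc d) c)
   = chain_eval (\<lambda>f. cup_coboundary a (Suc d) (\<lambda>i. simplicial_vertex i f)) c"
proof -
  have "(\<Sum>k\<le>Suc d. chain_eval (hemisphere_cochain a d) (frag_cmul ((-1) ^ k) (frag_of (singular_face (Suc d) k f))))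
      = cup_coboundary a (Suc d) (\<lambda>i. simplicial_vertex i f)" for f
  proof -
    have "chain_eval (hemisphere_cochain a d) (frag_cmul ((-1) ^ k) (frag_of (singular_face (Suc d) k f)))
      = cup_coboundary a d (\<lambda>i. simplicial_vertex (if i < k then i else Suc i) f)
        * a d (simplicial_vertex (if d < k then d else Suc d) f)" if "k \<le> Suc d" for k
      using that
      by (simp add: chain_eval_cmul hemisphere_cochain_def simplicial_vertex_face cong: cup_coboundary_cong)
    then show ?thesis
      using cup_coboundary_coboundary[of a d "\<lambda>i. simplicial_vertex i f"]
      by (simp del: sum.atMost_Suc power_Suc)
  qed
  then show ?thesis
    by (simp add: chain_boundary_def chain_eval_extend chain_eval_sum del: sum.atMost_Suc)
qed

text \<open>The antipodal map changes both terms of each difference in the cup product by 1, so the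
  product is invariant; only the extra factor \<open>a d\<close> changes, and by exactly 1.\<close>

lemma chain_eval_antipodal:
  assumes anti: "\<And>i x. x \<in> topspace X \<Longrightarrow> a i (g x) = a i x + 1" and c: "singular_chain d X c"
  shows "chain_eval (hemisphere_cochain a d) c + chain_eval (hemisphere_cochain a d) (chain_map d g c)
       = chain_eval (\<lambda>f. cup_coboundary a d (\<lambda>i. simplicial_vertex i f)) c"
proof -
  have "hemisphere_cochain a d f + hemisphere_cochain a d (simplex_map d g f)
      = cup_coboundary a d (\<lambda>i. simplicial_vertex i f)" if "f \<in> Poly_Mapping.keys c" for f
  proof -
    have f: "singular_simplex d X f" using c that by (auto simp: singular_chain_def)
    have top: "simplicial_vertex i f \<in> topspace X" if "i \<le> d" for i
    proof -
      have "f \<in> standard_simplex d \<rightarrow> topspace X"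
        using f by (auto simp: singular_simplex_def continuous_map_def)
      then show ?thesis using that by (auto simp: simplicial_vertex_def)
    qed
    have "a i (g (simplicial_vertex i f)) + a i (g (simplicial_vertex (Suc i) f))
        = a i (simplicial_vertex i f) + a i (simplicial_vertex (Suc i) f)" if "i < d" for i
      using that anti[OF top, of i] anti[OF top, of "Suc i"]
      by (cases "a i (simplicial_vertex i f)"; cases "a i (simplicial_vertex (Suc i) f)") auto
    then have "cup_coboundary a d (\<lambda>i. simplicial_vertex i (simplex_map d g f))
       = cup_coboundary a d (\<lambda>i. simplicial_vertex i f)"
      unfolding cup_coboundary_def by (intro prod.cong) (auto simp: simplicial_vertex_simplex_map)
    then show ?thesis
      using anti[OF top, of d]
      by (simp add: hemisphere_cochain_def simplicial_vertex_simplex_map)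
         (cases "a d (simplicial_vertex d f)"; auto)
  qed
  then show ?thesis
    by (simp add: chain_map_def chain_eval_extend chain_eval_fun_add[symmetric] comp_def)
       (rule chain_eval_cong, simp)
qed

text \<open>Here \<open>c d\<close> plays the \<open>d\<close>-dimensional hemisphere: its boundary
  consists of the hemisphere one dimension lower and the antipodal copy of that. Stokes followed by
  the antipodal formula descends one dimension, and in dimension 0 the cup product is empty, hence
  1.\<close>

lemma cochain_tower:
  assumes g: "\<And>x. x \<in> topspace X \<Longrightarrow> g x \<in> topspace X"
    and anti: "\<And>i x. x \<in> topspace X \<Longrightarrow> a i (g x) = a i x + 1"
    and c: "\<And>d. d \<le> n \<Longrightarrow> singular_chain d X (c d)"
    and bd: "\<And>d. d < n \<Longrightarrow>
      chain_boundary (Suc d) (c (Suc d)) = c d + frag_cmul ((-1) ^ Suc d) (chain_map d g (c d))"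
    and "d \<le> n"
  shows "chain_eval (\<lambda>f. cup_coboundary a d (\<lambda>i. simplicial_vertex i f)) (c d)
       = chain_eval (\<lambda>_. 1) (c 0)"
  using \<open>d \<le> n\<close>
proof (induction d)
  case 0
  then show ?case by (simp add: cup_coboundary_def)
next
  case (Suc d)
  then show ?case
    using chain_eval_antipodal[of X a g d "c d", OF anti c] bd[of d]
    by (simp add: chain_eval_boundary[symmetric] chain_eval_add chain_eval_cmul)
qed

section \<open>Hemispheres and spheres as simplicial chains in punctured Euclidean space\<close>

definition antipode :: "(nat \<Rightarrow> real) \<Rightarrow> nat \<Rightarrow> real" where
  "antipode x = (\<lambda>i. - x i)"

definition punctured_span :: "nat \<Rightarrow> (nat \<Rightarrow> real) set" where
  "punctured_span n = {x. (\<forall>i\<ge>n. x i = 0) \<and> x \<noteq> (\<lambda>_. 0)}"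

abbreviation "unit_vec i \<equiv> (\<lambda>j. if j = i then 1 else (0::real))"

text \<open>A segment from the new unit vector to a nonzero point of the old span avoids the origin:
  unless \<open>u = 1\<close> its last coordinate is nonzero, and at \<open>u = 1\<close> it is at
  \<open>x\<close>. Coning therefore never leaves the punctured space.\<close>

lemma punctured_span_cone:
  assumes "0 \<le> u" "u \<le> 1" "x \<in> punctured_span n"
  shows "(\<lambda>i. (1 - u) * unit_vec n i + u * x i) \<in> punctured_span (Suc n)"
proof -
  obtain j where j: "x j \<noteq> 0" "j < n"
    using assms by (force simp: punctured_span_def)
  have "(1 - u) * unit_vec n n + u * x n \<noteq> 0 \<or> (1 - u) * unit_vec n j + u * x j \<noteq> 0"
    using assms j by (cases "u = 1") (auto simp: punctured_span_def)
  then have "(\<lambda>i. (1 - u) * unit_vec n i + u * x i) \<noteq> (\<lambda>_. 0)"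
    unfolding fun_eq_iff by blast
  then show ?thesis
    using assms by (simp add: punctured_span_def)
qed

lemma simplicial_chain_antipode:
  assumes "simplicial_chain p S c" "\<And>x. x \<in> S \<Longrightarrow> antipode x \<in> S"
  shows "simplicial_chain p S (chain_map p antipode c)"
  using assms(1) unfolding simplicial_chain_def
proof (induction rule: frag_induction)
  case (one f)
  then obtain l where l: "f = oriented_simplex p l" and im: "f ` standard_simplex p \<subseteq> S"
    by (auto simp: simplicial_simplex)
  have "simplex_map p antipode f = oriented_simplex p (\<lambda>i. - l i)"
    by (auto simp: l antipode_def simplex_map_def oriented_simplex_def fun_eq_iff sum_negf)
  moreover have "simplex_map p antipode f ` standard_simplex p \<subseteq> S"
    using im assms(2) by (auto simp: simplex_map_def)
  ultimately show ?case
    unfolding simplicial_simplex by simp blast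
next
  case (diff a b)
  then show ?case
    unfolding chain_map_diff by (metis simplicial_chain_def simplicial_chain_diff)
qed simp

lemma antipode_punctured_span: "x \<in> punctured_span n \<Longrightarrow> antipode x \<in> punctured_span n"
  by (auto simp: punctured_span_def antipode_def fun_eq_iff)

text \<open>The next hemisphere is the cone from a new pole over the whole sphere below. The
  antipodal map has degree \<open>(-1) ^ Suc d\<close> on that sphere, and with this sign the two
  hemispheres fit together to a cycle. The simplices are affine, so the spheres are octahedral
  rather than round.\<close>

primrec hemisphere_chain :: "nat \<Rightarrow> (nat \<Rightarrow> real) chain" where
  "hemisphere_chain 0 = frag_of (oriented_simplex 0 (\<lambda>_. unit_vec 0))"
| "hemisphere_chain (Suc d) = simplicial_cone d (unit_vec (Suc d))
     (hemisphere_chain d + frag_cmul ((-1) ^ Suc d) (chain_map d antipode (hemisphere_chain d)))"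

abbreviation "sphere_chain d \<equiv>
  hemisphere_chain d + frag_cmul ((-1) ^ Suc d) (chain_map d antipode (hemisphere_chain d))"

lemma punctured_span_mono: "m \<le> n \<Longrightarrow> punctured_span m \<subseteq> punctured_span n"
  by (auto simp: punctured_span_def)

lemma simplicial_chain_mono:
  "\<lbrakk>simplicial_chain p S c; S \<subseteq> T\<rbrakk> \<Longrightarrow> simplicial_chain p T c"
  unfolding simplicial_chain_def simplicial_simplex by blast

lemma simplicial_chain_add:
  "\<lbrakk>simplicial_chain p S c1; simplicial_chain p S c2\<rbrakk> \<Longrightarrow> simplicial_chain p S (c1 + c2)"
  unfolding simplicial_chain_def using keys_add[of c1 c2] by blast

lemma hemisphere_chain:
  "simplicial_chain d (punctured_span (Suc d)) (hemisphere_chain d)"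
proof (induction d)
  case 0
  have "(\<lambda>i. unit_vec 0 i * x 0) \<in> punctured_span (Suc 0)" if "x \<in> standard_simplex 0" for x
    using that by (auto simp: standard_simplex_def punctured_span_def fun_eq_iff intro!: exI[of _ 0])
  then show ?case
    by (auto simp: simplicial_simplex_oriented_simplex)
next
  case (Suc d)
  then show ?case
    by (auto intro!: simplicial_chain_simplicial_cone[where S="punctured_span (Suc d)"]
        simplicial_chain_add simplicial_chain_cmul simplicial_chain_antipode
        antipode_punctured_span punctured_span_cone)
qed

lemma simplicial_sphere_chain: "simplicial_chain d (punctured_span (Suc d)) (sphere_chain d)"
  by (intro simplicial_chain_add simplicial_chain_cmul simplicial_chain_antipode
      antipode_punctured_span hemisphere_chain)

lemma chain_map_antipode_antipode:
  assumes "simplicial_chain p S c"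
  shows "chain_map p antipode (chain_map p antipode c) = c"
proof -
  have "chain_map p (antipode \<circ> antipode) c = c"
  proof (rule chain_map_id_gen)
    show "singular_chain p (subtopology (powertop_real UNIV) S) c"
      using assms by (rule simplicial_imp_singular_chain)
  qed (auto simp: antipode_def)
  then show ?thesis by (simp add: chain_map_compose)
qed

lemma singular_hemisphere_chain:
  assumes "d < n"
  shows "singular_chain d (subtopology (powertop_real UNIV) (punctured_span n)) (hemisphere_chain d)"
  by (rule simplicial_imp_singular_chain, rule simplicial_chain_mono[OF hemisphere_chain])
     (use assms in \<open>auto intro!: punctured_span_mono\<close>)

text \<open>The boundary of a cone is its base minus the cone over the boundary of the base, so the
  base must be shown to be a cycle. By induction its boundary is a lower sphere plus a signed
  antipodal copy; the antipodal map multiplies that sphere by the opposite sign, and the two terms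
  cancel.\<close>

lemma boundary_hemisphere_chain:
  "chain_boundary (Suc d) (hemisphere_chain (Suc d)) = sphere_chain d"
proof -
  have bd: "chain_boundary (Suc d) (hemisphere_chain (Suc d)) = sphere_chain d
    - (if d = 0 then frag_extend (\<lambda>f. frag_of (\<lambda>u\<in>standard_simplex d. unit_vec (Suc d))) (sphere_chain d)
       else simplicial_cone (d - 1) (unit_vec (Suc d)) (chain_boundary d (sphere_chain d)))" for d
    using chain_boundary_simplicial_cone[OF simplicial_sphere_chain[of d], of "unit_vec (Suc d)"] by simp
  show ?thesis
  proof (induction d)
    case 0
    then show ?case
      unfolding bd by (simp add: frag_extend_diff)
  next
    case (Suc d)
    let ?s = "(-1) ^ Suc d :: int"
    let ?h = "hemisphere_chain d"
    have sc: "singular_chain (Suc d) (subtopology (powertop_real UNIV) (punctured_span (Suc (Suc d))))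
        (hemisphere_chain (Suc d))"
      by (rule singular_hemisphere_chain) simp
    have "chain_boundary (Suc d) (sphere_chain (Suc d))
        = sphere_chain d + frag_cmul (- ?s) (chain_map d antipode (sphere_chain d))"
      using Suc chain_boundary_chain_map[OF sc, of antipode]
      by (simp add: chain_boundary_add chain_boundary_cmul del: hemisphere_chain.simps)
    also have "chain_map d antipode (sphere_chain d) = chain_map d antipode ?h + frag_cmul ?s ?h"
      by (simp add: chain_map_add chain_map_antipode_antipode[OF hemisphere_chain])
    also have "sphere_chain d + frag_cmul (- ?s) \<dots> = 0"
    proof -
      have "frag_cmul (- a) x + frag_cmul a x = 0" for a and x :: "(nat \<Rightarrow> real) chain"
        by (simp flip: frag_cmul_distrib)
      then show ?thesis
        by (simp add: frag_cmul_distrib2 flip: power_mult_distrib)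
    qed
    finally show ?case
      unfolding bd[of "Suc d"] by (simp add: simplicial_cone_def del: hemisphere_chain.simps)
  qed
qed

section \<open>Compatibility of iterated subdivision with boundaries and the antipodal map\<close>

lemma iterated_subdivision_singular_chain:
  "singular_chain p X c \<Longrightarrow> singular_chain p X ((singular_subdivision p ^^ n) c)"
  by (induction n) (auto simp: singular_chain_singular_subdivision)

lemma iterated_subdivision_boundary:
  assumes "singular_chain (Suc p) X c"
  shows "chain_boundary (Suc p) ((singular_subdivision (Suc p) ^^ n) c)
       = (singular_subdivision p ^^ n) (chain_boundary (Suc p) c)"
  by (induction n)
     (simp_all add: chain_boundary_singular_subdivision[OF iterated_subdivision_singular_chain[OF assms]])

lemma iterated_subdivision_chain_map:
  assumes "singular_chain p X c"
  shows "(singular_subdivision p ^^ n) (chain_map p g c) = chain_map p g ((singular_subdivision p ^^ n) c)"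
  by (induction n)
     (simp_all add: naturality_singular_subdivision[OF iterated_subdivision_singular_chain[OF assms]])

lemma iterated_subdivision_add:
  "(singular_subdivision p ^^ n) (c + frag_cmul a d)
   = (singular_subdivision p ^^ n) c + frag_cmul a ((singular_subdivision p ^^ n) d)"
  by (induction n) (simp_all add: singular_subdivision_def frag_extend_add frag_extend_cmul)

text \<open>If \<open>j < k\<close>, hemispheres up to dimension \<open>j\<close> exist in the
  source. The tower of hemispheres gives the \<open>j\<close>-fold product of sign coboundaries the
  value 1 on the top one, and subdividing all of them equally often preserves the relations of the
  tower. Fine subdivision makes the same value 0.\<close>

theorem borsuk_ulam:
  assumes cont: "continuous_map (subtopology (Euclidean_space k) (- {\<lambda>_. 0}))
                   (subtopology (Euclidean_space j) (- {\<lambda>_. 0})) \<phi>"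
    and odd: "\<And>v. v \<in> topspace (Euclidean_space k) \<Longrightarrow> v \<noteq> (\<lambda>_. 0) \<Longrightarrow> \<phi> (- v) = - \<phi> v"
  shows "k \<le> j"
proof (rule ccontr)
  assume "\<not> k \<le> j"
  then have jk: "j < k" by simp
  define X where "X = subtopology (powertop_real UNIV) (punctured_span k)"
  have X: "subtopology (Euclidean_space k) (- {\<lambda>_. 0}) = X"
    unfolding X_def Euclidean_space_def subtopology_subtopology
    by (rule arg_cong[where f="subtopology _"]) (auto simp: punctured_span_def)
  have topX: "topspace X = punctured_span k"
    by (simp add: X_def)
  have oddX: "\<phi> (antipode v) = - \<phi> v" if "v \<in> topspace X" for v
    using odd[of v] that
    by (auto simp: topX punctured_span_def topspace_Euclidean_space antipode_def fun_Compl_def)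
  have comp: "continuous_map X euclideanreal (\<lambda>x. \<phi> x i)" for i
    using cont[unfolded X] unfolding Euclidean_space_def continuous_map_in_subtopology continuous_map_componentwise_UNIV
    by simp
  have nz: "\<exists>i<j. \<phi> x i \<noteq> 0" if "x \<in> topspace X" for x
  proof -
    have "\<phi> x \<in> topspace (subtopology (Euclidean_space j) (- {\<lambda>_. 0}))"
      using cont that unfolding X by (auto simp: continuous_map_def)
    then show ?thesis
      by (auto simp: topspace_Euclidean_space fun_eq_iff) (meson not_less)
  qed
  txt \<open>The odd sign \<open>s\<close> breaks ties where a coordinate of \<open>\<phi>\<close> vanishes. After subdivision some
    coordinate has constant sign on each simplex, so one factor of the cup product vanishes.\<close>
  define s :: "(nat \<Rightarrow> real) \<Rightarrow> bool" where "s x \<longleftrightarrow> x (LEAST i. x i \<noteq> 0) > (0::real)" for x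
  have s: "s (antipode x) \<longleftrightarrow> \<not> s x" if "x \<in> topspace X" for x
  proof -
    obtain i where "x i \<noteq> 0"
      using \<open>x \<in> topspace X\<close> by (auto simp: topX punctured_span_def)
    then have "x (LEAST i. x i \<noteq> 0) \<noteq> 0"
      by (rule LeastI)
    then show ?thesis by (auto simp: s_def antipode_def)
  qed
  define a where "a i x = (of_bool (\<phi> x i > 0 \<or> \<phi> x i = 0 \<and> s x) :: bit)" for i x
  have anti: "a i (antipode x) = a i x + 1" if "x \<in> topspace X" for i x
    using s[OF that] by (auto simp: a_def oddX[OF that])
  \<comment> \<open>The sets on which some fixed coordinate of \<open>\<phi>\<close> has a fixed
    strict sign. They cover, since \<open>\<phi>\<close> has no zero, and subdivision makes every
    simplex subordinate to them.\<close>
  define \<C> where "\<C> = (\<Union>i<j. {{x \<in> topspace X. \<phi> x i \<in> {0<..}}, {x \<in> topspace X. \<phi> x i \<in> {..<0}}})"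
  have pre: "openin X {x \<in> topspace X. \<phi> x i \<in> T}" if "open T" for T i
    using openin_continuous_map_preimage[OF comp] that by (simp flip: open_openin)
  have opn: "openin X U" if "U \<in> \<C>" for U
    using that pre[of "{0<..}"] pre[of "{..<0}"] unfolding \<C>_def by auto
  have cover: "topspace X \<subseteq> \<Union>\<C>"
  proof
    fix x assume "x \<in> topspace X"
    then show "x \<in> \<Union>\<C>"
      using nz[of x] by (auto simp: \<C>_def neq_iff)
  qed
  have hc: "singular_chain d X (hemisphere_chain d)" if "d \<le> j" for d
    unfolding X_def using that jk by (intro singular_hemisphere_chain) auto
  obtain N where N: "\<And>m f. \<lbrakk>N \<le> m; f \<in> Poly_Mapping.keys ((singular_subdivision j ^^ m) (hemisphere_chain j))\<rbrakk>
                      \<Longrightarrow> \<exists>V \<in> \<C>. f \<in> (standard_simplex j) \<rightarrow> V"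
    using sufficient_iterated_singular_subdivision_exists[OF opn cover hc[OF order_refl]] by blast
  define c where "c d = (singular_subdivision d ^^ N) (hemisphere_chain d)" for d
  have cup: "cup_coboundary a j (\<lambda>i. simplicial_vertex i f) = 0" if f: "f \<in> Poly_Mapping.keys (c j)" for f
  proof -
    obtain V where V: "V \<in> \<C>" "f \<in> standard_simplex j \<rightarrow> V"
      using N[of N f] f by (auto simp: c_def)
    obtain i where i: "i < j" "V = {x \<in> topspace X. \<phi> x i \<in> {0<..}} \<or> V = {x \<in> topspace X. \<phi> x i \<in> {..<0}}"
      using V(1) by (auto simp: \<C>_def)
    have "simplicial_vertex i f \<in> V" "simplicial_vertex (Suc i) f \<in> V"
      using V(2) i(1) by (auto simp: simplicial_vertex_def Pi_def)
    then have "a i (simplicial_vertex i f) + a i (simplicial_vertex (Suc i) f) = 0"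
      using i(2) by (auto simp: a_def)
    then show ?thesis
      using i(1) unfolding cup_coboundary_def by (intro prod_zero) auto
  qed
  have "chain_eval (\<lambda>f. cup_coboundary a j (\<lambda>i. simplicial_vertex i f)) (c j) = chain_eval (\<lambda>_. 1) (c 0)"
  proof (rule cochain_tower[where X=X and g=antipode and n=j])
    show "antipode x \<in> topspace X" if "x \<in> topspace X" for x
      using that by (simp add: topX antipode_punctured_span)
    show "singular_chain d X (c d)" if "d \<le> j" for d
      unfolding c_def by (rule iterated_subdivision_singular_chain[OF hc[OF that]])
    show "chain_boundary (Suc d) (c (Suc d)) = c d + frag_cmul ((-1) ^ Suc d) (chain_map d antipode (c d))"
      if "d < j" for d
      unfolding c_def
      using that iterated_subdivision_boundary[OF hc[of "Suc d"], of N]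
      by (simp add: boundary_hemisphere_chain iterated_subdivision_add
          iterated_subdivision_chain_map[OF hc[of d]] del: hemisphere_chain.simps power_Suc)
  qed (use anti in auto)
  moreover have "chain_eval (\<lambda>f. cup_coboundary a j (\<lambda>i. simplicial_vertex i f)) (c j) = 0"
    by (subst chain_eval_cong[where w'="\<lambda>_. 0"]) (auto simp: cup chain_eval_def)
  moreover have "chain_eval (\<lambda>_. 1) (c 0) = 1"
  proof -
    have "(singular_subdivision 0 ^^ n) (hemisphere_chain 0) = hemisphere_chain 0" for n
      by (induction n) (simp_all add: singular_subdivision_zero[OF hc[of 0]] del: hemisphere_chain.simps)
    then show ?thesis by (simp add: c_def)
  qed
  ultimately show False by simp
qed

section \<open>Smooth functions\<close>

lemma Ck_fun_SucI:
  assumes "\<And>x. (f has_derivative D x) (at x)" "\<And>b. b \<in> Basis \<Longrightarrow> Ck_fun k (\<lambda>x. D x b)"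
  shows "Ck_fun (Suc k) f"
proof -
  have "frechet_derivative f (at x) = D x" for x
    by (rule frechet_derivative_at[OF assms(1), symmetric])
  moreover have "f differentiable (at x)" for x
    using assms(1)[of x] unfolding differentiable_def by blast
  ultimately show ?thesis
    using assms(2) by simp
qed

lemma Ck_fun_Suc_has_derivative:
  "Ck_fun (Suc k) f \<Longrightarrow> (f has_derivative frechet_derivative f (at x)) (at x)"
  by (simp add: frechet_derivative_works)

lemma Ck_fun_Suc_imp: "Ck_fun (Suc k) f \<Longrightarrow> Ck_fun k f"
proof (induction k arbitrary: f)
  case 0
  then show ?case
    by (simp add: continuous_on_eq_continuous_at differentiable_imp_continuous_within)
next
  case (Suc k)
  show ?case
    using Suc.prems Suc.IH by (subst Ck_fun.simps(2)) (blast dest: Ck_fun.simps(2)[THEN iffD1])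
qed

lemma Ck_fun_const [simp]: "Ck_fun k (\<lambda>x. c)"
proof (induction k arbitrary: c)
  case (Suc k)
  show ?case by (rule Ck_fun_SucI[where D="\<lambda>_ _. 0"]) (use Suc in auto)
qed simp

lemma Ck_fun_add:
  "Ck_fun k f \<Longrightarrow> Ck_fun k g \<Longrightarrow> Ck_fun k (\<lambda>x. f x + g x)"
proof (induction k arbitrary: f g)
  case 0
  then show ?case by (simp add: continuous_on_add)
next
  case (Suc k)
  note der = Ck_fun_Suc_has_derivative[OF Suc.prems(1)] Ck_fun_Suc_has_derivative[OF Suc.prems(2)]
  show ?case
    by (rule Ck_fun_SucI[OF has_derivative_add[OF der]]) (use Suc in simp)
qed

lemma Ck_fun_mult:
  "Ck_fun k f \<Longrightarrow> Ck_fun k g \<Longrightarrow> Ck_fun k (\<lambda>x. f x * g x)"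
proof (induction k arbitrary: f g)
  case 0
  then show ?case by (simp add: continuous_on_mult)
next
  case (Suc k)
  note der = Ck_fun_Suc_has_derivative[OF Suc.prems(1)] Ck_fun_Suc_has_derivative[OF Suc.prems(2)]
  have "Ck_fun k f" "Ck_fun k g"
    by (fact Ck_fun_Suc_imp[OF Suc.prems(1)] Ck_fun_Suc_imp[OF Suc.prems(2)])+
  then show ?case
    by (intro Ck_fun_SucI[OF has_derivative_mult[OF der]] Ck_fun_add Suc.IH) (use Suc.prems in auto)
qed

lemma smooth_fun_const [simp]: "smooth_fun (\<lambda>x. c)"
  by (simp add: smooth_fun_def)

lemma smooth_fun_add: "smooth_fun f \<Longrightarrow> smooth_fun g \<Longrightarrow> smooth_fun (\<lambda>x. f x + g x)"
  by (simp add: smooth_fun_def Ck_fun_add)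

lemma smooth_fun_mult: "smooth_fun f \<Longrightarrow> smooth_fun g \<Longrightarrow> smooth_fun (\<lambda>x. f x * g x)"
  by (simp add: smooth_fun_def Ck_fun_mult)

lemma smooth_fun_prod: "(\<And>i. i \<in> I \<Longrightarrow> smooth_fun (f i)) \<Longrightarrow> smooth_fun (\<lambda>x. \<Prod>i\<in>I. f i x)"
  by (induction I rule: infinite_finite_induct) (auto intro: smooth_fun_mult)

lemma smooth_fun_has_derivative:
  "smooth_fun f \<Longrightarrow> (f has_derivative frechet_derivative f (at x)) (at x)"
  unfolding smooth_fun_def using Ck_fun_Suc_has_derivative by blast

lemma smooth_fun_partial:
  "smooth_fun f \<Longrightarrow> b \<in> Basis \<Longrightarrow> smooth_fun (\<lambda>x. frechet_derivative f (at x) b)"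
  unfolding smooth_fun_def using Ck_fun.simps(2) by blast

lemma smooth_fun_continuous: "smooth_fun f \<Longrightarrow> continuous_on UNIV f"
  unfolding smooth_fun_def using Ck_fun.simps(1) by blast

section \<open>Flat functions and smooth bumps on boxes\<close>

text \<open>Closed under differentiation, which gives smoothness.\<close>

definition flat_fun :: "real poly \<Rightarrow> real \<Rightarrow> real" where
  "flat_fun P t = (if t > 0 then poly P (1 / t) * exp (- (1 / t)) else 0)"

lemma poly_times_exp_neg_tendsto_0: "((\<lambda>x::real. poly P x * exp (- x)) \<longlongrightarrow> 0) at_top"
proof -
  have "((\<lambda>x::real. \<Sum>i\<le>Polynomial.degree P. Polynomial.coeff P i * (x ^ i / exp x)) \<longlongrightarrow> (\<Sum>i\<le>Polynomial.degree P. Polynomial.coeff P i * 0)) at_top"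
    by (intro tendsto_sum tendsto_mult tendsto_const tendsto_power_div_exp_0)
  then show ?thesis
    by (simp add: poly_altdef sum_distrib_right exp_minus divide_inverse mult.assoc)
qed

text \<open>For positive \<open>t\<close> the product rule gives \<open>1 / t^2\<close> times
  \<open>P - P'\<close> at \<open>1 / t\<close>; the polynomial \<open>[:0, 0, 1:]\<close> supplies
  this square. At 0 the difference quotient from the right is the flat function of
  \<open>pCons 0 P\<close>, which tends to 0 like polynomial times decaying exponential.\<close>

lemma flat_fun_deriv:
  "(flat_fun P has_real_derivative flat_fun ([:0, 0, 1:] * (P - pderiv P)) t) (at t)"
proof -
  consider "t < 0" | "t = 0" | "t > 0" by linarith
  then show ?thesis
  proof cases
    case 1
    have "((\<lambda>_. 0) has_real_derivative 0) (at t)" by simp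
    then have "(flat_fun P has_real_derivative 0) (at t)"
      by (rule has_field_derivative_transform_within_open[where S="{..<0}"])
         (use 1 in \<open>auto simp: flat_fun_def\<close>)
    then show ?thesis using 1 by (simp add: flat_fun_def)
  next
    case 2
    have "((\<lambda>h. flat_fun P h / h) \<longlongrightarrow> 0) (at_right 0)"
    proof -
      have "((\<lambda>h. (inverse h * poly P (inverse h)) * exp (- inverse h)) \<longlongrightarrow> 0) (at_right (0::real))"
        using filterlim_compose[OF poly_times_exp_neg_tendsto_0[of "pCons 0 P"] filterlim_inverse_at_top_right]
        by simp
      moreover have "\<forall>\<^sub>F h in at_right 0. (inverse h * poly P (inverse h)) * exp (- inverse h) = flat_fun P h / h"
        by (rule eventually_at_rightI[of 0 1]) (simp_all add: flat_fun_def inverse_eq_divide)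
      ultimately show ?thesis by (rule Lim_transform_eventually)
    qed
    moreover have "((\<lambda>h. flat_fun P h / h) \<longlongrightarrow> 0) (at_left 0)"
    proof (rule Lim_transform_eventually[OF tendsto_const])
      show "\<forall>\<^sub>F h in at_left 0. 0 = flat_fun P h / h"
        by (rule eventually_at_leftI[of "-1"]) (simp_all add: flat_fun_def)
    qed
    ultimately have "((\<lambda>h. flat_fun P h / h) \<longlongrightarrow> 0) (at 0)"
      by (rule filterlim_split_at[rotated])
    then show ?thesis
      using 2 by (simp add: DERIV_def flat_fun_def)
  next
    case 3
    have inv: "((\<lambda>t. 1 / t) has_real_derivative - (1 / t\<^sup>2)) (at t)"
      using 3 by (auto intro!: derivative_eq_intros simp: power2_eq_square)
    have "((\<lambda>t. poly P (1 / t) * exp (- (1 / t))) has_real_derivative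
        poly P (1 / t) * (exp (- (1 / t)) * (1 / t\<^sup>2)) + poly (pderiv P) (1 / t) * (- (1 / t\<^sup>2)) * exp (- (1 / t))) (at t)"
      using DERIV_mult[OF DERIV_chain2[OF poly_DERIV inv] DERIV_chain2[OF DERIV_exp DERIV_minus[OF inv]], of P]
      by (simp add: mult.commute)
    then have "(flat_fun P has_real_derivative
        poly P (1 / t) * (exp (- (1 / t)) * (1 / t\<^sup>2)) + poly (pderiv P) (1 / t) * (- (1 / t\<^sup>2)) * exp (- (1 / t))) (at t)"
      by (rule has_field_derivative_transform_within_open[where S="{0<..}"])
         (use 3 in \<open>auto simp: flat_fun_def\<close>)
    then show ?thesis
      using 3 by (simp add: flat_fun_def power2_eq_square algebra_simps)
  qed
qed

lemma smooth_fun_flat: "smooth_fun (\<lambda>x. flat_fun P (x \<bullet> a + d))"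
proof -
  have der: "((\<lambda>x. flat_fun P (x \<bullet> a + d)) has_derivative
      (\<lambda>h. flat_fun ([:0, 0, 1:] * (P - pderiv P)) (x \<bullet> a + d) * (h \<bullet> a))) (at x)" for P x
  proof (rule has_derivative_compose[of "\<lambda>x. x \<bullet> a + d" "\<lambda>h. h \<bullet> a" x UNIV "flat_fun P",
        OF _ flat_fun_deriv[unfolded has_field_derivative_def]])
    show "((\<lambda>x. x \<bullet> a + d) has_derivative (\<lambda>h. h \<bullet> a)) (at x)"
      by (auto intro!: derivative_eq_intros)
  qed
  have "Ck_fun k (\<lambda>x. flat_fun P (x \<bullet> a + d))" for k
  proof (induction k arbitrary: P)
    case 0
    show ?case
      using der by (auto intro!: continuous_at_imp_continuous_on has_derivative_continuous)
  next
    case (Suc k)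
    show ?case
      by (rule Ck_fun_SucI[OF der]) (intro Ck_fun_mult Suc Ck_fun_const)
  qed
  then show ?thesis by (simp add: smooth_fun_def)
qed

text \<open>The parameter \<open>j\<close> is a steepness. For every positive \<open>j\<close> the
  bump is nonzero exactly on the open box, while its values there tend to 1 as \<open>j\<close>
  grows, so indicators of boxes become limits of smooth functions bounded by 1.\<close>

definition box_bump :: "real \<Rightarrow> 'a::euclidean_space \<Rightarrow> 'a \<Rightarrow> 'a \<Rightarrow> real" where
  "box_bump j a c x =
     (\<Prod>b\<in>Basis. flat_fun 1 (j * (x \<bullet> b - a \<bullet> b)) * flat_fun 1 (j * (c \<bullet> b - x \<bullet> b)))"

lemma flat_fun_1: "0 \<le> flat_fun 1 t" "flat_fun 1 t \<le> 1" "flat_fun 1 t > 0 \<longleftrightarrow> t > 0"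
  by (auto simp: flat_fun_def)

lemma smooth_fun_box_bump: "smooth_fun (box_bump j a c)"
proof -
  have "smooth_fun (\<lambda>x. flat_fun 1 (j * (x \<bullet> b - a \<bullet> b)))" for b
    using smooth_fun_flat[of 1 "j *\<^sub>R b" "- j * (a \<bullet> b)"] by (simp add: algebra_simps)
  moreover have "smooth_fun (\<lambda>x. flat_fun 1 (j * (c \<bullet> b - x \<bullet> b)))" for b
    using smooth_fun_flat[of 1 "- j *\<^sub>R b" "j * (c \<bullet> b)"] by (simp add: algebra_simps)
  ultimately show ?thesis
    unfolding box_bump_def by (intro smooth_fun_prod smooth_fun_mult)
qed

lemma box_bump_nonneg: "0 \<le> box_bump j a c x"
  unfolding box_bump_def by (intro prod_nonneg mult_nonneg_nonneg flat_fun_1)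

lemma box_bump_le_1: "box_bump j a c x \<le> 1"
  unfolding box_bump_def by (intro prod_le_1 conjI mult_nonneg_nonneg mult_le_one flat_fun_1)

lemma box_bump_pos_iff:
  assumes "j > 0" shows "box_bump j a c x \<noteq> 0 \<longleftrightarrow> x \<in> box a c"
proof -
  have "flat_fun 1 t \<noteq> 0 \<longleftrightarrow> t > 0" for t
    by (auto simp: flat_fun_def)
  then show ?thesis
    using assms by (auto simp: box_bump_def box_def zero_less_mult_iff)
qed

lemma box_bump_tendsto:
  "(\<lambda>j. box_bump (real j) a c x) \<longlonglongrightarrow> indicator (box a c) x"
proof (cases "x \<in> box a c")
  case True
  have lim: "(\<lambda>j. flat_fun 1 (real j * t)) \<longlonglongrightarrow> 1" if "t > 0" for t
  proof -
    have "(\<lambda>j. exp (- (1 / (real j * t)))) \<longlonglongrightarrow> exp (- 0)"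
    proof (intro tendsto_exp tendsto_minus)
      have "(\<lambda>j. (1 / t) * (1 / real j)) \<longlonglongrightarrow> (1 / t) * 0"
        by (intro tendsto_mult tendsto_const lim_1_over_n)
      then show "(\<lambda>j. 1 / (real j * t)) \<longlonglongrightarrow> 0" by (simp add: mult.commute)
    qed
    moreover have "\<forall>\<^sub>F j in sequentially. exp (- (1 / (real j * t))) = flat_fun 1 (real j * t)"
      using eventually_gt_at_top[of 0] by eventually_elim (use that in \<open>auto simp: flat_fun_def\<close>)
    ultimately show ?thesis by (auto intro: Lim_transform_eventually)
  qed
  have "(\<lambda>j. box_bump (real j) a c x) \<longlonglongrightarrow> (\<Prod>b\<in>(Basis::'a set). 1 * 1)"
    unfolding box_bump_def
    by (intro tendsto_prod tendsto_mult lim) (use True in \<open>auto simp: box_def\<close>)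
  then show ?thesis using True by simp
next
  case False
  have "\<forall>\<^sub>F j in sequentially. 0 = box_bump (real j) a c x"
    using eventually_gt_at_top[of 0]
  proof eventually_elim
    case (elim j)
    then show ?case using False box_bump_pos_iff[of "real j" a c x] by auto
  qed
  then show ?thesis
    using False by (auto intro: Lim_transform_eventually[OF tendsto_const])
qed

text \<open>Differentiation under the integral puts every derivative on \<open>\<psi>\<close>, while
  \<open>w\<close> stays merely continuous. A partial derivative is thus a convolution with a
  partial derivative of \<open>\<psi>\<close>, and smoothness follows by induction over the order
  for all \<open>\<psi>\<close> at once.\<close>

lemma smooth_fun_convolution:
  fixes w \<psi> :: "'a::euclidean_space \<Rightarrow> real"
  assumes w: "continuous_on UNIV w" and \<psi>: "smooth_fun \<psi>"
  shows "((\<lambda>x. integral (cbox a c) (\<lambda>y. w y * \<psi> (x - y))) has_derivative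
           (\<lambda>h. integral (cbox a c) (\<lambda>y. w y * frechet_derivative \<psi> (at (x - y)) h))) (at x)" (is ?der)
    and "smooth_fun (\<lambda>x. integral (cbox a c) (\<lambda>y. w y * \<psi> (x - y)))" (is ?smooth)
proof -
  have cont: "continuous_on UNIV (\<lambda>z. frechet_derivative \<psi> (at z) h)" if "smooth_fun \<psi>" for \<psi> :: "'a \<Rightarrow> real" and h
  proof -
    have lin: "linear (frechet_derivative \<psi> (at z))" for z
      using smooth_fun_has_derivative[OF that, of z] has_derivative_linear by blast
    have "frechet_derivative \<psi> (at z) h = (\<Sum>b\<in>Basis. (h \<bullet> b) * frechet_derivative \<psi> (at z) b)" for z
      using linear_sum[OF lin[of z], of "\<lambda>b. (h \<bullet> b) *\<^sub>R b" Basis]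
      by (simp add: linear_cmul[OF lin] euclidean_representation)
    then show ?thesis
      by (simp add: continuous_on_sum continuous_on_mult smooth_fun_continuous[OF smooth_fun_partial[OF that]])
  qed
  have der: "((\<lambda>x. integral (cbox a c) (\<lambda>y. w y * \<psi> (x - y))) has_derivative
           (\<lambda>h. integral (cbox a c) (\<lambda>y. w y * frechet_derivative \<psi> (at (x - y)) h))) (at x)"
    if \<psi>: "smooth_fun \<psi>" for \<psi> :: "'a \<Rightarrow> real" and x
  proof -
    \<comment> \<open>The derivative is packaged as a bounded linear map, because differentiation
      under the integral asks for continuity in operator norm; in finite dimension this can be
      checked on basis vectors.\<close>
    define D where "D x y = w y *\<^sub>R Blinfun (frechet_derivative \<psi> (at (x - y)))" for x y
    have bl: "bounded_linear (frechet_derivative \<psi> (at z))" for z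
      using smooth_fun_has_derivative[OF \<psi>] has_derivative_bounded_linear by blast
    have D: "blinfun_apply (D x y) h = w y * frechet_derivative \<psi> (at (x - y)) h" for x y h
      by (simp add: D_def blinfun.scaleR_left bounded_linear_Blinfun_apply[OF bl])
    have contD: "continuous_on (UNIV \<times> cbox a c) (\<lambda>(x, y). D x y)"
    proof (rule continuous_on_blinfun_componentwise)
      fix i :: 'a assume "i \<in> Basis"
      show "continuous_on (UNIV \<times> cbox a c) (\<lambda>p. blinfun_apply (case p of (x, y) \<Rightarrow> D x y) i)"
        unfolding split_beta D
        by (intro continuous_intros continuous_on_compose2[OF w] continuous_on_compose2[OF cont[OF \<psi>]]) auto
    qed
    have "((\<lambda>x. integral (cbox a c) (\<lambda>y. w y * \<psi> (x - y))) has_derivative integral (cbox a c) (D x)) (at x within UNIV)"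
    proof (rule leibniz_rule[OF _ _ contD])
      fix x y
      have "((\<lambda>x. \<psi> (x - y)) has_derivative frechet_derivative \<psi> (at (x - y))) (at x)"
      proof (rule has_derivative_compose[of "\<lambda>x. x - y" "\<lambda>h. h" x UNIV \<psi>, OF _ smooth_fun_has_derivative[OF \<psi>]])
        show "((\<lambda>x. x - y) has_derivative (\<lambda>h. h)) (at x)"
          by (auto intro!: derivative_eq_intros)
      qed
      then show "((\<lambda>x. w y * \<psi> (x - y)) has_derivative blinfun_apply (D x y)) (at x within UNIV)"
        unfolding D by (auto intro!: derivative_eq_intros)
    next
      fix x show "(\<lambda>y. w y * \<psi> (x - y)) integrable_on cbox a c"
        by (intro integrable_continuous continuous_intros continuous_on_subset[OF w]
            continuous_on_compose2[OF smooth_fun_continuous[OF \<psi>]]) auto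
    qed auto
    moreover {
    have "blinfun_apply (integral (cbox a c) (D x)) h
        = integral (cbox a c) (\<lambda>y. w y * frechet_derivative \<psi> (at (x - y)) h)" for h
    proof -
      have "continuous_on (cbox a c) (D x)"
        using continuous_on_compose2[OF contD, of "cbox a c" "\<lambda>y. (x, y)"]
        by (simp add: continuous_on_Pair image_subset_iff)
      then show ?thesis
        by (subst blinfun_apply_integral) (auto simp: D integrable_continuous)
    qed
    then have "blinfun_apply (integral (cbox a c) (D x))
        = (\<lambda>h. integral (cbox a c) (\<lambda>y. w y * frechet_derivative \<psi> (at (x - y)) h))" by (rule ext)
    }
    ultimately show ?thesis by simp
  qed
  show ?der by (rule der[OF \<psi>])
  have "Ck_fun k (\<lambda>x. integral (cbox a c) (\<lambda>y. w y * \<psi> (x - y)))" if "smooth_fun \<psi>" for k and \<psi> :: "'a \<Rightarrow> real"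
    using that
  proof (induction k arbitrary: \<psi>)
    case 0
    show ?case
      using der[OF 0] by (auto intro!: continuous_at_imp_continuous_on has_derivative_continuous)
  next
    case (Suc k)
    show ?case
      by (rule Ck_fun_SucI[OF der[OF Suc.prems]]) (intro Suc.IH smooth_fun_partial Suc.prems)
  qed
  then show ?smooth using \<psi> by (simp add: smooth_fun_def)
qed

section \<open>Test functions and integration by parts\<close>

definition gradient :: "('a::euclidean_space \<Rightarrow> real) \<Rightarrow> 'a \<Rightarrow> 'a" where
  "gradient f x = (\<Sum>b\<in>Basis. frechet_derivative f (at x) b *\<^sub>R b)"

lemma gradient_inner_Basis: "b \<in> Basis \<Longrightarrow> gradient f x \<bullet> b = frechet_derivative f (at x) b"
  by (simp add: gradient_def inner_sum_left inner_Basis if_distrib cong: if_cong)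

lemma frechet_derivative_eq_gradient:
  assumes "smooth_fun f"
  shows "frechet_derivative f (at x) h = gradient f x \<bullet> h"
proof -
  have lin: "linear (frechet_derivative f (at x))"
    using smooth_fun_has_derivative[OF assms] has_derivative_linear by blast
  have "frechet_derivative f (at x) h = (\<Sum>b\<in>Basis. (h \<bullet> b) * frechet_derivative f (at x) b)"
    using linear_sum[OF lin, of "\<lambda>b. (h \<bullet> b) *\<^sub>R b" Basis]
    by (simp add: linear_cmul[OF lin] euclidean_representation)
  then show ?thesis
    by (simp add: gradient_def inner_sum_left inner_commute[of h] mult.commute)
qed

lemma smooth_fun_has_derivative_gradient:
  assumes "smooth_fun f"
  shows "(f has_derivative (\<lambda>h. gradient f x \<bullet> h)) (at x)"
proof -
  have "frechet_derivative f (at x) = (\<lambda>h. gradient f x \<bullet> h)"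
    by (rule ext) (rule frechet_derivative_eq_gradient[OF assms])
  then show ?thesis
    using smooth_fun_has_derivative[OF assms, of x] by simp
qed

lemma gradient_eqI:
  assumes "smooth_fun f" "(f has_derivative (\<lambda>h. v \<bullet> h)) (at x)"
  shows "gradient f x = v"
proof -
  have "(\<lambda>h. gradient f x \<bullet> h) = (\<lambda>h. v \<bullet> h)"
    by (rule has_derivative_unique[OF smooth_fun_has_derivative_gradient[OF assms(1)] assms(2)])
  then have "\<forall>h. gradient f x \<bullet> h = v \<bullet> h" by (simp add: fun_eq_iff)
  then show ?thesis by (simp only: vector_eq_rdot)
qed

lemma continuous_on_gradient: "smooth_fun f \<Longrightarrow> continuous_on S (gradient f)"
  unfolding gradient_def
  by (intro continuous_on_sum continuous_on_scaleR continuous_on_const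
      continuous_on_subset[OF smooth_fun_continuous[OF smooth_fun_partial]]) auto

lemma gradient_add: "smooth_fun f \<Longrightarrow> smooth_fun g \<Longrightarrow> gradient (\<lambda>x. f x + g x) x = gradient f x + gradient g x"
  by (rule gradient_eqI[OF smooth_fun_add])
     (auto simp: inner_add_left intro!: has_derivative_add smooth_fun_has_derivative_gradient)

lemma gradient_cmul: "smooth_fun f \<Longrightarrow> gradient (\<lambda>x. c * f x) x = c *\<^sub>R gradient f x"
  by (rule gradient_eqI[OF smooth_fun_mult])
     (auto intro!: has_derivative_mult_right smooth_fun_has_derivative_gradient)

lemma gradient_zero_outside:
  assumes "smooth_fun f" "x \<notin> closure {x. f x \<noteq> 0}"
  shows "gradient f x = 0"
proof (rule gradient_eqI[OF assms(1)])
  have "((\<lambda>_. 0) has_derivative (\<lambda>h. 0 \<bullet> h)) (at x)" by simp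
  then show "(f has_derivative (\<lambda>h. 0 \<bullet> h)) (at x)"
  proof (rule has_derivative_transform_within_open[where s="- closure {x. f x \<noteq> 0}"])
    show "0 = f y" if "y \<in> - closure {x. f x \<noteq> 0}" for y
      using that closure_subset[of "{x. f x \<noteq> 0}"] by auto
  qed (use assms in auto)
qed

lemma test_functionsI:
  assumes "smooth_fun f" "compact K" "K \<subseteq> \<Omega>" "\<And>x. x \<notin> K \<Longrightarrow> f x = 0"
  shows "f \<in> test_functions \<Omega>"
proof -
  have sub: "closure {x. f x \<noteq> 0} \<subseteq> K"
    using assms by (intro closure_minimal compact_imp_closed) auto
  then have "compact (closure {x. f x \<noteq> 0})"
    using compact_Int_closed[OF assms(2), of "closure {x. f x \<noteq> 0}"] by (simp add: Int_absorb1)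
  then show ?thesis using assms sub by (auto simp: test_functions_def)
qed

lemma test_functionsE:
  assumes "f \<in> test_functions \<Omega>"
  obtains K where "smooth_fun f" "compact K" "K \<subseteq> \<Omega>" "\<And>x. x \<notin> K \<Longrightarrow> f x = 0" "\<And>x. x \<notin> K \<Longrightarrow> gradient f x = 0"
proof
  show "smooth_fun f" "compact (closure {x. f x \<noteq> 0})" "closure {x. f x \<noteq> 0} \<subseteq> \<Omega>"
    using assms by (auto simp: test_functions_def)
  show "f x = 0" if "x \<notin> closure {x. f x \<noteq> 0}" for x
    using that closure_subset[of "{x. f x \<noteq> 0}"] by auto
  show "gradient f x = 0" if "x \<notin> closure {x. f x \<noteq> 0}" for x
    using gradient_zero_outside that assms by (auto simp: test_functions_def)
qed

lemma test_functions_smooth: "f \<in> test_functions \<Omega> \<Longrightarrow> smooth_fun f"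
  by (simp add: test_functions_def)

lemma test_functions_add:
  assumes "f \<in> test_functions \<Omega>" "g \<in> test_functions \<Omega>"
  shows "(\<lambda>x. f x + g x) \<in> test_functions \<Omega>"
proof -
  obtain K where K: "smooth_fun f" "compact K" "K \<subseteq> \<Omega>" "\<And>x. x \<notin> K \<Longrightarrow> f x = 0"
      "\<And>x. x \<notin> K \<Longrightarrow> gradient f x = 0"
    by (rule test_functionsE[OF assms(1)]) (rule that)
  obtain L where L: "smooth_fun g" "compact L" "L \<subseteq> \<Omega>" "\<And>x. x \<notin> L \<Longrightarrow> g x = 0"
      "\<And>x. x \<notin> L \<Longrightarrow> gradient g x = 0"
    by (rule test_functionsE[OF assms(2)]) (rule that)
  show ?thesis
    by (rule test_functionsI[of _ "K \<union> L"]) (use K L in \<open>auto intro: smooth_fun_add\<close>)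
qed

lemma test_functions_mult:
  assumes "f \<in> test_functions \<Omega>" "smooth_fun g"
  shows "(\<lambda>x. g x * f x) \<in> test_functions \<Omega>"
proof -
  obtain K where K: "smooth_fun f" "compact K" "K \<subseteq> \<Omega>" "\<And>x. x \<notin> K \<Longrightarrow> f x = 0"
      "\<And>x. x \<notin> K \<Longrightarrow> gradient f x = 0"
    by (rule test_functionsE[OF assms(1)]) (rule that)
  show ?thesis
    by (rule test_functionsI[of _ K]) (use K assms(2) in \<open>auto intro: smooth_fun_mult\<close>)
qed

lemma test_functions_cmul: "f \<in> test_functions \<Omega> \<Longrightarrow> (\<lambda>x. c * f x) \<in> test_functions \<Omega>"
  by (simp add: test_functions_mult)

section \<open>Integration of compactly supported functions and integration by parts\<close>

lemma integrable_lebesgue_on_supported: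
  fixes f :: "'a::euclidean_space \<Rightarrow> 'b::euclidean_space"
  assumes "S \<in> sets lebesgue" "\<And>x. x \<notin> S \<Longrightarrow> f x = 0"
  shows "integrable (lebesgue_on S) f \<longleftrightarrow> integrable lebesgue f"
    and "integral\<^sup>L (lebesgue_on S) f = integral\<^sup>L lebesgue f"
proof -
  have "(\<lambda>x. indicator S x *\<^sub>R f x) = f"
    using assms(2) by (auto simp: indicator_def fun_eq_iff)
  then show "integrable (lebesgue_on S) f \<longleftrightarrow> integrable lebesgue f"
    and "integral\<^sup>L (lebesgue_on S) f = integral\<^sup>L lebesgue f"
    using assms(1) by (simp_all add: integrable_restrict_space integral_restrict_space)
qed

lemma integrable_continuous_compact_support:
  fixes f :: "'a::euclidean_space \<Rightarrow> 'b::euclidean_space"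
  assumes "continuous_on UNIV f" "compact K" "\<And>x. x \<notin> K \<Longrightarrow> f x = 0"
  shows "integrable lebesgue f"
proof -
  obtain a c where ac: "K \<subseteq> cbox a c"
    using bounded_subset_cbox_symmetric compact_imp_bounded[OF assms(2)] by metis
  have "integrable (lebesgue_on (cbox a c)) f"
    by (intro continuous_imp_integrable continuous_on_subset[OF assms(1)]) auto
  then show ?thesis
    by (subst (asm) integrable_lebesgue_on_supported) (use ac assms(3) in auto)
qed

lemma integrable_compact_support_scaleR:
  fixes g :: "'a::euclidean_space \<Rightarrow> 'b::euclidean_space"
  assumes g: "locally_integrable S g" and f: "continuous_on UNIV f"
    and K: "compact K" "K \<subseteq> S" "\<And>x. x \<notin> K \<Longrightarrow> f x = 0"
  shows "integrable lebesgue (\<lambda>x. (f x :: real) *\<^sub>R g x)"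
proof -
  have gK: "integrable (lebesgue_on K) g"
    using g K by (auto simp: locally_integrable_def)
  have Kl: "K \<in> sets lebesgue" using K by (simp add: lmeasurable_compact fmeasurableD)
  obtain B where B: "\<And>x. x \<in> K \<Longrightarrow> \<bar>f x\<bar> \<le> B"
    using compact_imp_bounded[OF compact_continuous_image[OF continuous_on_subset[OF f] K(1)]]
    by (auto simp: bounded_iff)
  have meas: "f \<in> borel_measurable (lebesgue_on K)"
    using f by (intro continuous_imp_measurable_on_sets_lebesgue Kl continuous_on_subset[OF f]) auto
  have "integrable (lebesgue_on K) (\<lambda>x. f x *\<^sub>R g x)"
  proof (rule Bochner_Integration.integrable_bound)
    show "integrable (lebesgue_on K) (\<lambda>x. B *\<^sub>R g x)" using gK by simp
    show "(\<lambda>x. f x *\<^sub>R g x) \<in> borel_measurable (lebesgue_on K)"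
      using meas gK by (intro borel_measurable_scaleR) auto
    show "AE x in lebesgue_on K. norm (f x *\<^sub>R g x) \<le> norm (B *\<^sub>R g x)"
      by (rule AE_I2) (use B in \<open>force simp: space_restrict_space intro!: mult_right_mono\<close>)
  qed
  then show ?thesis
    by (subst (asm) integrable_lebesgue_on_supported) (use Kl K in auto)
qed

lemma integral_translation:
  fixes f :: "'a::euclidean_space \<Rightarrow> real"
  assumes "f \<in> borel_measurable borel"
  shows "integral\<^sup>L lborel (\<lambda>x. f (v + x)) = integral\<^sup>L lborel f"
proof -
  have "integral\<^sup>L (distr lborel borel ((+) v)) f = integral\<^sup>L lborel (\<lambda>x. f (v + x))"
    by (rule integral_distr) (use assms in auto)
  then show ?thesis by (simp add: lborel_distr_plus)
qed

text \<open>The integral of \<open>f (x + t b)\<close> over \<open>x\<close> does not depend on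
  \<open>t\<close>, by translation invariance; differentiating it at \<open>t = 0\<close> under the
  integral yields the integral of the directional derivative.\<close>

lemma integral_derivative_compact_support:
  fixes f :: "'a::euclidean_space \<Rightarrow> real"
  assumes f: "smooth_fun f" "compact K" "\<And>x. x \<notin> K \<Longrightarrow> f x = 0"
  shows "integral\<^sup>L lebesgue (\<lambda>x. gradient f x \<bullet> b) = 0"
proof -
  have contf: "continuous_on S f" for S
    using smooth_fun_continuous[OF f(1)] continuous_on_subset by blast
  \<comment> \<open>This set contains the supports of all translates with \<open>t\<close> between
    -1 and 1, so one box serves as domain of integration for all of them.\<close>
  define K' where "K' = K \<union> (\<Union>t\<in>{-1..1}. (\<lambda>x. x - t *\<^sub>R b) ` K)"
  have "bounded K'"
  proof -
    obtain B where B: "\<And>x. x \<in> K \<Longrightarrow> norm x \<le> B"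
      using compact_imp_bounded[OF f(2)] by (auto simp: bounded_iff)
    have "norm y \<le> B + norm b" if y: "y \<in> K'" for y
    proof -
      have "norm (x - t *\<^sub>R b) \<le> B + norm b" if "x \<in> K" "t \<in> {-1..1}" for x t
      proof -
        have "norm (t *\<^sub>R b) \<le> norm b"
          using that by (auto simp: abs_le_iff intro!: mult_left_le_one_le)
        then show ?thesis
          using norm_triangle_ineq4[of x "t *\<^sub>R b"] B[OF that(1)] by linarith
      qed
      moreover have "norm x \<le> B + norm b" if "x \<in> K" for x
        using B[OF that] norm_ge_zero[of b] by linarith
      ultimately show ?thesis using y by (auto simp: K'_def)
    qed
    then show ?thesis by (auto simp: bounded_iff)
  qed
  then obtain p q where pq: "K' \<subseteq> cbox p q"
    using bounded_subset_cbox_symmetric by metis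
  have out: "f (x + t *\<^sub>R b) = 0" if "x \<notin> cbox p q" "t \<in> {-1<..<1}" for x t
  proof (rule f(3), rule notI)
    assume "x + t *\<^sub>R b \<in> K"
    then have "x \<in> (\<lambda>x. x - t *\<^sub>R b) ` K" by (intro image_eqI[of _ _ "x + t *\<^sub>R b"]) auto
    then have "x \<in> K'" using that unfolding K'_def by (intro UnI2 UN_I[of t]) auto
    then show False using that pq by auto
  qed
  have const: "integral (cbox p q) (\<lambda>x. f (x + t *\<^sub>R b)) = integral\<^sup>L lborel f" if t: "t \<in> {-1<..<1}" for t
  proof -
    have "((\<lambda>x. f (x + t *\<^sub>R b)) has_integral integral (cbox p q) (\<lambda>x. f (x + t *\<^sub>R b))) (cbox p q)"
      by (intro integrable_integral integrable_continuous continuous_on_compose2[OF contf[of UNIV]] continuous_intros) auto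
    then have "((\<lambda>x. f (x + t *\<^sub>R b)) has_integral integral (cbox p q) (\<lambda>x. f (x + t *\<^sub>R b))) UNIV"
      by (rule has_integral_on_superset) (use out t in auto)
    moreover have "integrable lborel (\<lambda>x. f (t *\<^sub>R b + x))"
    proof -
      have "integrable lebesgue (\<lambda>x. f (t *\<^sub>R b + x))"
      proof (rule integrable_continuous_compact_support[where K="cbox p q"])
        show "continuous_on UNIV (\<lambda>x. f (t *\<^sub>R b + x))"
          by (intro continuous_on_compose2[OF contf[of UNIV]] continuous_intros) auto
      qed (use out[OF _ t] in \<open>auto simp: add.commute\<close>)
      moreover have "(\<lambda>x. f (t *\<^sub>R b + x)) \<in> borel_measurable lborel"
        by (simp, intro borel_measurable_continuous_onI continuous_on_compose2[OF contf[of UNIV]] continuous_intros) auto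
      ultimately show ?thesis by (simp add: integrable_completion)
    qed
    then have "((\<lambda>x. f (t *\<^sub>R b + x)) has_integral integral\<^sup>L lborel (\<lambda>x. f (t *\<^sub>R b + x))) UNIV"
      by (rule has_integral_integral_lborel)
    moreover have "integral\<^sup>L lborel (\<lambda>x. f (t *\<^sub>R b + x)) = integral\<^sup>L lborel f"
      by (rule integral_translation) (intro borel_measurable_continuous_onI contf)
    ultimately show ?thesis
      by (simp only: add.commute[of "t *\<^sub>R b"]) (rule has_integral_unique)
  qed
  have "((\<lambda>t. integral (cbox p q) (\<lambda>x. f (x + t *\<^sub>R b))) has_field_derivative
      integral (cbox p q) (\<lambda>x. gradient f (x + 0 *\<^sub>R b) \<bullet> b)) (at 0 within {-1<..<1})"
  proof (rule leibniz_rule_field_derivative)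
    fix t x
    have "((\<lambda>t. f (x + t *\<^sub>R b)) has_derivative (\<lambda>h. gradient f (x + t *\<^sub>R b) \<bullet> (h *\<^sub>R b))) (at t within {-1<..<1})"
    proof (rule has_derivative_compose[of "\<lambda>t. x + t *\<^sub>R b" "\<lambda>h. h *\<^sub>R b" t _ f, OF _ smooth_fun_has_derivative_gradient[OF f(1)]])
      show "((\<lambda>t. x + t *\<^sub>R b) has_derivative (\<lambda>h. h *\<^sub>R b)) (at t within {-1<..<1})"
        by (auto intro!: derivative_eq_intros)
    qed
    then show "((\<lambda>t. f (x + t *\<^sub>R b)) has_field_derivative gradient f (x + t *\<^sub>R b) \<bullet> b) (at t within {-1<..<1})"
      by (simp add: has_field_derivative_def mult.commute[of _ "gradient f (x + t *\<^sub>R b) \<bullet> b"])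
  next
    show "(\<lambda>x. f (x + t *\<^sub>R b)) integrable_on cbox p q" for t
      by (intro integrable_continuous continuous_on_compose2[OF contf[of UNIV]] continuous_intros) auto
    show "continuous_on ({-1<..<1} \<times> cbox p q) (\<lambda>(t, x). gradient f (x + t *\<^sub>R b) \<bullet> b)"
      unfolding split_beta
      by (intro continuous_intros continuous_on_compose2[OF continuous_on_gradient[OF f(1), of UNIV]]) auto
  qed auto
  then have "((\<lambda>t. integral (cbox p q) (\<lambda>x. f (x + t *\<^sub>R b))) has_field_derivative
      integral (cbox p q) (\<lambda>x. gradient f x \<bullet> b)) (at 0)"
    by (subst (asm) at_within_open) auto
  moreover have "((\<lambda>t. integral (cbox p q) (\<lambda>x. f (x + t *\<^sub>R b))) has_field_derivative 0) (at 0)"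
    by (rule has_field_derivative_transform_within_open[where S="{-1<..<1}" and f="\<lambda>_. integral\<^sup>L lborel f"])
       (auto simp: const)
  ultimately have "integral (cbox p q) (\<lambda>x. gradient f x \<bullet> b) = 0"
    by (rule DERIV_unique)
  moreover have zero: "gradient f x = 0" if "x \<notin> cbox p q" for x
  proof (rule gradient_zero_outside[OF f(1)])
    have "closure {x. f x \<noteq> 0} \<subseteq> K"
      using f by (intro closure_minimal compact_imp_closed) auto
    then show "x \<notin> closure {x. f x \<noteq> 0}"
      using that pq by (auto simp: K'_def)
  qed
  moreover have "integral (cbox p q) (\<lambda>x. gradient f x \<bullet> b) = integral\<^sup>L lebesgue (\<lambda>x. gradient f x \<bullet> b)"
  proof -
    have "integrable lebesgue (\<lambda>x. gradient f x \<bullet> b)"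
      by (rule integrable_continuous_compact_support[of _ "cbox p q"])
         (intro continuous_intros continuous_on_gradient f, simp_all add: zero)
    then have "integral UNIV (\<lambda>x. gradient f x \<bullet> b) = integral\<^sup>L lebesgue (\<lambda>x. gradient f x \<bullet> b)"
      by (simp add: integral_lebesgue[symmetric])
    moreover have "integral UNIV (\<lambda>x. gradient f x \<bullet> b) = integral (cbox p q) (\<lambda>x. gradient f x \<bullet> b)"
    proof (rule integral_unique, rule has_integral_on_superset)
      show "((\<lambda>x. gradient f x \<bullet> b) has_integral integral (cbox p q) (\<lambda>x. gradient f x \<bullet> b)) (cbox p q)"
        by (intro integrable_integral integrable_continuous continuous_intros continuous_on_gradient f)
    qed (auto simp: zero)
    ultimately show ?thesis by simp
  qed
  ultimately show ?thesis by simp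
qed

lemma gradient_mult:
  assumes "smooth_fun f" "smooth_fun g"
  shows "gradient (\<lambda>x. f x * g x) x = f x *\<^sub>R gradient g x + g x *\<^sub>R gradient f x"
proof (rule gradient_eqI[OF smooth_fun_mult[OF assms]])
  show "((\<lambda>x. f x * g x) has_derivative (\<lambda>h. (f x *\<^sub>R gradient g x + g x *\<^sub>R gradient f x) \<bullet> h)) (at x)"
    using has_derivative_mult[OF assms[THEN smooth_fun_has_derivative_gradient]]
    by (simp add: inner_add_left mult.commute)
qed

lemma integrable_imp_locally_integrable:
  fixes g :: "'a::euclidean_space \<Rightarrow> 'b::euclidean_space"
  assumes "integrable lebesgue g" shows "locally_integrable S g"
  unfolding locally_integrable_def
proof (intro allI impI)
  fix K :: "'a set" assume "compact K \<and> K \<subseteq> S"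
  then have "K \<in> sets lebesgue" by (simp add: lmeasurable_compact fmeasurableD)
  then show "integrable (lebesgue_on K) g"
    using integrable_mult_indicator[OF _ assms, of K] by (simp add: integrable_restrict_space)
qed

text \<open>Integration by parts without boundary terms: the derivative of the compactly supported
  product of \<open>f\<close> and the test function integrates to 0.\<close>

lemma has_weak_gradient_test_function:
  fixes f :: "'a::euclidean_space \<Rightarrow> real"
  assumes "open \<Omega>" "f \<in> test_functions \<Omega>"
  shows "has_weak_gradient \<Omega> f (gradient f)"
proof -
  obtain K where K: "smooth_fun f" "compact K" "K \<subseteq> \<Omega>" "\<And>x. x \<notin> K \<Longrightarrow> f x = 0"
      "\<And>x. x \<notin> K \<Longrightarrow> gradient f x = 0"
    by (rule test_functionsE[OF assms(2)]) (rule that)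
  have \<Omega>: "\<Omega> \<in> sets lebesgue" using assms(1) by auto
  have "locally_integrable \<Omega> f"
    by (intro integrable_imp_locally_integrable integrable_continuous_compact_support[where K=K]
        smooth_fun_continuous K)
  moreover have "locally_integrable \<Omega> (gradient f)"
    by (intro integrable_imp_locally_integrable integrable_continuous_compact_support[where K=K]
        continuous_on_gradient K)
  moreover have "integral\<^sup>L (lebesgue_on \<Omega>) (\<lambda>x. f x * frechet_derivative \<phi> (at x) b)
      = - integral\<^sup>L (lebesgue_on \<Omega>) (\<lambda>x. (gradient f x \<bullet> b) * \<phi> x)"
    if \<phi>: "\<phi> \<in> test_functions \<Omega>" and b: "b \<in> Basis" for \<phi> b
  proof -
    have s\<phi>: "smooth_fun \<phi>" using \<phi> by (rule test_functions_smooth)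
    have int1: "integrable lebesgue (\<lambda>x. f x * (gradient \<phi> x \<bullet> b))"
      by (intro integrable_continuous_compact_support[where K=K] continuous_on_mult continuous_on_inner
          continuous_on_const smooth_fun_continuous[OF K(1)] smooth_fun_continuous[OF s\<phi>]
          continuous_on_gradient K(1,2) s\<phi>) (simp add: K(4,5))
    have int2: "integrable lebesgue (\<lambda>x. (gradient f x \<bullet> b) * \<phi> x)"
      by (intro integrable_continuous_compact_support[where K=K] continuous_on_mult continuous_on_inner
          continuous_on_const smooth_fun_continuous[OF K(1)] smooth_fun_continuous[OF s\<phi>]
          continuous_on_gradient K(1,2) s\<phi>) (simp add: K(4,5))
    have zero: "integral\<^sup>L lebesgue (\<lambda>x. gradient (\<lambda>x. f x * \<phi> x) x \<bullet> b) = 0"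
      by (rule integral_derivative_compact_support[where K=K])
         (simp_all add: K smooth_fun_mult[OF K(1) s\<phi>])
    have "integral\<^sup>L lebesgue (\<lambda>x. f x * (gradient \<phi> x \<bullet> b)) + integral\<^sup>L lebesgue (\<lambda>x. (gradient f x \<bullet> b) * \<phi> x) = 0"
    proof -
      have "gradient (\<lambda>x. f x * \<phi> x) x \<bullet> b = f x * (gradient \<phi> x \<bullet> b) + (gradient f x \<bullet> b) * \<phi> x" for x
        by (simp add: gradient_mult[OF K(1) s\<phi>] inner_add_left)
      then show ?thesis
        using zero Bochner_Integration.integral_add[OF int1 int2] by simp
    qed
    moreover have "integral\<^sup>L (lebesgue_on \<Omega>) (\<lambda>x. f x * frechet_derivative \<phi> (at x) b)
        = integral\<^sup>L lebesgue (\<lambda>x. f x * (gradient \<phi> x \<bullet> b))"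
      unfolding gradient_inner_Basis[OF b, symmetric]
    proof (rule integrable_lebesgue_on_supported(2)[OF \<Omega>])
      show "f x * (gradient \<phi> x \<bullet> b) = 0" if "x \<notin> \<Omega>" for x
      proof -
        have "f x = 0" using K(3) K(4)[of x] that by blast
        then show ?thesis by simp
      qed
    qed
    moreover have "integral\<^sup>L (lebesgue_on \<Omega>) (\<lambda>x. (gradient f x \<bullet> b) * \<phi> x)
        = integral\<^sup>L lebesgue (\<lambda>x. (gradient f x \<bullet> b) * \<phi> x)"
    proof (rule integrable_lebesgue_on_supported(2)[OF \<Omega>])
      show "(gradient f x \<bullet> b) * \<phi> x = 0" if "x \<notin> \<Omega>" for x
      proof -
        have "gradient f x = 0" using K(3) K(5)[of x] that by blast
        then show ?thesis by simp
      qed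
    qed
    ultimately show ?thesis by simp
  qed
  ultimately show ?thesis by (simp add: has_weak_gradient_def)
qed

text \<open>Boxes form an intersection-stable generator of the Borel sets, so the integral of a
  Borel version \<open>h\<close> vanishes over every Borel set, in particular over the sets where
  \<open>h\<close> is positive and where it is negative.\<close>

lemma integrable_all_boxes_zero_imp_AE_zero:
  fixes g :: "'a::euclidean_space \<Rightarrow> real"
  assumes g: "integrable lebesgue g" and zero: "\<And>a c. integral\<^sup>L lebesgue (\<lambda>x. indicator (box a c) x * g x) = 0"
  shows "AE x in lebesgue. g x = 0"
proof -
  obtain h where h: "h \<in> borel_measurable lborel" "AE x in lborel. g x = h x"
    using completion_ex_borel_measurable_real[of g lborel] g by auto
  have AEc: "AE x in lebesgue. g x = h x" using h(2) by (rule AE_completion)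
  have hl: "h \<in> borel_measurable lebesgue" using h(1) by (rule measurable_completion)
  have int_h: "integrable lborel h"
  proof -
    have "integrable lebesgue h"
      by (rule integrable_cong_AE_imp[OF g hl AEc])
    then show ?thesis using h(1) by (simp add: integrable_completion)
  qed
  have set_int: "set_integrable lborel A h" if "A \<in> sets borel" for A
    unfolding set_integrable_def using that int_h by (intro integrable_mult_indicator) auto
  have boxes: "set_lebesgue_integral lborel (box a c) h = 0" for a c
  proof -
    have "integral\<^sup>L lebesgue (\<lambda>x. indicator (box a c) x * h x) = integral\<^sup>L lebesgue (\<lambda>x. indicator (box a c) x * g x)"
    proof (rule integral_cong_AE)
      show "AE x in lebesgue. indicator (box a c) x * h x = indicator (box a c) x * g x"
        using AEc by eventually_elim simp
    qed (use g hl in \<open>auto intro!: borel_measurable_times borel_measurable_indicator\<close>)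
    moreover have "(\<lambda>x. indicator (box a c) x * h x) \<in> borel_measurable lborel"
      using h(1) by (auto intro!: borel_measurable_times borel_measurable_indicator)
    ultimately show ?thesis
      using zero[of a c] by (simp add: set_lebesgue_integral_def integral_completion)
  qed
  \<comment> \<open>The whole space is an increasing union of boxes; its integral is needed for
    complements in the induction over the generated sets.\<close>
  have all: "set_lebesgue_integral lborel UNIV h = 0"
  proof -
    have "(\<lambda>n. set_lebesgue_integral lborel (box (- (real n *\<^sub>R One)) (real n *\<^sub>R One)) h)
        \<longlonglongrightarrow> set_lebesgue_integral lborel (\<Union>n. box (- (real n *\<^sub>R One)) (real n *\<^sub>R One)) h"
    proof (rule set_integral_cont_up)
      show "incseq (\<lambda>n. box (- (real n *\<^sub>R One)) (real n *\<^sub>R (One::'a)))"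
        by (rule incseq_SucI) (auto simp: box_def)
    qed (auto intro: set_int)
    then show ?thesis
      by (simp add: boxes UN_box_eq_UNIV LIMSEQ_const_iff)
  qed
  have borel: "set_lebesgue_integral lborel A h = 0" if "A \<in> sets borel" for A
  proof -
    have Int: "Int_stable (range (\<lambda>(a, b). box a b :: 'a set))"
      by (auto simp: Int_stable_def box_Int_box)
    have sub: "range (\<lambda>(a, b). box a b :: 'a set) \<subseteq> Pow UNIV" by auto
    have A: "A \<in> sigma_sets UNIV (range (\<lambda>(a, b). box a b))"
      using that unfolding borel_eq_box by simp
    have meas: "B \<in> sets borel" if "B \<in> sigma_sets UNIV (range (\<lambda>(a, b). box a b :: 'a set))" for B
      using that unfolding borel_eq_box by simp
    show ?thesis
      using Int sub A
    proof (induction rule: sigma_sets_induct_disjoint)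
      case (basic A)
      then show ?case by (auto simp: boxes)
    next
      case empty
      show ?case by (simp add: set_lebesgue_integral_def)
    next
      case (compl A)
      have "set_lebesgue_integral lborel (A \<union> (UNIV - A)) h
          = set_lebesgue_integral lborel A h + set_lebesgue_integral lborel (UNIV - A) h"
        by (rule set_integral_Un) (use compl meas in \<open>auto intro: set_int\<close>)
      then show ?case using compl all by (simp add: Un_absorb1)
    next
      case (union A)
      have "set_lebesgue_integral lborel (\<Union>i. A i) h = suminf (\<lambda>i. set_lebesgue_integral lborel (A i) h)"
      proof (rule lebesgue_integral_countable_add)
        show "set_integrable lborel (\<Union>i. A i) h"
          by (rule set_int) (use union meas in \<open>auto simp: image_subset_iff\<close>)
        show "A i \<in> sets lborel" for i using union meas by auto
        show "i \<noteq> j \<Longrightarrow> A i \<inter> A j = {}" for i j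
          using union by (auto simp: disjoint_family_on_def)
      qed
      then show ?case using union by simp
    qed
  qed
  have "AE x in lborel. indicator {x. 0 < h x} x *\<^sub>R h x = 0"
  proof (subst integral_nonneg_eq_0_iff_AE[symmetric])
    have P: "{x. 0 < h x} \<in> sets borel" using h(1) by measurable
    show "integrable lborel (\<lambda>x. indicator {x. 0 < h x} x *\<^sub>R h x)"
      using set_int[OF P] by (simp add: set_integrable_def)
    show "integral\<^sup>L lborel (\<lambda>x. indicator {x. 0 < h x} x *\<^sub>R h x) = 0"
      using borel[OF P] by (simp add: set_lebesgue_integral_def)
  qed (auto simp: indicator_def)
  moreover have "AE x in lborel. - (indicator {x. h x < 0} x *\<^sub>R h x) = 0"
  proof (subst integral_nonneg_eq_0_iff_AE[symmetric])
    have P: "{x. h x < 0} \<in> sets borel" using h(1) by measurable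
    show "integrable lborel (\<lambda>x. - (indicator {x. h x < 0} x *\<^sub>R h x))"
      using set_int[OF P] by (simp add: set_integrable_def)
    show "integral\<^sup>L lborel (\<lambda>x. - (indicator {x. h x < 0} x *\<^sub>R h x)) = 0"
      using borel[OF P] by (simp add: set_lebesgue_integral_def)
  qed (auto simp: indicator_def)
  ultimately have "AE x in lborel. h x = 0"
    by eventually_elim (auto simp: indicator_def split: if_splits)
  then have "AE x in lebesgue. h x = 0" by (rule AE_completion)
  then show ?thesis using AEc by eventually_elim simp
qed

text \<open>The fundamental lemma of the calculus of variations. Bumps on boxes are admissible test
  functions and converge boundedly to indicators, so \<open>g\<close> integrates to 0 over the boxes
  inside a closed box in \<open>\<Omega>\<close>; countably many closed boxes exhaust
  \<open>\<Omega>\<close>.\<close>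

lemma test_orthogonal_imp_AE_zero:
  fixes g :: "'a::euclidean_space \<Rightarrow> real"
  assumes \<Omega>: "open \<Omega>" and g: "locally_integrable \<Omega> g"
    and orth: "\<And>\<phi>. \<phi> \<in> test_functions \<Omega> \<Longrightarrow> integral\<^sup>L lebesgue (\<lambda>x. \<phi> x * g x) = 0"
  shows "AE x in lebesgue. x \<in> \<Omega> \<longrightarrow> g x = 0"
proof -
  have cb: "AE x in lebesgue. x \<in> cbox p q \<longrightarrow> g x = 0" if pq: "cbox p q \<subseteq> \<Omega>" for p q
  proof -
    have gpq: "integrable lebesgue (\<lambda>x. indicator (cbox p q) x * g x)"
    proof -
      have "integrable (lebesgue_on (cbox p q)) g"
        using g pq unfolding locally_integrable_def by auto
      then show ?thesis by (simp add: integrable_restrict_space)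
    qed
    then have meas: "(\<lambda>x. indicator (cbox p q) x * g x) \<in> borel_measurable lebesgue"
      by (rule borel_measurable_integrable)
    \<comment> \<open>Cutting down to the open box makes the trace of an arbitrary box a box again,
      now with closure-safe bumps that vanish off \<open>cbox p q\<close>. The discarded boundary is
      a null set.\<close>
    define h where "h = (\<lambda>x. indicator (box p q) x * (indicator (cbox p q) x * g x))"
    have "integrable lebesgue h"
      using integrable_mult_indicator[OF _ gpq, of "box p q"] by (simp add: h_def)
    then have "AE x in lebesgue. h x = 0"
    proof (rule integrable_all_boxes_zero_imp_AE_zero)
      fix a c :: 'a
      obtain a' c' where box: "box a c \<inter> box p q = box a' c'"
        by (rule that) (rule box_Int_box)
      have lim: "(\<lambda>j. integral\<^sup>L lebesgue (\<lambda>x. box_bump (real j) a' c' x * (indicator (cbox p q) x * g x)))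
          \<longlonglongrightarrow> integral\<^sup>L lebesgue (\<lambda>x. indicator (box a' c') x * (indicator (cbox p q) x * g x))"
      proof (rule integral_dominated_convergence[where w="\<lambda>x. norm (indicator (cbox p q) x * g x)"])
        show "(\<lambda>x. indicator (box a' c') x * (indicator (cbox p q) x * g x)) \<in> borel_measurable lebesgue"
          by (rule borel_measurable_times[OF _ meas]) (intro borel_measurable_indicator, simp)
        show "(\<lambda>x. box_bump (real j) a' c' x * (indicator (cbox p q) x * g x)) \<in> borel_measurable lebesgue" for j
        proof (rule borel_measurable_times[OF _ meas], rule measurable_completion)
          show "box_bump (real j) a' c' \<in> borel_measurable lborel"
            by (simp, intro borel_measurable_continuous_onI smooth_fun_continuous smooth_fun_box_bump)
        qed
        show "integrable lebesgue (\<lambda>x. norm (indicator (cbox p q) x * g x))"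
          using gpq by (rule integrable_norm)
        show "AE x in lebesgue. (\<lambda>j. box_bump (real j) a' c' x * (indicator (cbox p q) x * g x))
            \<longlonglongrightarrow> indicator (box a' c') x * (indicator (cbox p q) x * g x)"
          by (intro AE_I2 tendsto_mult tendsto_const box_bump_tendsto)
        show "AE x in lebesgue. norm (box_bump (real j) a' c' x * (indicator (cbox p q) x * g x))
            \<le> norm (indicator (cbox p q) x * g x)" for j
          by (rule AE_I2) (simp add: abs_mult mult_left_le_one_le box_bump_nonneg box_bump_le_1)
      qed
      have sub: "box a' c' \<subseteq> cbox p q"
        unfolding box[symmetric] using box_subset_cbox[of p q] by blast
      have "\<forall>\<^sub>F j in sequentially. integral\<^sup>L lebesgue (\<lambda>x. box_bump (real j) a' c' x * (indicator (cbox p q) x * g x)) = 0"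
        using eventually_gt_at_top[of 0]
      proof eventually_elim
        case (elim j)
        then have z: "box_bump (real j) a' c' x = 0" if "x \<notin> cbox p q" for x
          using that sub box_bump_pos_iff[of "real j" a' c' x] by auto
        have "box_bump (real j) a' c' \<in> test_functions \<Omega>"
          by (rule test_functionsI[OF smooth_fun_box_bump compact_cbox pq z])
        moreover have "(\<lambda>x. box_bump (real j) a' c' x * (indicator (cbox p q) x * g x)) = (\<lambda>x. box_bump (real j) a' c' x * g x)"
          using z by (auto simp: fun_eq_iff indicator_def)
        ultimately show ?case using orth by simp
      qed
      then have "(\<lambda>j. integral\<^sup>L lebesgue (\<lambda>x. box_bump (real j) a' c' x * (indicator (cbox p q) x * g x))) \<longlonglongrightarrow> 0"
        by (rule tendsto_eventually)
      then have "integral\<^sup>L lebesgue (\<lambda>x. indicator (box a' c') x * (indicator (cbox p q) x * g x)) = 0"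
        by (rule LIMSEQ_unique[OF lim])
      moreover have "indicator (box a c) x * h x = indicator (box a' c') x * (indicator (cbox p q) x * g x)" for x
        unfolding h_def box[symmetric] by (simp add: indicator_inter_arith)
      ultimately show "integral\<^sup>L lebesgue (\<lambda>x. indicator (box a c) x * h x) = 0" by simp
    qed
    moreover have "AE x in lebesgue. x \<notin> cbox p q - box p q"
    proof (rule AE_not_in)
      show "cbox p q - box p q \<in> null_sets lebesgue"
        using negligible_frontier_interval[of p q] by (simp add: negligible_iff_null_sets)
    qed
    ultimately show ?thesis
      by eventually_elim (auto simp: h_def indicator_def split: if_splits)
  qed
  obtain D where D: "countable D" "D \<subseteq> Pow \<Omega>" "\<And>X. X \<in> D \<Longrightarrow> \<exists>a b. X = cbox a b" "\<Union>D = \<Omega>"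
    by (rule open_countable_Union_open_cbox[OF \<Omega>]) (rule that)
  have "AE x in lebesgue. \<forall>X\<in>D. x \<in> X \<longrightarrow> g x = 0"
    unfolding AE_ball_countable[OF D(1)]
  proof
    fix X assume X: "X \<in> D"
    then obtain a b where "X = cbox a b" using D(3) by blast
    then show "AE x in lebesgue. x \<in> X \<longrightarrow> g x = 0" using cb D(2) X by auto
  qed
  then show ?thesis
    by (rule eventually_mono) (use D(4) in blast)
qed

section \<open>Sobolev spaces\<close>

lemma powr_above_tangent:
  fixes s t p :: real
  assumes "p \<ge> 1" "s > 0" "t \<ge> 0"
  shows "s powr p + p * s powr (p - 1) * (t - s) \<le> t powr p"
\<comment> \<open>The tangent inequality for convex functions is applied on the positive half-line,
  where the power is differentiable; its endpoint is treated by hand.\<close>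
proof (cases "t = 0")
  case True
  have "s powr p = s powr (p - 1) * s"
    using assms by (simp add: powr_diff)
  moreover have "1 * (s powr (p - 1) * s) \<le> p * (s powr (p - 1) * s)"
    using assms by (intro mult_right_mono) auto
  ultimately show ?thesis using True by (simp add: algebra_simps)
next
  case False
  have "t powr p - s powr p \<ge> p * s powr (p - 1) * (t - s)"
  proof (rule convex_on_imp_above_tangent[OF powr_convex[OF assms(1)]])
    show "((\<lambda>x. x powr p) has_real_derivative p * s powr (p - 1)) (at s within {0<..})"
      using assms by (intro has_field_derivative_at_within[OF has_real_derivative_powr]) auto
  qed (use assms False in \<open>auto simp: interior_open\<close>)
  then show ?thesis by simp
qed

text \<open>Jensen's inequality: \<open>(x + y) / (a + b)\<close> is the convex combination of
  \<open>x / a\<close> and \<open>y / b\<close> with weights proportional to \<open>a\<close> and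
  \<open>b\<close>. With \<open>a\<close> and \<open>b\<close> chosen as norms of two functions,
  integration turns this into Minkowski's inequality.\<close>

lemma powr_add_le_weighted:
  fixes a b x y p :: real
  assumes p: "p \<ge> 1" and "a > 0" "b > 0" "x \<ge> 0" "y \<ge> 0"
  shows "(x + y) powr p \<le> (a + b) powr p * (a / (a + b) * (x powr p / a powr p) + b / (a + b) * (y powr p / b powr p))"
proof (cases "x + y = 0")
  case True
  then show ?thesis using assms by simp
next
  case False
  define z where "z = (x + y) / (a + b)"
  define v where "v = a / (a + b)"
  define w where "w = b / (a + b)"
  have z: "z > 0" using False assms by (simp add: z_def)
  have vw: "v \<ge> 0" "w \<ge> 0" "v + w = 1"
    using assms by (simp_all add: v_def w_def flip: add_divide_distrib)
  have zvw: "v * (x / a) + w * (y / b) = z"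
    using assms by (simp add: v_def w_def z_def add_divide_distrib)
  have "v * (z powr p + p * z powr (p - 1) * (x / a - z)) + w * (z powr p + p * z powr (p - 1) * (y / b - z))
      \<le> v * (x / a) powr p + w * (y / b) powr p"
    using assms z vw by (intro add_mono mult_left_mono powr_above_tangent) auto
  moreover have "v * (z powr p + p * z powr (p - 1) * (x / a - z)) + w * (z powr p + p * z powr (p - 1) * (y / b - z))
     = z powr p"
  proof -
    have "v * (A + P * (X - z)) + w * (A + P * (Y - z)) = (v + w) * A + P * ((v * X + w * Y) - (v + w) * z)" for A P X Y
      by (simp add: algebra_simps)
    then show ?thesis by (simp only: zvw vw(3)) simp
  qed
  ultimately have "z powr p \<le> v * (x / a) powr p + w * (y / b) powr p"
    by linarith
  then have "(a + b) powr p * z powr p \<le> (a + b) powr p * (v * (x / a) powr p + w * (y / b) powr p)"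
    by (intro mult_left_mono) auto
  moreover have "(a + b) powr p * z powr p = (x + y) powr p"
    using assms by (simp add: z_def powr_divide)
  ultimately show ?thesis
    using assms by (simp add: powr_divide v_def w_def)
qed

text \<open>Comparison of the mean with the \<open>q\<close>-th power mean. The tangent to the
  \<open>q\<close>-th power at \<open>a\<close> bounds \<open>g\<close> pointwise by an affine
  function of its \<open>q\<close>-th power, and this bound is integrated.\<close>

lemma integral_le_of_powr_integral:
  fixes g :: "'b \<Rightarrow> real"
  assumes M: "finite_measure M" and q: "q \<ge> 1" and a: "a > 0"
    and g: "integrable M g" "\<And>x. g x \<ge> 0" and gq: "integrable M (\<lambda>x. g x powr q)"
    and le: "integral\<^sup>L M (\<lambda>x. g x powr q) \<le> a powr q * measure M (space M)"
  shows "integral\<^sup>L M g \<le> a * measure M (space M)"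
proof -
  interpret finite_measure M by (rule M)
  define c where "c = q * a powr (q - 1)"
  have c: "c > 0" using q a by (simp add: c_def)
  have "g x \<le> a + (g x powr q - a powr q) / c" for x
  proof -
    have "(g x - a) * c \<le> g x powr q - a powr q"
      using powr_above_tangent[OF q a g(2)[of x]] by (simp add: c_def mult.commute)
    then have "g x - a \<le> (g x powr q - a powr q) / c"
      using c by (simp add: pos_le_divide_eq)
    then show ?thesis by simp
  qed
  then have "integral\<^sup>L M g \<le> integral\<^sup>L M (\<lambda>x. a + (g x powr q - a powr q) / c)"
    using g gq by (intro integral_mono) auto
  also have "\<dots> = a * measure M (space M) + (integral\<^sup>L M (\<lambda>x. g x powr q) - a powr q * measure M (space M)) / c"
    using gq by (simp add: Bochner_Integration.integral_diff)
  also have "\<dots> \<le> a * measure M (space M)"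
    using le c by (simp add: divide_nonpos_pos)
  finally show ?thesis .
qed

section \<open>Weak gradients and Lebesgue spaces\<close>

lemma AE_lebesgue_on_iff:
  "S \<in> sets lebesgue \<Longrightarrow> (AE x in lebesgue_on S. P x) \<longleftrightarrow> (AE x in lebesgue. x \<in> S \<longrightarrow> P x)"
  by (simp add: AE_restrict_space_iff)

text \<open>Lebesgue measure is complete, so preimages may be altered arbitrarily inside the
  exceptional null set.\<close>

lemma borel_measurable_lebesgue_on_AE:
  fixes f g :: "'a::euclidean_space \<Rightarrow> 'b::euclidean_space"
  assumes S: "S \<in> sets lebesgue" and g: "g \<in> borel_measurable (lebesgue_on S)"
    and ae: "AE x in lebesgue_on S. f x = g x"
  shows "f \<in> borel_measurable (lebesgue_on S)"
proof -
  define F where "F = (\<lambda>x. indicator S x *\<^sub>R f x)"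
  define G where "G = (\<lambda>x. indicator S x *\<^sub>R g x)"
  have G: "G \<in> borel_measurable lebesgue"
    using g S by (simp add: G_def borel_measurable_restrict_space_iff)
  have "AE x in lebesgue. F x = G x"
    using ae unfolding AE_lebesgue_on_iff[OF S] by eventually_elim (auto simp: F_def G_def indicator_def)
  then obtain N where N: "N \<in> null_sets lebesgue" "{x. F x \<noteq> G x} \<subseteq> N"
    unfolding eventually_ae_filter by auto
  have "F \<in> borel_measurable lebesgue"
  proof (rule measurableI)
    fix B :: "'b set" assume B: "B \<in> sets borel"
    have "F -` B \<inter> N \<in> null_sets lebesgue"
      using N(1) by (rule null_sets_completion_subset[rotated]) auto
    moreover have "G -` B \<in> sets lebesgue"
      using measurable_sets[OF G B] by simp
    ultimately have "(G -` B - N) \<union> (F -` B \<inter> N) \<in> sets lebesgue"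
      using N(1) by (auto dest: null_setsD2)
    moreover have "F -` B = (G -` B - N) \<union> (F -` B \<inter> N)"
      using N(2) by auto
    ultimately show "F -` B \<inter> space lebesgue \<in> sets lebesgue" by simp
  qed simp
  then show ?thesis
    using S by (simp add: F_def borel_measurable_restrict_space_iff)
qed

lemma weak_gradient_pairing:
  fixes g :: "'a::euclidean_space \<Rightarrow> 'a"
  assumes "open \<Omega>" "locally_integrable \<Omega> g" "\<phi> \<in> test_functions \<Omega>"
  shows "integrable lebesgue (\<lambda>x. (g x \<bullet> b) * \<phi> x)"
    and "integral\<^sup>L (lebesgue_on \<Omega>) (\<lambda>x. (g x \<bullet> b) * \<phi> x) = integral\<^sup>L lebesgue (\<lambda>x. (g x \<bullet> b) * \<phi> x)"
proof -
  obtain K where K: "smooth_fun \<phi>" "compact K" "K \<subseteq> \<Omega>" "\<And>x. x \<notin> K \<Longrightarrow> \<phi> x = 0"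
      "\<And>x. x \<notin> K \<Longrightarrow> gradient \<phi> x = 0"
    by (rule test_functionsE[OF assms(3)]) (rule that)
  have "integrable lebesgue (\<lambda>x. \<phi> x *\<^sub>R g x)"
    by (rule integrable_compact_support_scaleR[OF assms(2) smooth_fun_continuous[OF K(1)] K(2-4)])
  then have "integrable lebesgue (\<lambda>x. (\<phi> x *\<^sub>R g x) \<bullet> b)"
    by (intro integrable_inner_left) simp
  then show "integrable lebesgue (\<lambda>x. (g x \<bullet> b) * \<phi> x)"
    by (simp add: mult.commute)
  show "integral\<^sup>L (lebesgue_on \<Omega>) (\<lambda>x. (g x \<bullet> b) * \<phi> x) = integral\<^sup>L lebesgue (\<lambda>x. (g x \<bullet> b) * \<phi> x)"
  proof (rule integrable_lebesgue_on_supported(2))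
    show "\<Omega> \<in> sets lebesgue" using assms(1) by auto
    show "(g x \<bullet> b) * \<phi> x = 0" if "x \<notin> \<Omega>" for x
    proof -
      have "\<phi> x = 0" using K(3) K(4)[of x] that by blast
      then show ?thesis by simp
    qed
  qed
qed

lemma function_pairing:
  fixes u :: "'a::euclidean_space \<Rightarrow> real"
  assumes "open \<Omega>" "locally_integrable \<Omega> u" "\<phi> \<in> test_functions \<Omega>" and b: "b \<in> Basis"
  shows "integrable (lebesgue_on \<Omega>) (\<lambda>x. u x * frechet_derivative \<phi> (at x) b)"
proof -
  obtain K where K: "smooth_fun \<phi>" "compact K" "K \<subseteq> \<Omega>" "\<And>x. x \<notin> K \<Longrightarrow> \<phi> x = 0"
      "\<And>x. x \<notin> K \<Longrightarrow> gradient \<phi> x = 0"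
    by (rule test_functionsE[OF assms(3)]) (rule that)
  have zero: "frechet_derivative \<phi> (at x) b = 0" if "x \<notin> K" for x
    using K(5)[OF that] by (simp flip: gradient_inner_Basis[OF b])
  have "integrable lebesgue (\<lambda>x. frechet_derivative \<phi> (at x) b *\<^sub>R u x)"
    by (rule integrable_compact_support_scaleR[OF assms(2) smooth_fun_continuous[OF smooth_fun_partial[OF K(1) b]] K(2,3) zero])
  then have "integrable lebesgue (\<lambda>x. u x * frechet_derivative \<phi> (at x) b)"
    by (simp add: mult.commute)
  moreover have "u x * frechet_derivative \<phi> (at x) b = 0" if "x \<notin> \<Omega>" for x
  proof -
    have "x \<notin> K" using K(3) that by blast
    then show ?thesis using zero[of x] by simp
  qed
  ultimately show ?thesis
    using assms(1) by (subst integrable_lebesgue_on_supported(1)) auto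
qed

text \<open>Each component of the difference is orthogonal to all test functions. Consequently the
  choice made in \<open>weak_gradient\<close> does not affect energies.\<close>

lemma weak_gradient_unique:
  assumes \<Omega>: "open \<Omega>" and g: "has_weak_gradient \<Omega> u g" and h: "has_weak_gradient \<Omega> u h"
  shows "AE x in lebesgue_on \<Omega>. g x = h x"
proof -
  have li: "locally_integrable \<Omega> g" "locally_integrable \<Omega> h"
    using g h by (auto simp: has_weak_gradient_def)
  have comp: "AE x in lebesgue. x \<in> \<Omega> \<longrightarrow> (g x - h x) \<bullet> b = 0" if b: "b \<in> Basis" for b
  proof (rule test_orthogonal_imp_AE_zero[OF \<Omega>])
    show "locally_integrable \<Omega> (\<lambda>x. (g x - h x) \<bullet> b)"
      using li unfolding locally_integrable_def by simp
    fix \<phi> assume \<phi>: "\<phi> \<in> test_functions \<Omega>"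
    have "integral\<^sup>L (lebesgue_on \<Omega>) (\<lambda>x. (g x \<bullet> b) * \<phi> x) = integral\<^sup>L (lebesgue_on \<Omega>) (\<lambda>x. (h x \<bullet> b) * \<phi> x)"
    proof -
      have "integral\<^sup>L (lebesgue_on \<Omega>) (\<lambda>x. u x * frechet_derivative \<phi> (at x) b)
          = - integral\<^sup>L (lebesgue_on \<Omega>) (\<lambda>x. (g x \<bullet> b) * \<phi> x)"
        using g \<phi> b by (simp add: has_weak_gradient_def)
      moreover have "integral\<^sup>L (lebesgue_on \<Omega>) (\<lambda>x. u x * frechet_derivative \<phi> (at x) b)
          = - integral\<^sup>L (lebesgue_on \<Omega>) (\<lambda>x. (h x \<bullet> b) * \<phi> x)"
        using h \<phi> b by (simp add: has_weak_gradient_def)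
      ultimately show ?thesis by simp
    qed
    then have eq: "integral\<^sup>L lebesgue (\<lambda>x. (g x \<bullet> b) * \<phi> x) = integral\<^sup>L lebesgue (\<lambda>x. (h x \<bullet> b) * \<phi> x)"
      using weak_gradient_pairing(2)[OF \<Omega> li(1) \<phi>] weak_gradient_pairing(2)[OF \<Omega> li(2) \<phi>] by simp
    have "integral\<^sup>L lebesgue (\<lambda>x. (g x \<bullet> b) * \<phi> x - (h x \<bullet> b) * \<phi> x) = 0"
      using eq weak_gradient_pairing(1)[OF \<Omega> li(1) \<phi>] weak_gradient_pairing(1)[OF \<Omega> li(2) \<phi>]
      by (simp add: Bochner_Integration.integral_diff)
    then show "integral\<^sup>L lebesgue (\<lambda>x. \<phi> x * ((g x - h x) \<bullet> b)) = 0"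
      by (simp add: inner_diff_left algebra_simps)
  qed
  have "AE x in lebesgue. \<forall>b\<in>Basis. x \<in> \<Omega> \<longrightarrow> (g x - h x) \<bullet> b = 0"
    unfolding AE_ball_countable[OF countable_finite[OF finite_Basis]] by (intro ballI comp)
  then have "AE x in lebesgue. x \<in> \<Omega> \<longrightarrow> g x = h x"
  proof (rule eventually_mono)
    fix x assume x: "\<forall>b\<in>Basis. x \<in> \<Omega> \<longrightarrow> (g x - h x) \<bullet> b = 0"
    show "x \<in> \<Omega> \<longrightarrow> g x = h x"
    proof
      assume "x \<in> \<Omega>"
      then have "g x \<bullet> b = h x \<bullet> b" if "b \<in> Basis" for b
        using x that by (simp add: inner_diff_left)
      then show "g x = h x" by (rule euclidean_eqI)
    qed
  qed
  then show ?thesis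
    using \<Omega> by (simp add: AE_lebesgue_on_iff)
qed

lemma has_weak_gradient_linear:
  assumes \<Omega>: "open \<Omega>" and u: "has_weak_gradient \<Omega> u g" and v: "has_weak_gradient \<Omega> v h"
  shows "has_weak_gradient \<Omega> (\<lambda>x. u x + a * v x) (\<lambda>x. g x + a *\<^sub>R h x)"
proof -
  have li: "locally_integrable \<Omega> u" "locally_integrable \<Omega> v" "locally_integrable \<Omega> g" "locally_integrable \<Omega> h"
    using u v by (auto simp: has_weak_gradient_def)
  have li5: "locally_integrable \<Omega> (\<lambda>x. g x + a *\<^sub>R h x)"
    using li unfolding locally_integrable_def by auto
  moreover have "locally_integrable \<Omega> (\<lambda>x. u x + a * v x)"
    using li unfolding locally_integrable_def by auto
  moreover have "integral\<^sup>L (lebesgue_on \<Omega>) (\<lambda>x. (u x + a * v x) * frechet_derivative \<phi> (at x) b)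
      = - integral\<^sup>L (lebesgue_on \<Omega>) (\<lambda>x. ((g x + a *\<^sub>R h x) \<bullet> b) * \<phi> x)"
    if \<phi>: "\<phi> \<in> test_functions \<Omega>" and b: "b \<in> Basis" for \<phi> b
  proof -
    let ?D = "\<lambda>x. frechet_derivative \<phi> (at x) b"
    have "integral\<^sup>L (lebesgue_on \<Omega>) (\<lambda>x. (u x + a * v x) * ?D x)
      = integral\<^sup>L (lebesgue_on \<Omega>) (\<lambda>x. u x * ?D x + a * (v x * ?D x))"
      by (simp add: algebra_simps)
    also have "\<dots> = integral\<^sup>L (lebesgue_on \<Omega>) (\<lambda>x. u x * ?D x) + a * integral\<^sup>L (lebesgue_on \<Omega>) (\<lambda>x. v x * ?D x)"
      using function_pairing[OF \<Omega> li(1) \<phi> b] function_pairing[OF \<Omega> li(2) \<phi> b]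
      by (simp add: Bochner_Integration.integral_add)
    also have "\<dots> = - (integral\<^sup>L lebesgue (\<lambda>x. (g x \<bullet> b) * \<phi> x) + a * integral\<^sup>L lebesgue (\<lambda>x. (h x \<bullet> b) * \<phi> x))"
      using u v \<phi> b weak_gradient_pairing(2)[OF \<Omega> li(3) \<phi>] weak_gradient_pairing(2)[OF \<Omega> li(4) \<phi>]
      by (simp add: has_weak_gradient_def)
    also have "\<dots> = - integral\<^sup>L lebesgue (\<lambda>x. (g x \<bullet> b) * \<phi> x + a * ((h x \<bullet> b) * \<phi> x))"
      using weak_gradient_pairing(1)[OF \<Omega> li(3) \<phi>] weak_gradient_pairing(1)[OF \<Omega> li(4) \<phi>]
      by (simp add: Bochner_Integration.integral_add)
    also have "\<dots> = - integral\<^sup>L lebesgue (\<lambda>x. ((g x + a *\<^sub>R h x) \<bullet> b) * \<phi> x)"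
      by (simp add: inner_add_left algebra_simps)
    also have "\<dots> = - integral\<^sup>L (lebesgue_on \<Omega>) (\<lambda>x. ((g x + a *\<^sub>R h x) \<bullet> b) * \<phi> x)"
      using weak_gradient_pairing(2)[OF \<Omega> li5 \<phi>] by simp
    finally show ?thesis .
  qed
  ultimately show ?thesis by (simp add: has_weak_gradient_def)
qed

lemma Lp_space_linear:
  fixes f g :: "'a::euclidean_space \<Rightarrow> 'b::euclidean_space"
  assumes p: "p \<ge> 1" and f: "f \<in> Lp_space \<Omega> p" and g: "g \<in> Lp_space \<Omega> p"
  shows "(\<lambda>x. f x + a *\<^sub>R g x) \<in> Lp_space \<Omega> p"
proof -
  have meas[measurable]: "f \<in> borel_measurable (lebesgue_on \<Omega>)" "g \<in> borel_measurable (lebesgue_on \<Omega>)"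
    using f g by (auto simp: Lp_space_def)
  have bound: "norm (f x + a *\<^sub>R g x) powr p \<le> 2 powr p * (norm (f x) powr p + \<bar>a\<bar> powr p * norm (g x) powr p)" for x
  proof -
    have "norm (f x + a *\<^sub>R g x) \<le> norm (f x) + \<bar>a\<bar> * norm (g x)"
      using norm_triangle_ineq[of "f x" "a *\<^sub>R g x"] by simp
    then have "norm (f x + a *\<^sub>R g x) powr p \<le> (norm (f x) + \<bar>a\<bar> * norm (g x)) powr p"
      using p by (intro powr_mono2) auto
    also have "\<dots> \<le> (1 + 1) powr p * (1 / (1 + 1) * (norm (f x) powr p / 1 powr p) + 1 / (1 + 1) * ((\<bar>a\<bar> * norm (g x)) powr p / 1 powr p))"
      by (rule powr_add_le_weighted[OF p]) auto
    also have "\<dots> = 2 powr p * ((norm (f x) powr p + \<bar>a\<bar> powr p * norm (g x) powr p) / 2)"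
      by (simp add: powr_mult)
    also have "\<dots> \<le> 2 powr p * (norm (f x) powr p + \<bar>a\<bar> powr p * norm (g x) powr p)"
      by (intro mult_left_mono) auto
    finally show ?thesis .
  qed
  have "integrable (lebesgue_on \<Omega>) (\<lambda>x. norm (f x + a *\<^sub>R g x) powr p)"
  proof (rule Bochner_Integration.integrable_bound)
    show "integrable (lebesgue_on \<Omega>) (\<lambda>x. 2 powr p * (norm (f x) powr p + \<bar>a\<bar> powr p * norm (g x) powr p))"
      using f g by (auto simp: Lp_space_def)
    show "AE x in lebesgue_on \<Omega>. norm (norm (f x + a *\<^sub>R g x) powr p)
        \<le> norm (2 powr p * (norm (f x) powr p + \<bar>a\<bar> powr p * norm (g x) powr p))"
      by (rule AE_I2) (use bound in simp)
  qed measurable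
  then show ?thesis by (simp add: Lp_space_def)
qed

text \<open>The weights stay free, instead of being fixed as the norms of \<open>f\<close> and
  \<open>g\<close>, so that the estimates for functions and for gradients can use one common pair
  and be added.\<close>

lemma integral_powr_add_le:
  fixes f g :: "'a::euclidean_space \<Rightarrow> 'b::euclidean_space"
  assumes p: "p \<ge> 1" and f: "f \<in> Lp_space \<Omega> p" and g: "g \<in> Lp_space \<Omega> p" and ab: "a > 0" "b > 0"
  shows "integral\<^sup>L (lebesgue_on \<Omega>) (\<lambda>x. norm (f x + g x) powr p)
    \<le> (a + b) powr p * (a / (a + b) * (integral\<^sup>L (lebesgue_on \<Omega>) (\<lambda>x. norm (f x) powr p) / a powr p)
        + b / (a + b) * (integral\<^sup>L (lebesgue_on \<Omega>) (\<lambda>x. norm (g x) powr p) / b powr p))"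
proof -
  have int: "integrable (lebesgue_on \<Omega>) (\<lambda>x. norm (f x) powr p)" "integrable (lebesgue_on \<Omega>) (\<lambda>x. norm (g x) powr p)"
    "integrable (lebesgue_on \<Omega>) (\<lambda>x. norm (f x + g x) powr p)"
    using f g Lp_space_linear[OF p f g, of 1] by (auto simp: Lp_space_def)
  have "norm (f x + g x) powr p \<le> (a + b) powr p * (a / (a + b) * (norm (f x) powr p / a powr p) + b / (a + b) * (norm (g x) powr p / b powr p))" for x
  proof -
    have "norm (f x + g x) powr p \<le> (norm (f x) + norm (g x)) powr p"
      using p by (intro powr_mono2 norm_triangle_ineq) auto
    also have "\<dots> \<le> (a + b) powr p * (a / (a + b) * (norm (f x) powr p / a powr p) + b / (a + b) * (norm (g x) powr p / b powr p))"
      by (rule powr_add_le_weighted[OF p ab]) auto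
    finally show ?thesis .
  qed
  then have "integral\<^sup>L (lebesgue_on \<Omega>) (\<lambda>x. norm (f x + g x) powr p)
    \<le> integral\<^sup>L (lebesgue_on \<Omega>) (\<lambda>x. (a + b) powr p * (a / (a + b) * (norm (f x) powr p / a powr p) + b / (a + b) * (norm (g x) powr p / b powr p)))"
    using int by (intro integral_mono) auto
  also have "\<dots> = (a + b) powr p * (a / (a + b) * (integral\<^sup>L (lebesgue_on \<Omega>) (\<lambda>x. norm (f x) powr p) / a powr p)
        + b / (a + b) * (integral\<^sup>L (lebesgue_on \<Omega>) (\<lambda>x. norm (g x) powr p) / b powr p))"
    using int by (simp add: Bochner_Integration.integral_add)
  finally show ?thesis .
qed

lemma weak_gradient_works: "has_weak_gradient \<Omega> u g \<Longrightarrow> has_weak_gradient \<Omega> u (weak_gradient \<Omega> u)"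
  unfolding weak_gradient_def by (rule someI[where P="has_weak_gradient \<Omega> u" and x=g])

lemma weak_gradient_AE_eq:
  "open \<Omega> \<Longrightarrow> has_weak_gradient \<Omega> u g \<Longrightarrow> AE x in lebesgue_on \<Omega>. weak_gradient \<Omega> u x = g x"
  by (rule weak_gradient_unique[OF _ weak_gradient_works])

lemma Lp_space_AE_cong:
  fixes f g :: "'a::euclidean_space \<Rightarrow> 'b::euclidean_space"
  assumes "\<Omega> \<in> sets lebesgue" "g \<in> Lp_space \<Omega> p" "AE x in lebesgue_on \<Omega>. f x = g x"
  shows "f \<in> Lp_space \<Omega> p"
proof -
  have g: "g \<in> borel_measurable (lebesgue_on \<Omega>)" "integrable (lebesgue_on \<Omega>) (\<lambda>x. norm (g x) powr p)"
    using assms(2) by (auto simp: Lp_space_def)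
  have f: "f \<in> borel_measurable (lebesgue_on \<Omega>)"
    by (rule borel_measurable_lebesgue_on_AE[OF assms(1) g(1) assms(3)])
  have "integrable (lebesgue_on \<Omega>) (\<lambda>x. norm (f x) powr p)"
  proof (rule integrable_cong_AE_imp[OF g(2)])
    show "(\<lambda>x. norm (f x) powr p) \<in> borel_measurable (lebesgue_on \<Omega>)" using f by measurable
    show "AE x in lebesgue_on \<Omega>. norm (g x) powr p = norm (f x) powr p"
      using assms(3) by eventually_elim simp
  qed
  then show ?thesis using f by (simp add: Lp_space_def)
qed

lemma sobolev_space_weak_gradient:
  assumes "open \<Omega>" "u \<in> sobolev_space \<Omega> p"
  shows "has_weak_gradient \<Omega> u (weak_gradient \<Omega> u)" "weak_gradient \<Omega> u \<in> Lp_space \<Omega> p" "u \<in> Lp_space \<Omega> p"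
proof -
  obtain g where g: "g \<in> Lp_space \<Omega> p" "has_weak_gradient \<Omega> u g"
    using assms by (auto simp: sobolev_space_def)
  show "has_weak_gradient \<Omega> u (weak_gradient \<Omega> u)" by (rule weak_gradient_works[OF g(2)])
  have "\<Omega> \<in> sets lebesgue" using assms(1) by auto
  then show "weak_gradient \<Omega> u \<in> Lp_space \<Omega> p"
    by (rule Lp_space_AE_cong[OF _ g(1) weak_gradient_AE_eq[OF assms(1) g(2)]])
  show "u \<in> Lp_space \<Omega> p" using assms by (simp add: sobolev_space_def)
qed

lemma sobolev_space_linear:
  assumes "open \<Omega>" "p \<ge> 1" "u \<in> sobolev_space \<Omega> p" "v \<in> sobolev_space \<Omega> p"
  shows "(\<lambda>x. u x + a * v x) \<in> sobolev_space \<Omega> p"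
proof -
  note u = sobolev_space_weak_gradient[OF assms(1,3)] and v = sobolev_space_weak_gradient[OF assms(1,4)]
  show ?thesis
    using Lp_space_linear[OF assms(2) u(3) v(3), of a] Lp_space_linear[OF assms(2) u(2) v(2), of a]
      has_weak_gradient_linear[OF assms(1) u(1) v(1), of a]
    by (auto simp: sobolev_space_def)
qed

lemma dirichlet_energy_eq:
  assumes "open \<Omega>" "has_weak_gradient \<Omega> u g" "g \<in> Lp_space \<Omega> p"
  shows "dirichlet_energy \<Omega> p u = integral\<^sup>L (lebesgue_on \<Omega>) (\<lambda>x. norm (g x) powr p)"
  unfolding dirichlet_energy_def
proof (rule integral_cong_AE)
  have \<Omega>: "\<Omega> \<in> sets lebesgue" using assms(1) by auto
  note ae = weak_gradient_AE_eq[OF assms(1,2)]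
  show "(\<lambda>x. norm (weak_gradient \<Omega> u x) powr p) \<in> borel_measurable (lebesgue_on \<Omega>)"
    using Lp_space_AE_cong[OF \<Omega> assms(3) ae] by (auto simp: Lp_space_def)
  show "(\<lambda>x. norm (g x) powr p) \<in> borel_measurable (lebesgue_on \<Omega>)"
    using assms(3) by (auto simp: Lp_space_def)
  show "AE x in lebesgue_on \<Omega>. norm (weak_gradient \<Omega> u x) powr p = norm (g x) powr p"
    using ae by eventually_elim simp
qed

section \<open>The Sobolev seminorm\<close>

lemma dirichlet_energy_nonneg: "dirichlet_energy \<Omega> p u \<ge> 0"
  by (simp add: dirichlet_energy_def)

definition sobolev_power :: "'a::euclidean_space set \<Rightarrow> real \<Rightarrow> ('a \<Rightarrow> real) \<Rightarrow> real" where
  "sobolev_power \<Omega> p u = integral\<^sup>L (lebesgue_on \<Omega>) (\<lambda>x. \<bar>u x\<bar> powr p) + dirichlet_energy \<Omega> p u"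

lemma sobolev_power_nonneg: "sobolev_power \<Omega> p u \<ge> 0"
  by (simp add: sobolev_power_def dirichlet_energy_nonneg)

lemma sobolev_norm_power: "p > 0 \<Longrightarrow> sobolev_norm \<Omega> p u powr p = sobolev_power \<Omega> p u"
  by (simp add: sobolev_norm_def sobolev_power_nonneg powr_powr flip: sobolev_power_def)

lemma sobolev_norm_nonneg: "sobolev_norm \<Omega> p u \<ge> 0"
  by (simp add: sobolev_norm_def)

lemma sobolev_norm_le_iff:
  assumes "p > 0" "a \<ge> 0"
  shows "sobolev_norm \<Omega> p u \<le> a \<longleftrightarrow> sobolev_power \<Omega> p u \<le> a powr p"
proof (cases "sobolev_norm \<Omega> p u \<le> a")
  case True
  then show ?thesis
    using powr_mono2[of p "sobolev_norm \<Omega> p u" a] assms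
    by (simp add: sobolev_norm_nonneg sobolev_norm_power)
next
  case False
  then show ?thesis
    using powr_less_mono2[of p a "sobolev_norm \<Omega> p u"] assms
    by (simp add: sobolev_norm_power)
qed

lemma sobolev_norm_add:
  assumes \<Omega>: "open \<Omega>" and p: "p \<ge> 1" and u: "u \<in> sobolev_space \<Omega> p" and v: "v \<in> sobolev_space \<Omega> p"
  shows "sobolev_norm \<Omega> p (\<lambda>x. u x + v x) \<le> sobolev_norm \<Omega> p u + sobolev_norm \<Omega> p v"
proof (rule field_le_epsilon)
  fix e :: real assume e: "e > 0"
  \<comment> \<open>The extra \<open>e / 2\<close> keeps both weights positive even where a seminorm
    vanishes.\<close>
  define a where "a = sobolev_norm \<Omega> p u + e / 2"
  define b where "b = sobolev_norm \<Omega> p v + e / 2"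
  have ab: "a > 0" "b > 0"
    using e sobolev_norm_nonneg[of \<Omega> p u] sobolev_norm_nonneg[of \<Omega> p v] by (simp_all add: a_def b_def add_nonneg_pos)
  have pu: "sobolev_power \<Omega> p u \<le> a powr p" and pv: "sobolev_power \<Omega> p v \<le> b powr p"
    using p e ab by (simp_all add: a_def b_def flip: sobolev_norm_le_iff)
  note wu = sobolev_space_weak_gradient[OF \<Omega> u] and wv = sobolev_space_weak_gradient[OF \<Omega> v]
  let ?I = "\<lambda>f. integral\<^sup>L (lebesgue_on \<Omega>) (\<lambda>x. norm (f x) powr p)"
  have "dirichlet_energy \<Omega> p (\<lambda>x. u x + v x) = integral\<^sup>L (lebesgue_on \<Omega>) (\<lambda>x. norm (weak_gradient \<Omega> u x + weak_gradient \<Omega> v x) powr p)"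
    using dirichlet_energy_eq[OF \<Omega> has_weak_gradient_linear[OF \<Omega> wu(1) wv(1), of 1] Lp_space_linear[OF p wu(2) wv(2), of 1]]
    by simp
  then have "sobolev_power \<Omega> p (\<lambda>x. u x + v x)
      \<le> (a + b) powr p * (a / (a + b) * (integral\<^sup>L (lebesgue_on \<Omega>) (\<lambda>x. norm (u x) powr p) / a powr p)
            + b / (a + b) * (integral\<^sup>L (lebesgue_on \<Omega>) (\<lambda>x. norm (v x) powr p) / b powr p))
        + (a + b) powr p * (a / (a + b) * (dirichlet_energy \<Omega> p u / a powr p)
            + b / (a + b) * (dirichlet_energy \<Omega> p v / b powr p))"
    using integral_powr_add_le[OF p wu(3) wv(3) ab] integral_powr_add_le[OF p wu(2) wv(2) ab]
    by (simp add: sobolev_power_def dirichlet_energy_def)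
  also have "\<dots> = (a + b) powr p * (a / (a + b) * (sobolev_power \<Omega> p u / a powr p)
            + b / (a + b) * (sobolev_power \<Omega> p v / b powr p))"
    by (simp add: sobolev_power_def add_divide_distrib distrib_left)
  also have "\<dots> \<le> (a + b) powr p * (a / (a + b) * 1 + b / (a + b) * 1)"
    using pu pv ab by (intro mult_left_mono add_mono) auto
  also have "\<dots> = (a + b) powr p"
    using ab by (simp flip: add_divide_distrib)
  finally have "sobolev_norm \<Omega> p (\<lambda>x. u x + v x) \<le> a + b"
    using p ab by (subst sobolev_norm_le_iff) auto
  then show "sobolev_norm \<Omega> p (\<lambda>x. u x + v x) \<le> sobolev_norm \<Omega> p u + sobolev_norm \<Omega> p v + e"
    by (simp add: a_def b_def)
qed

lemma sobolev_norm_zero: "open \<Omega> \<Longrightarrow> p > 0 \<Longrightarrow> sobolev_norm \<Omega> p (\<lambda>x. 0) = 0"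
  by (simp add: sobolev_norm_def dirichlet_energy_eq[of \<Omega> "\<lambda>x. 0" "\<lambda>x. 0"]
      has_weak_gradient_def locally_integrable_def Lp_space_def)

lemma sobolev_space_diff:
  "open \<Omega> \<Longrightarrow> p \<ge> 1 \<Longrightarrow> u \<in> sobolev_space \<Omega> p \<Longrightarrow> v \<in> sobolev_space \<Omega> p \<Longrightarrow> u - v \<in> sobolev_space \<Omega> p"
  using sobolev_space_linear[of \<Omega> p u v "-1"] by (simp add: fun_diff_def)

lemma sobolev_norm_triangle:
  assumes "open \<Omega>" "p \<ge> 1" "u \<in> sobolev_space \<Omega> p" "v \<in> sobolev_space \<Omega> p" "w \<in> sobolev_space \<Omega> p"
  shows "sobolev_norm \<Omega> p (u - w) \<le> sobolev_norm \<Omega> p (u - v) + sobolev_norm \<Omega> p (v - w)"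
  using sobolev_norm_add[OF assms(1,2) sobolev_space_diff[OF assms(1-4)] sobolev_space_diff[OF assms(1,2,4,5)]]
  by (simp add: fun_diff_def)

lemma sobolev_norm_le_add:
  assumes "open \<Omega>" "p \<ge> 1" "u \<in> sobolev_space \<Omega> p" "v \<in> sobolev_space \<Omega> p"
  shows "sobolev_norm \<Omega> p v \<le> sobolev_norm \<Omega> p u + sobolev_norm \<Omega> p (v - u)"
  using sobolev_norm_add[OF assms(1-3) sobolev_space_diff[OF assms(1,2,4,3)]]
  by (simp add: fun_diff_def)

lemma dirichlet_energy_le_norm:
  "p > 0 \<Longrightarrow> sobolev_norm \<Omega> p u \<le> a \<Longrightarrow> dirichlet_energy \<Omega> p u \<le> a powr p"
proof -
  assume p: "p > 0" and a: "sobolev_norm \<Omega> p u \<le> a"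
  have "a \<ge> 0" using a sobolev_norm_nonneg[of \<Omega> p u] by linarith
  then have "sobolev_power \<Omega> p u \<le> a powr p"
    using sobolev_norm_le_iff[OF p] a by blast
  moreover have "integral\<^sup>L (lebesgue_on \<Omega>) (\<lambda>x. \<bar>u x\<bar> powr p) \<ge> 0" by simp
  ultimately show ?thesis unfolding sobolev_power_def by linarith
qed

lemma Lp_norm_le_sobolev_norm:
  "p > 0 \<Longrightarrow> sobolev_norm \<Omega> p u \<le> a \<Longrightarrow> integral\<^sup>L (lebesgue_on \<Omega>) (\<lambda>x. \<bar>u x\<bar> powr p) \<le> a powr p"
proof -
  assume p: "p > 0" and a: "sobolev_norm \<Omega> p u \<le> a"
  have "a \<ge> 0" using a sobolev_norm_nonneg[of \<Omega> p u] by linarith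
  then have "sobolev_power \<Omega> p u \<le> a powr p"
    using sobolev_norm_le_iff[OF p] a by blast
  then show ?thesis
    unfolding sobolev_power_def using dirichlet_energy_nonneg[of \<Omega> p u] by linarith
qed

lemma Lp_space_continuous_compact_support:
  fixes f :: "'a::euclidean_space \<Rightarrow> 'b::euclidean_space"
  assumes \<Omega>: "open \<Omega>" and p: "p > 0" and f: "continuous_on UNIV f" and K: "compact K" "K \<subseteq> \<Omega>"
    and zero: "\<And>x. x \<notin> K \<Longrightarrow> f x = 0"
  shows "f \<in> Lp_space \<Omega> p"
proof -
  have \<Omega>l: "\<Omega> \<in> sets lebesgue" using \<Omega> by auto
  have "integrable lebesgue (\<lambda>x. norm (f x) powr p)"
  proof (rule integrable_continuous_compact_support[OF _ K(1)])
    show "continuous_on UNIV (\<lambda>x. norm (f x) powr p)"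
      using p by (intro continuous_on_powr' continuous_on_norm f continuous_on_const) auto
  qed (simp add: zero)
  moreover have "norm (f x) powr p = 0" if "x \<notin> \<Omega>" for x
  proof -
    have "f x = 0" using K(2) zero[of x] that by blast
    then show ?thesis by simp
  qed
  ultimately have "integrable (lebesgue_on \<Omega>) (\<lambda>x. norm (f x) powr p)"
    using integrable_lebesgue_on_supported(1)[OF \<Omega>l, of "\<lambda>x. norm (f x) powr p"] by simp
  moreover have "f \<in> borel_measurable (lebesgue_on \<Omega>)"
    by (intro continuous_imp_measurable_on_sets_lebesgue \<Omega>l continuous_on_subset[OF f]) auto
  ultimately show ?thesis by (simp add: Lp_space_def)
qed

lemma test_function_Lp:
  assumes "open \<Omega>" "p > 0" "\<phi> \<in> test_functions \<Omega>"
  shows "\<phi> \<in> Lp_space \<Omega> p" "gradient \<phi> \<in> Lp_space \<Omega> p"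
proof -
  obtain K where K: "smooth_fun \<phi>" "compact K" "K \<subseteq> \<Omega>" "\<And>x. x \<notin> K \<Longrightarrow> \<phi> x = 0"
      "\<And>x. x \<notin> K \<Longrightarrow> gradient \<phi> x = 0"
    by (rule test_functionsE[OF assms(3)]) (rule that)
  show "\<phi> \<in> Lp_space \<Omega> p"
    by (rule Lp_space_continuous_compact_support[OF assms(1,2) smooth_fun_continuous[OF K(1)] K(2-4)])
  show "gradient \<phi> \<in> Lp_space \<Omega> p"
    by (rule Lp_space_continuous_compact_support[OF assms(1,2) continuous_on_gradient[OF K(1)] K(2,3,5)])
qed

lemma test_functions_subset_sobolev_space:
  assumes "open \<Omega>" "p > 0"
  shows "test_functions \<Omega> \<subseteq> sobolev_space \<Omega> p"
  using test_function_Lp[OF assms] has_weak_gradient_test_function[OF assms(1)]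
  by (fastforce simp: sobolev_space_def)

lemma dirichlet_energy_test_function:
  assumes "open \<Omega>" "p > 0" "\<phi> \<in> test_functions \<Omega>"
  shows "dirichlet_energy \<Omega> p \<phi> = integral\<^sup>L (lebesgue_on \<Omega>) (\<lambda>x. norm (gradient \<phi> x) powr p)"
  by (rule dirichlet_energy_eq[OF assms(1) has_weak_gradient_test_function[OF assms(1,3)] test_function_Lp(2)[OF assms]])

lemma integral_powr_le_measure:
  fixes f :: "'a::euclidean_space \<Rightarrow> 'b::euclidean_space"
  assumes "\<Omega> \<in> lmeasurable" "f \<in> Lp_space \<Omega> p" "p > 0" "B \<ge> 0" "\<And>x. norm (f x) \<le> B"
  shows "integral\<^sup>L (lebesgue_on \<Omega>) (\<lambda>x. norm (f x) powr p) \<le> B powr p * measure lebesgue \<Omega>"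
proof -
  have "integral\<^sup>L (lebesgue_on \<Omega>) (\<lambda>x. norm (f x) powr p) \<le> integral\<^sup>L (lebesgue_on \<Omega>) (\<lambda>x. B powr p)"
  proof (rule integral_mono)
    show "integrable (lebesgue_on \<Omega>) (\<lambda>x. B powr p)"
      by (rule finite_measure.integrable_const[OF finite_measure_lebesgue_on[OF assms(1)]])
    show "norm (f x) powr p \<le> B powr p" for x
      using assms by (intro powr_mono2) auto
  qed (use assms in \<open>auto simp: Lp_space_def\<close>)
  also have "\<dots> = B powr p * measure lebesgue \<Omega>"
    using assms(1) by (simp add: measure_restrict_space fmeasurableD)
  finally show ?thesis .
qed

section \<open>The Sobolev topology: approximation, continuity and compactness\<close>

lemma topspace_sobolev_topology:
  assumes "open \<Omega>" "p > 0"
  shows "topspace (sobolev_topology \<Omega> p) = sobolev_space \<Omega> p"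
proof -
  have "sobolev_norm \<Omega> p (u - u) = 0" for u
    using sobolev_norm_zero[OF assms] by (simp add: fun_diff_def)
  then have "u \<in> \<Union> {{v \<in> sobolev_space \<Omega> p. sobolev_norm \<Omega> p (v - u) < r} |u r. u \<in> sobolev_space \<Omega> p \<and> r > 0}"
    if "u \<in> sobolev_space \<Omega> p" for u
    using that by (intro UnionI[of "{v \<in> sobolev_space \<Omega> p. sobolev_norm \<Omega> p (v - u) < 1}"] CollectI exI[of _ u] exI[of _ "1::real"]) auto
  then show ?thesis
    unfolding sobolev_topology_def topology_generated_by_topspace by blast
qed

lemma openin_sobolev_ball:
  "u \<in> sobolev_space \<Omega> p \<Longrightarrow> r > 0 \<Longrightarrow>
    openin (sobolev_topology \<Omega> p) {v \<in> sobolev_space \<Omega> p. sobolev_norm \<Omega> p (v - u) < r}"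
  unfolding sobolev_topology_def by (rule topology_generated_by_Basis) blast

lemma sobolev_space0_approx:
  assumes "open \<Omega>" "p > 0" "u \<in> sobolev_space0 \<Omega> p" "r > 0"
  shows "\<exists>\<phi>\<in>test_functions \<Omega>. sobolev_norm \<Omega> p (\<phi> - u) < r"
proof -
  have u: "u \<in> sobolev_space \<Omega> p"
    using assms(3) closure_of_subset_topspace[of "sobolev_topology \<Omega> p" "test_functions \<Omega>"]
    unfolding sobolev_space0_def topspace_sobolev_topology[OF assms(1,2)] by blast
  have "sobolev_norm \<Omega> p (u - u) = 0"
    using sobolev_norm_zero[OF assms(1,2)] by (simp add: fun_diff_def)
  then have "u \<in> {v \<in> sobolev_space \<Omega> p. sobolev_norm \<Omega> p (v - u) < r}"
    using u assms(4) by simp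
  then have "\<exists>\<phi>. \<phi> \<in> test_functions \<Omega> \<and> \<phi> \<in> {v \<in> sobolev_space \<Omega> p. sobolev_norm \<Omega> p (v - u) < r}"
  proof -
    have "\<forall>T. u \<in> T \<and> openin (sobolev_topology \<Omega> p) T \<longrightarrow> (\<exists>y. y \<in> test_functions \<Omega> \<and> y \<in> T)"
      using assms(3) by (simp add: sobolev_space0_def in_closure_of)
    from this[rule_format, OF conjI[OF _ openin_sobolev_ball[OF u assms(4)]]] show ?thesis
      using \<open>u \<in> {v \<in> sobolev_space \<Omega> p. sobolev_norm \<Omega> p (v - u) < r}\<close> by simp
  qed
  then show ?thesis by auto
qed

lemma sobolev_space0_subset:
  assumes "open \<Omega>" "p > 0" shows "sobolev_space0 \<Omega> p \<subseteq> sobolev_space \<Omega> p"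
  using closure_of_subset_topspace[of "sobolev_topology \<Omega> p" "test_functions \<Omega>"]
  unfolding sobolev_space0_def topspace_sobolev_topology[OF assms] .

lemma test_functions_subset_sobolev_space0:
  assumes "open \<Omega>" "p > 0" shows "test_functions \<Omega> \<subseteq> sobolev_space0 \<Omega> p"
  unfolding sobolev_space0_def
  by (rule closure_of_subset)
     (simp add: topspace_sobolev_topology[OF assms] test_functions_subset_sobolev_space[OF assms])

lemma continuous_map_into_sobolev:
  fixes C :: "'c::metric_space set" and \<Phi> :: "'c \<Rightarrow> 'a::euclidean_space \<Rightarrow> real"
  assumes \<Omega>: "open \<Omega>" and p: "p \<ge> 1" and sob: "\<And>c. c \<in> C \<Longrightarrow> \<Phi> c \<in> sobolev_space \<Omega> p"
    and cont: "\<And>c e. c \<in> C \<Longrightarrow> e > 0 \<Longrightarrow>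
      \<exists>d>0. \<forall>c'\<in>C. dist c' c < d \<longrightarrow> sobolev_norm \<Omega> p (\<Phi> c' - \<Phi> c) < e"
  shows "continuous_map (top_of_set C) (sobolev_topology \<Omega> p) \<Phi>"
  unfolding sobolev_topology_def
proof (rule continuous_on_generated_topo)
  fix U assume "U \<in> {{v \<in> sobolev_space \<Omega> p. sobolev_norm \<Omega> p (v - u) < r} |u r. u \<in> sobolev_space \<Omega> p \<and> r > 0}"
  then obtain u r where U: "U = {v \<in> sobolev_space \<Omega> p. sobolev_norm \<Omega> p (v - u) < r}" and u: "u \<in> sobolev_space \<Omega> p"
    by blast
  have "openin (top_of_set C) (\<Phi> -` U \<inter> C)"
    unfolding openin_euclidean_subtopology_iff
  proof (intro conjI ballI)
    fix c assume c: "c \<in> \<Phi> -` U \<inter> C"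
    define e where "e = r - sobolev_norm \<Omega> p (\<Phi> c - u)"
    have "e > 0" "c \<in> C" using c by (auto simp: e_def U)
    then obtain d where d: "d > 0" "\<forall>c'\<in>C. dist c' c < d \<longrightarrow> sobolev_norm \<Omega> p (\<Phi> c' - \<Phi> c) < e"
      using cont by blast
    have "c' \<in> \<Phi> -` U \<inter> C" if c': "c' \<in> C" "dist c' c < d" for c'
    proof -
      have "sobolev_norm \<Omega> p (\<Phi> c' - u) \<le> sobolev_norm \<Omega> p (\<Phi> c' - \<Phi> c) + sobolev_norm \<Omega> p (\<Phi> c - u)"
        by (rule sobolev_norm_triangle[OF \<Omega> p sob[OF c'(1)] sob[OF \<open>c \<in> C\<close>] u])
      moreover have "sobolev_norm \<Omega> p (\<Phi> c' - \<Phi> c) < e" using d(2) c' by blast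
      ultimately show ?thesis using c' sob by (simp add: U e_def)
    qed
    then show "\<exists>e>0. \<forall>x'\<in>C. dist x' c < e \<longrightarrow> x' \<in> \<Phi> -` U \<inter> C"
      using d(1) by blast
  qed simp
  then show "openin (top_of_set C) (\<Phi> -` U \<inter> topspace (top_of_set C))" by simp
next
  show "\<Phi> ` topspace (top_of_set C) \<subseteq> \<Union> {{v \<in> sobolev_space \<Omega> p. sobolev_norm \<Omega> p (v - u) < r} |u r. u \<in> sobolev_space \<Omega> p \<and> r > 0}"
    using sob topspace_sobolev_topology[of \<Omega> p] \<Omega> p
    unfolding sobolev_topology_def topology_generated_by_topspace by auto
qed

lemma continuous_map_from_sobolev:
  fixes V :: "('a::euclidean_space \<Rightarrow> real) \<Rightarrow> 'c::metric_space"
  assumes \<Omega>: "open \<Omega>" and p: "p > 0" and A: "A \<subseteq> sobolev_space \<Omega> p"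
    and cont: "\<And>u e. u \<in> A \<Longrightarrow> e > 0 \<Longrightarrow>
      \<exists>r>0. \<forall>v\<in>A. sobolev_norm \<Omega> p (v - u) < r \<longrightarrow> dist (V v) (V u) < e"
  shows "continuous_map (subtopology (sobolev_topology \<Omega> p) A) euclidean V"
  unfolding continuous_map_def
proof (intro conjI allI impI)
  fix W :: "'c set" assume "openin euclidean W"
  then have W: "open W" by simp
  have top: "topspace (subtopology (sobolev_topology \<Omega> p) A) = A"
    using A by (auto simp: topspace_sobolev_topology[OF \<Omega> p])
  show "openin (subtopology (sobolev_topology \<Omega> p) A) {x \<in> topspace (subtopology (sobolev_topology \<Omega> p) A). V x \<in> W}"
    unfolding top
  proof (subst openin_subopen, intro ballI)
    fix u assume u: "u \<in> {x \<in> A. V x \<in> W}"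
    then obtain e where e: "e > 0" "\<And>y. dist y (V u) < e \<Longrightarrow> y \<in> W"
      using W unfolding open_dist by blast
    obtain r where r: "r > 0" "\<forall>v\<in>A. sobolev_norm \<Omega> p (v - u) < r \<longrightarrow> dist (V v) (V u) < e"
      using cont[of u e] u e(1) by blast
    let ?B = "{v \<in> sobolev_space \<Omega> p. sobolev_norm \<Omega> p (v - u) < r}"
    have uS: "u \<in> sobolev_space \<Omega> p" using u A by blast
    have "sobolev_norm \<Omega> p (u - u) = 0"
      using sobolev_norm_zero[OF \<Omega> p] by (simp add: fun_diff_def)
    then have "u \<in> ?B \<inter> A" using u uS r(1) by simp
    moreover have "openin (subtopology (sobolev_topology \<Omega> p) A) (?B \<inter> A)"
      using openin_sobolev_ball[OF uS r(1)] by (auto simp: openin_subtopology)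
    moreover have "?B \<inter> A \<subseteq> {x \<in> A. V x \<in> W}" using r(2) e(2) by blast
    ultimately show "\<exists>T. openin (subtopology (sobolev_topology \<Omega> p) A) T \<and> u \<in> T \<and> T \<subseteq> {x \<in> A. V x \<in> W}"
      by blast
  qed
qed simp

lemma compactin_sobolev_bounded:
  assumes \<Omega>: "open \<Omega>" and p: "p \<ge> 1" and A: "compactin (sobolev_topology \<Omega> p) A"
  shows "\<exists>B. \<forall>u\<in>A. sobolev_norm \<Omega> p u \<le> B"
proof -
  have AS: "A \<subseteq> sobolev_space \<Omega> p"
    using compactin_subset_topspace[OF A] p by (simp add: topspace_sobolev_topology[OF \<Omega>])
  define b where "b u = {v \<in> sobolev_space \<Omega> p. sobolev_norm \<Omega> p (v - u) < 1}" for u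
  have "\<exists>\<F>. finite \<F> \<and> \<F> \<subseteq> b ` A \<and> A \<subseteq> \<Union> \<F>"
  proof (rule compactinD[OF A])
    show "openin (sobolev_topology \<Omega> p) U" if U: "U \<in> b ` A" for U
    proof -
      obtain u where "u \<in> A" "U = b u" using U by blast
      then show ?thesis
        unfolding b_def using AS by (auto intro: openin_sobolev_ball)
    qed
    show "A \<subseteq> \<Union> (b ` A)"
    proof
      fix u assume u: "u \<in> A"
      have "sobolev_norm \<Omega> p (u - u) = 0"
        using sobolev_norm_zero[OF \<Omega>, of p] p by (simp add: fun_diff_def)
      then have "u \<in> b u" using u AS by (auto simp: b_def)
      then show "u \<in> \<Union> (b ` A)" using u by blast
    qed
  qed
  then obtain F where F: "finite F" "F \<subseteq> A" "A \<subseteq> \<Union> (b ` F)"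
    by (metis finite_subset_image)
  \<comment> \<open>Summing the norms of the centres, instead of taking their maximum, covers an
    empty cover as well.\<close>
  have "sobolev_norm \<Omega> p v \<le> (\<Sum>u\<in>F. sobolev_norm \<Omega> p u) + 1" if v: "v \<in> A" for v
  proof -
    obtain u where u: "u \<in> F" "v \<in> b u" using F(3) v by blast
    have "sobolev_norm \<Omega> p v \<le> sobolev_norm \<Omega> p u + sobolev_norm \<Omega> p (v - u)"
      by (rule sobolev_norm_le_add[OF \<Omega> p]) (use u v F AS in auto)
    moreover have "sobolev_norm \<Omega> p u \<le> (\<Sum>u\<in>F. sobolev_norm \<Omega> p u)"
      using F(1) u(1) by (intro member_le_sum) (auto simp: sobolev_norm_nonneg)
    ultimately show ?thesis using u(2) by (simp add: b_def)
  qed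
  then show ?thesis by blast
qed

section \<open>Admissible sets from families of Lipschitz functions\<close>

text \<open>An odd map on the image, composed with \<open>f\<close>, is an odd map on
  \<open>A\<close> into the same punctured space; the infimum for \<open>A\<close> is thus over a
  larger set.\<close>

lemma genus_le_image:
  assumes cont: "continuous_map (subtopology T A) T' f"
    and odd: "\<And>v. v \<in> A \<Longrightarrow> f (- v) = - f v"
  shows "genus T A \<le> genus T' (f ` A)"
  unfolding genus_def
proof (rule Inf_superset_mono, rule subsetI)
  fix g assume "g \<in> {enat j |j. \<exists>\<phi>. continuous_map (subtopology T' (f ` A)) (subtopology (Euclidean_space j) (- {\<lambda>_. 0})) \<phi> \<and>
     (\<forall>v\<in>f ` A. \<phi> (- v) = - \<phi> v)}"
  then obtain j \<phi> where g: "g = enat j"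
    and \<phi>: "continuous_map (subtopology T' (f ` A)) (subtopology (Euclidean_space j) (- {\<lambda>_. 0})) \<phi>"
      "\<forall>v\<in>f ` A. \<phi> (- v) = - \<phi> v"
    by blast
  have "continuous_map (subtopology T A) (subtopology T' (f ` A)) f"
    by (rule continuous_map_into_subtopology[OF cont]) (auto simp: topspace_subtopology)
  then have "continuous_map (subtopology T A) (subtopology (Euclidean_space j) (- {\<lambda>_. 0})) (\<phi> \<circ> f)"
    by (rule continuous_map_compose[OF _ \<phi>(1)])
  moreover have "\<forall>v\<in>A. (\<phi> \<circ> f) (- v) = - (\<phi> \<circ> f) v"
    using odd \<phi>(2) by simp
  ultimately show "g \<in> {enat j |j. \<exists>\<phi>. continuous_map (subtopology T A) (subtopology (Euclidean_space j) (- {\<lambda>_. 0})) \<phi> \<and>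
     (\<forall>v\<in>A. \<phi> (- v) = - \<phi> v)}"
    using g by blast
qed

lemma sobolev_norm_test_function_le:
  assumes \<Omega>: "open \<Omega>" "\<Omega> \<in> lmeasurable" and p: "p > 0" and \<phi>: "\<phi> \<in> test_functions \<Omega>" and B: "B \<ge> 0"
    and bounds: "\<And>x. \<bar>\<phi> x\<bar> \<le> B" "\<And>x. norm (gradient \<phi> x) \<le> B"
  shows "sobolev_norm \<Omega> p \<phi> \<le> B * (2 * measure lebesgue \<Omega>) powr (1 / p)"
proof -
  have "sobolev_power \<Omega> p \<phi> \<le> B powr p * measure lebesgue \<Omega> + B powr p * measure lebesgue \<Omega>"
    unfolding sobolev_power_def dirichlet_energy_test_function[OF \<Omega>(1) p \<phi>]
    using integral_powr_le_measure[OF \<Omega>(2) test_function_Lp(1)[OF \<Omega>(1) p \<phi>] p B]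
      integral_powr_le_measure[OF \<Omega>(2) test_function_Lp(2)[OF \<Omega>(1) p \<phi>] p B] bounds
    by (intro add_mono) auto
  also have "\<dots> = (B * (2 * measure lebesgue \<Omega>) powr (1 / p)) powr p"
    using p B by (simp add: powr_mult powr_powr)
  finally show ?thesis
    using p B by (subst sobolev_norm_le_iff) auto
qed

text \<open>The witness is the image of \<open>C\<close> under \<open>z v\<close> divided by the \<open>p\<close>-th root of its constraint integral.\<close>

lemma family_admissible:
  fixes C :: "'c::{metric_space, uminus} set" and z :: "'c \<Rightarrow> 'a::euclidean_space \<Rightarrow> real"
  assumes \<Omega>: "open \<Omega>" "\<Omega> \<in> lmeasurable" and p: "p \<ge> 1"
    and m: "m \<in> borel_measurable (lebesgue_on \<Omega>)" "\<And>x. x \<in> \<Omega> \<Longrightarrow> \<bar>m x\<bar> \<le> M"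
    and C: "compact C" "\<And>v. v \<in> C \<Longrightarrow> - v \<in> C" "enat k \<le> genus euclidean C"
    and z: "\<And>v. v \<in> C \<Longrightarrow> z v \<in> test_functions \<Omega>" "\<And>v x. v \<in> C \<Longrightarrow> z (- v) x = - z v x"
    and zb: "\<And>v x. v \<in> C \<Longrightarrow> \<bar>z v x\<bar> \<le> Z" "\<And>v x. v \<in> C \<Longrightarrow> norm (gradient (z v) x) \<le> L" "L \<ge> 0" "Z \<ge> 0"
    and zc: "\<And>v v' x. v \<in> C \<Longrightarrow> v' \<in> C \<Longrightarrow> \<bar>z v' x - z v x\<bar> \<le> T * dist v' v"
      "\<And>v v' x. v \<in> C \<Longrightarrow> v' \<in> C \<Longrightarrow> norm (gradient (z v') x - gradient (z v) x) \<le> T * dist v' v" "T \<ge> 0"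
    and D: "D > 0" "\<And>v. v \<in> C \<Longrightarrow> D powr p \<le> integral\<^sup>L (lebesgue_on \<Omega>) (\<lambda>x. m x * \<bar>z v x\<bar> powr p)"
  shows "\<exists>A\<in>admissible_sets \<Omega> m k p. \<forall>u\<in>A. dirichlet_energy \<Omega> p u \<le> (L / D) powr p * measure lebesgue \<Omega>"
proof -
  have p0: "p > 0" using p by simp
  have \<Omega>l: "\<Omega> \<in> sets lebesgue" using \<Omega> by auto
  interpret fin: finite_measure "lebesgue_on \<Omega>" by (rule finite_measure_lebesgue_on[OF \<Omega>(2)])
  define N where "N v = integral\<^sup>L (lebesgue_on \<Omega>) (\<lambda>x. m x * \<bar>z v x\<bar> powr p)" for v
  define a where "a v = N v powr (- (1 / p))" for v
  define \<Phi> where "\<Phi> v = (\<lambda>x. a v * z v x)" for v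
  have N: "N v > 0" "N v \<ge> D powr p" if "v \<in> C" for v
  proof -
    show "N v \<ge> D powr p" using D(2)[OF that] by (simp add: N_def)
    moreover have "D powr p > 0" using D(1) by simp
    ultimately show "N v > 0" by linarith
  qed
  \<comment> \<open>Dominated convergence: the integrands converge pointwise and are bounded by the
    constant \<open>M * Z powr p\<close> on a space of finite measure.\<close>
  have contN: "continuous_on C N"
    unfolding continuous_on_sequentially
  proof (intro allI impI ballI)
    fix X v assume v: "v \<in> C" and X: "(\<forall>n. X n \<in> C) \<and> X \<longlonglongrightarrow> v"
    have lim: "(\<lambda>n. z (X n) x) \<longlonglongrightarrow> z v x" for x
    proof (rule Lim_null_comparison[THEN LIM_zero_cancel])
      show "\<forall>\<^sub>F n in sequentially. norm (z (X n) x - z v x) \<le> T * dist (X n) v"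
        using X zc(1)[OF v] by (intro always_eventually) auto
      have "(\<lambda>n. dist (X n) v) \<longlonglongrightarrow> 0"
        using X by (intro tendsto_dist_iff[THEN iffD1]) blast
      then show "(\<lambda>n. T * dist (X n) v) \<longlonglongrightarrow> 0"
        by (rule tendsto_mult_right_zero)
    qed
    have meas: "z u \<in> borel_measurable (lebesgue_on \<Omega>)" if "u \<in> C" for u
      using test_function_Lp(1)[OF \<Omega>(1) p0 z(1)[OF that]] by (simp add: Lp_space_def)
    have "(\<lambda>n. integral\<^sup>L (lebesgue_on \<Omega>) (\<lambda>x. m x * \<bar>z (X n) x\<bar> powr p))
        \<longlonglongrightarrow> integral\<^sup>L (lebesgue_on \<Omega>) (\<lambda>x. m x * \<bar>z v x\<bar> powr p)"
    proof (rule integral_dominated_convergence[where w="\<lambda>_. M * Z powr p"])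
      show "(\<lambda>x. m x * \<bar>z v x\<bar> powr p) \<in> borel_measurable (lebesgue_on \<Omega>)"
        using m(1) meas[OF v] by measurable
      show "(\<lambda>x. m x * \<bar>z (X n) x\<bar> powr p) \<in> borel_measurable (lebesgue_on \<Omega>)" for n
      proof -
        have "z (X n) \<in> borel_measurable (lebesgue_on \<Omega>)" using meas X by blast
        with m(1) show ?thesis by measurable
      qed
      show "AE x in lebesgue_on \<Omega>. (\<lambda>n. m x * \<bar>z (X n) x\<bar> powr p) \<longlonglongrightarrow> m x * \<bar>z v x\<bar> powr p"
        using p0 by (intro AE_I2 tendsto_mult tendsto_const tendsto_powr2 tendsto_rabs lim) auto
      show "AE x in lebesgue_on \<Omega>. norm (m x * \<bar>z (X n) x\<bar> powr p) \<le> M * Z powr p" for n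
      proof (rule AE_I2)
        fix x assume "x \<in> space (lebesgue_on \<Omega>)"
        then have mx: "\<bar>m x\<bar> \<le> M" using m(2) by (simp add: space_restrict_space)
        have "\<bar>z (X n) x\<bar> powr p \<le> Z powr p"
          using zb(1)[of "X n" x] X p0 by (intro powr_mono2) auto
        then have "\<bar>m x\<bar> * \<bar>z (X n) x\<bar> powr p \<le> M * Z powr p"
          using mx by (intro mult_mono) auto
        then show "norm (m x * \<bar>z (X n) x\<bar> powr p) \<le> M * Z powr p" by (simp add: abs_mult)
      qed
    qed simp
    then show "(N \<circ> X) \<longlonglongrightarrow> N v" by (simp add: N_def comp_def)
  qed
  have conta: "continuous_on C a"
    unfolding a_def
  proof (rule continuous_on_powr[OF contN continuous_on_const], intro ballI)
    fix v assume "v \<in> C" then show "N v \<noteq> 0" using N(1)[of v] by simp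
  qed
  have a: "a v > 0" "a v \<le> 1 / D" "a v powr p * N v = 1" if v: "v \<in> C" for v
  proof -
    show "a v > 0" using N(1)[OF v] by (simp add: a_def)
    have "a v \<le> (D powr p) powr (- (1 / p))"
      unfolding a_def using N[OF v] D(1) p0 by (intro powr_mono2') auto
    then show "a v \<le> 1 / D" using p0 D(1) by (simp add: powr_powr powr_minus_divide)
    show "a v powr p * N v = 1"
    proof -
      have "a v powr p = N v powr (-1)" using p0 by (simp add: a_def powr_powr)
      then show ?thesis using N(1)[OF v] by (simp add: powr_minus_divide)
    qed
  qed
  have test: "\<Phi> v \<in> test_functions \<Omega>" if "v \<in> C" for v
    unfolding \<Phi>_def by (rule test_functions_cmul[OF z(1)[OF that]])
  have smooth: "smooth_fun (z v)" if "v \<in> C" for v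
    by (rule test_functions_smooth[OF z(1)[OF that]])
  have sob: "\<Phi> v \<in> sobolev_space \<Omega> p" if "v \<in> C" for v
    using test[OF that] test_functions_subset_sobolev_space[OF \<Omega>(1) p0] by blast
  have N_minus: "N (- v) = N v" if "v \<in> C" for v
    by (simp add: N_def z(2)[OF that])
  have odd: "\<Phi> (- v) = - \<Phi> v" if "v \<in> C" for v
    using N_minus[OF that] by (simp add: \<Phi>_def a_def fun_eq_iff z(2)[OF that])
  have cont: "continuous_map (top_of_set C) (sobolev_topology \<Omega> p) \<Phi>"
  proof (rule continuous_map_into_sobolev[OF \<Omega>(1) p sob])
    fix v and e :: real assume v: "v \<in> C" and e: "e > 0"
    \<comment> \<open>The difference is split as
      \<open>a v' (z v' - z v) + (a v' - a v) z v\<close>, and likewise for gradients. The radii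
      \<open>d2\<close> and \<open>d1\<close> make the two terms at most \<open>e1 / 2\<close> each,
      using \<open>a v' <= 1 / D\<close>; the added ones in \<open>Q\<close>, \<open>Z1\<close> and
      \<open>T1\<close> keep the divisors positive.\<close>
    define Q where "Q = (2 * measure lebesgue \<Omega>) powr (1 / p) + 1"
    have Q: "Q > 0" by (simp add: Q_def add_nonneg_pos)
    define e1 where "e1 = e / (2 * Q)"
    have e1: "e1 > 0" using e Q by (simp add: e1_def)
    define Z1 where "Z1 = Z + L + 1"
    have Z1: "Z1 > 0" "Z + L \<le> Z1" using zb(3,4) by (simp_all add: Z1_def)
    define T1 where "T1 = T + 1"
    have T1: "T1 > 0" "T \<le> T1" using zc(3) by (simp_all add: T1_def)
    define e2 where "e2 = e1 / (2 * Z1)"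
    have e2: "e2 > 0" using e1 Z1 by (simp add: e2_def)
    obtain d1 where d1: "d1 > 0" "\<And>v'. v' \<in> C \<Longrightarrow> dist v' v < d1 \<Longrightarrow> dist (a v') (a v) < e2"
      using conta[unfolded continuous_on_iff, rule_format, OF v e2] by blast
    define d2 where "d2 = e1 * D / (2 * T1)"
    have d2: "d2 > 0" using e1 D(1) T1 by (simp add: d2_def)
    have "sobolev_norm \<Omega> p (\<Phi> v' - \<Phi> v) < e" if v': "v' \<in> C" "dist v' v < min d1 d2" for v'
    proof -
      have da: "\<bar>a v' - a v\<bar> \<le> e2" using d1(2)[OF v'(1)] v'(2) by (simp add: dist_real_def)
      have small: "a v' * (T * dist v' v) + \<bar>a v' - a v\<bar> * (Z + L) \<le> e1"
      proof -
        have "a v' * (T * dist v' v) \<le> 1 / D * (T1 * d2)"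
          using a[OF v'(1)] v'(2) zc(3) T1 D(1) by (intro mult_mono) auto
        also have "\<dots> = e1 / 2" using D(1) T1 by (simp add: d2_def)
        finally have 1: "a v' * (T * dist v' v) \<le> e1 / 2" .
        have "\<bar>a v' - a v\<bar> * (Z + L) \<le> e2 * Z1"
          using da zb(3,4) Z1 e2 by (intro mult_mono) auto
        also have "\<dots> = e1 / 2" using Z1 by (simp add: e2_def)
        finally show ?thesis using 1 by simp
      qed
      have eq: "(\<Phi> v' - \<Phi> v) = (\<lambda>x. a v' * z v' x + (- a v) * z v x)"
        by (simp add: \<Phi>_def fun_diff_def)
      have tst: "(\<Phi> v' - \<Phi> v) \<in> test_functions \<Omega>"
        unfolding eq by (intro test_functions_add test_functions_cmul z(1) v v'(1))
      have "sobolev_norm \<Omega> p (\<Phi> v' - \<Phi> v) \<le> e1 * (2 * measure lebesgue \<Omega>) powr (1 / p)"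
      proof (rule sobolev_norm_test_function_le[OF \<Omega> p0 tst])
        show "e1 \<ge> 0" using e1 by simp
        fix x
        have a0: "a v' \<ge> 0" using a(1)[OF v'(1)] by simp
        have "(\<Phi> v' - \<Phi> v) x = a v' * (z v' x - z v x) + (a v' - a v) * z v x"
          by (simp add: eq algebra_simps)
        then have "\<bar>(\<Phi> v' - \<Phi> v) x\<bar> \<le> a v' * \<bar>z v' x - z v x\<bar> + \<bar>a v' - a v\<bar> * \<bar>z v x\<bar>"
          using a0 abs_triangle_ineq[of "a v' * (z v' x - z v x)" "(a v' - a v) * z v x"] by (simp add: abs_mult)
        also have "\<dots> \<le> a v' * (T * dist v' v) + \<bar>a v' - a v\<bar> * (Z + L)"
          using zc(1)[OF v v'(1)] zb(1)[OF v, of x] zb(3) a0 by (intro add_mono mult_left_mono) auto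
        finally show "\<bar>(\<Phi> v' - \<Phi> v) x\<bar> \<le> e1" using small by linarith
        have "gradient (\<Phi> v' - \<Phi> v) x = a v' *\<^sub>R gradient (z v') x + (- a v) *\<^sub>R gradient (z v) x"
          unfolding eq using smooth[OF v] smooth[OF v'(1)]
          by (simp only: gradient_add[OF smooth_fun_mult[OF smooth_fun_const] smooth_fun_mult[OF smooth_fun_const]] gradient_cmul)
        also have "\<dots> = a v' *\<^sub>R (gradient (z v') x - gradient (z v) x) + (a v' - a v) *\<^sub>R gradient (z v) x"
          by (simp add: algebra_simps)
        finally have "norm (gradient (\<Phi> v' - \<Phi> v) x)
            \<le> a v' * norm (gradient (z v') x - gradient (z v) x) + \<bar>a v' - a v\<bar> * norm (gradient (z v) x)"
          using a0 norm_triangle_ineq[of "a v' *\<^sub>R (gradient (z v') x - gradient (z v) x)" "(a v' - a v) *\<^sub>R gradient (z v) x"]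
          by simp
        also have "\<dots> \<le> a v' * (T * dist v' v) + \<bar>a v' - a v\<bar> * (Z + L)"
          using zc(2)[OF v v'(1)] zb(2)[OF v, of x] zb(4) a0 by (intro add_mono mult_left_mono) auto
        finally show "norm (gradient (\<Phi> v' - \<Phi> v) x) \<le> e1" using small by linarith
      qed
      also have "\<dots> \<le> e1 * Q" using e1 by (simp add: Q_def)
      also have "\<dots> < e" using e Q by (simp add: e1_def)
      finally show ?thesis .
    qed
    then show "\<exists>d>0. \<forall>c'\<in>C. dist c' v < d \<longrightarrow> sobolev_norm \<Omega> p (\<Phi> c' - \<Phi> v) < e"
      using d1(1) d2 by (intro exI[of _ "min d1 d2"]) auto
  qed
  define T0 where "T0 = subtopology (sobolev_topology \<Omega> p) (sobolev_space0 \<Omega> p)"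
  have sob0: "\<Phi> v \<in> sobolev_space0 \<Omega> p" if "v \<in> C" for v
    using test[OF that] test_functions_subset_sobolev_space0[OF \<Omega>(1) p0] by blast
  have cont0: "continuous_map (top_of_set C) T0 \<Phi>"
    unfolding T0_def by (rule continuous_map_into_subtopology[OF cont]) (use sob0 in auto)
  have "\<Phi> ` C \<in> admissible_sets \<Omega> m k p"
    unfolding admissible_sets_def T0_def[symmetric]
  proof (intro CollectI conjI)
    show "\<Phi> ` C \<subseteq> constraint_set \<Omega> m p"
    proof
      fix u assume "u \<in> \<Phi> ` C"
      then obtain v where v: "v \<in> C" "u = \<Phi> v" by blast
      have "m x * \<bar>u x\<bar> powr p = a v powr p * (m x * \<bar>z v x\<bar> powr p)" for x
        using a(1)[OF v(1)] by (simp add: v(2) \<Phi>_def abs_mult powr_mult)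
      then have "integral\<^sup>L (lebesgue_on \<Omega>) (\<lambda>x. m x * \<bar>u x\<bar> powr p)
          = integral\<^sup>L (lebesgue_on \<Omega>) (\<lambda>x. a v powr p * (m x * \<bar>z v x\<bar> powr p))"
        by (intro Bochner_Integration.integral_cong[OF refl])
      also have "\<dots> = a v powr p * N v" by (simp add: N_def)
      finally have "integral\<^sup>L (lebesgue_on \<Omega>) (\<lambda>x. m x * \<bar>u x\<bar> powr p) = a v powr p * N v" .
      then show "u \<in> constraint_set \<Omega> m p"
        using a(3)[OF v(1)] sob0[OF v(1)] v(2) by (simp add: constraint_set_def)
    qed
    show "symmetric_set (\<Phi> ` C)"
      unfolding symmetric_set_def
    proof
      fix u assume "u \<in> \<Phi> ` C"
      then obtain v where v: "v \<in> C" "u = \<Phi> v" by blast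
      have "- u = \<Phi> (- v)" using odd[OF v(1)] v(2) by simp
      then show "- u \<in> \<Phi> ` C" using C(2)[OF v(1)] by blast
    qed
    show "compactin T0 (\<Phi> ` C)"
      by (rule image_compactin[OF _ cont0]) (use C(1) in \<open>simp add: compactin_subtopology\<close>)
    show "enat k \<le> genus T0 (\<Phi> ` C)"
      using C(3) genus_le_image[OF cont0 odd] by (rule order_trans)
  qed
  moreover have "dirichlet_energy \<Omega> p u \<le> (L / D) powr p * measure lebesgue \<Omega>" if u: "u \<in> \<Phi> ` C" for u
  proof -
    obtain v where v: "v \<in> C" "u = \<Phi> v" using u by blast
    have LD: "L / D \<ge> 0" using zb(3) D(1) by simp
    have "norm (gradient u x) \<le> L / D" for x
    proof -
      have "gradient u x = a v *\<^sub>R gradient (z v) x"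
        unfolding v(2) \<Phi>_def by (rule gradient_cmul[OF smooth[OF v(1)]])
      then have "norm (gradient u x) = a v * norm (gradient (z v) x)"
        using a(1)[OF v(1)] by simp
      also have "\<dots> \<le> 1 / D * L"
        using a(1,2)[OF v(1)] zb(2)[OF v(1)] D(1) by (intro mult_mono) auto
      finally show ?thesis by simp
    qed
    then show ?thesis
      using test[OF v(1)] unfolding v(2)[symmetric]
      by (subst dirichlet_energy_test_function[OF \<Omega>(1) p0])
         (auto intro: integral_powr_le_measure[OF \<Omega>(2) test_function_Lp(2)[OF \<Omega>(1) p0] p0 LD])
  qed
  ultimately show ?thesis by (intro bexI[of _ "\<Phi> ` C"] ballI)
qed

section \<open>Lipschitz constants and mollification\<close>

lemma norm_gradient_le_lipschitz:
  assumes f: "smooth_fun f" and L: "\<And>x y. \<bar>f x - f y\<bar> \<le> L * norm (x - y)"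
  shows "norm (gradient f x) \<le> L"
proof (cases "gradient f x = 0")
  case True
  \<comment> \<open>In this case only \<open>L >= 0\<close> has to be shown, and two distinct points
    suffice for it.\<close>
  have "\<bar>f x - f (x + (\<Sum>Basis))\<bar> \<le> L * norm (\<Sum>Basis :: 'a)"
    using L[of x "x + \<Sum>Basis"] by (simp add: norm_minus_commute)
  then have "0 \<le> L * norm (\<Sum>Basis :: 'a)"
    using abs_ge_zero order_trans by blast
  moreover have "norm (\<Sum>Basis :: 'a) > 0" by (simp add: One_neq_0)
  ultimately show ?thesis using True by (simp add: zero_le_mult_iff)
next
  case False
  \<comment> \<open>Along the gradient itself the directional derivative is
    \<open>v \<bullet> v\<close>, while the Lipschitz bound makes every difference quotient at most
    \<open>L * norm v\<close>.\<close>
  define v where "v = gradient f x"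
  have "((\<lambda>t. f (x + t *\<^sub>R v)) has_derivative (\<lambda>h. gradient f (x + 0 *\<^sub>R v) \<bullet> (h *\<^sub>R v))) (at 0)"
  proof (rule has_derivative_compose[of "\<lambda>t. x + t *\<^sub>R v" "\<lambda>h. h *\<^sub>R v" 0 UNIV f, OF _ smooth_fun_has_derivative_gradient[OF f]])
    show "((\<lambda>t. x + t *\<^sub>R v) has_derivative (\<lambda>h. h *\<^sub>R v)) (at 0)"
      by (auto intro!: derivative_eq_intros)
  qed
  then have "((\<lambda>t. f (x + t *\<^sub>R v)) has_real_derivative v \<bullet> v) (at 0)"
    by (simp add: has_field_derivative_def v_def mult.commute[of _ "gradient f x \<bullet> gradient f x"])
  then have "((\<lambda>h. (f (x + h *\<^sub>R v) - f x) / h) \<longlongrightarrow> v \<bullet> v) (at 0)"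
    by (simp add: DERIV_def)
  then have "v \<bullet> v \<le> L * norm v"
  proof (rule tendsto_upperbound)
    show "\<forall>\<^sub>F h in at 0. (f (x + h *\<^sub>R v) - f x) / h \<le> L * norm v"
      unfolding eventually_at_filter
    proof (intro always_eventually allI impI)
      fix h :: real assume h: "h \<noteq> 0"
      have "\<bar>(f (x + h *\<^sub>R v) - f x) / h\<bar> \<le> (L * (\<bar>h\<bar> * norm v)) / \<bar>h\<bar>"
        unfolding abs_divide by (rule divide_right_mono) (use L[of "x + h *\<^sub>R v" x] in auto)
      also have "\<dots> = L * norm v" using h by simp
      finally show "(f (x + h *\<^sub>R v) - f x) / h \<le> L * norm v" by linarith
    qed
  qed simp
  then have "norm v * norm v \<le> L * norm v"
    by (simp add: dot_square_norm power2_eq_square)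
  then show ?thesis
    using False by (simp add: v_def)
qed

lemma lipschitz_gradient_bound:
  assumes f: "smooth_fun f" and L: "\<And>x. norm (gradient f x) \<le> L"
  shows "\<bar>f x - f y\<bar> \<le> L * norm (x - y)"
proof -
  have "norm (f x - f y) \<le> L * norm (x - y)"
  proof (rule differentiable_bound[of UNIV f "\<lambda>x h. gradient f x \<bullet> h"])
    show "onorm (\<lambda>h. gradient f x \<bullet> h) \<le> L" for x
    proof (rule onorm_le)
      fix h
      have "norm (gradient f x \<bullet> h) \<le> norm (gradient f x) * norm h"
        by (simp add: Cauchy_Schwarz_ineq2)
      also have "\<dots> \<le> L * norm h" by (intro mult_right_mono L) simp
      finally show "norm (gradient f x \<bullet> h) \<le> L * norm h" .
    qed
  qed (auto simp: smooth_fun_has_derivative_gradient[OF f])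
  then show ?thesis by simp
qed

text \<open>The support is measured by a cube, to match bumps on boxes. The mass is that of the
  reflected function, since this is the weight with which translates are averaged below.\<close>

definition mollifier :: "real \<Rightarrow> ('a::euclidean_space \<Rightarrow> real) \<Rightarrow> bool" where
  "mollifier \<tau> \<psi> \<longleftrightarrow> smooth_fun \<psi> \<and> (\<forall>x. 0 \<le> \<psi> x) \<and>
     (\<forall>x. x \<notin> cbox (- (\<tau> *\<^sub>R One)) (\<tau> *\<^sub>R One) \<longrightarrow> \<psi> x = 0) \<and> integral\<^sup>L lborel (\<lambda>x. \<psi> (- x)) = 1"

lemma integrable_lborel_continuous_compact_support:
  fixes f :: "'a::euclidean_space \<Rightarrow> real"
  assumes "continuous_on UNIV f" "compact K" "\<And>x. x \<notin> K \<Longrightarrow> f x = 0"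
  shows "integrable lborel f"
proof -
  have "integrable lebesgue f" by (rule integrable_continuous_compact_support[OF assms])
  moreover have "f \<in> borel_measurable lborel"
    using borel_measurable_continuous_onI[OF assms(1)] by simp
  ultimately show ?thesis by (simp add: integrable_completion)
qed

lemma uminus_in_symmetric_cbox:
  "- x \<in> cbox (- (\<tau> *\<^sub>R One)) (\<tau> *\<^sub>R One) \<longleftrightarrow> x \<in> cbox (- (\<tau> *\<^sub>R One)) (\<tau> *\<^sub>R (One :: 'a::euclidean_space))"
  by (auto simp: mem_box)

lemma mollifier_exists:
  assumes "\<tau> > 0" shows "\<exists>\<psi> :: 'a::euclidean_space \<Rightarrow> real. mollifier \<tau> \<psi>"
proof -
  let ?a = "- (\<tau> *\<^sub>R One) :: 'a" and ?c = "\<tau> *\<^sub>R One :: 'a"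
  define k where "k = box_bump 1 ?a ?c"
  have k: "smooth_fun k" "\<And>x. 0 \<le> k x" "\<And>x. k x \<noteq> 0 \<longleftrightarrow> x \<in> box ?a ?c"
    by (simp_all add: k_def smooth_fun_box_bump box_bump_nonneg box_bump_pos_iff)
  have k0: "k x = 0" if "x \<notin> cbox ?a ?c" for x
    using k(3)[of x] that box_subset_cbox[of ?a ?c] by blast
  have cont: "continuous_on UNIV (\<lambda>x. k (- x))"
    by (intro continuous_on_compose2[OF smooth_fun_continuous[OF k(1)]] continuous_intros) auto
  have int: "integrable lborel (\<lambda>x. k (- x))"
    by (rule integrable_lborel_continuous_compact_support[OF cont compact_cbox[of ?a ?c]])
       (simp add: k0 uminus_in_symmetric_cbox)
  define I where "I = integral\<^sup>L lborel (\<lambda>x. k (- x))"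
  \<comment> \<open>A nonnegative function with integral 0 would vanish almost everywhere, but this
    one is positive on a neighbourhood of 0, and nonempty open sets are not negligible.\<close>
  have "I \<noteq> 0"
  proof
    assume "I = 0"
    then have "AE x in lborel. k (- x) = 0"
      using int k(2) by (simp add: I_def integral_nonneg_eq_0_iff_AE)
    then have "AE x in lebesgue. k (- x) = 0" by (rule AE_completion)
    then obtain N where N: "N \<in> null_sets lebesgue" "{x. k (- x) \<noteq> 0} \<subseteq> N"
      unfolding eventually_ae_filter by auto
    then have "negligible {x. k (- x) \<noteq> 0}"
      using negligible_subset negligible_iff_null_sets by blast
    moreover have "open {x. k (- x) \<noteq> 0}"
      using cont by (intro open_Collect_neq) (auto intro!: continuous_intros)
    moreover have "0 \<in> {x. k (- x) \<noteq> 0}"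
      using assms by (simp add: k(3) mem_box)
    ultimately show False using open_not_negligible by blast
  qed
  moreover have "I \<ge> 0" unfolding I_def by (rule integral_nonneg_AE) (simp add: k(2))
  ultimately have I: "I > 0" by simp
  have "mollifier \<tau> (\<lambda>x. (1 / I) * k x)"
    unfolding mollifier_def
  proof (intro conjI allI impI smooth_fun_mult smooth_fun_const k(1))
    show "integral\<^sup>L lborel (\<lambda>x. (1 / I) * k (- x)) = 1"
      using I by (simp add: I_def[symmetric])
  qed (use I k(2) k0 in auto)
  then show ?thesis by blast
qed

text \<open>Convolution over a fixed box instead of the whole space: differentiation under the
  integral needs a compact domain, and nothing is lost for \<open>w\<close> vanishing off the
  box.\<close>

definition mollify :: "('a::euclidean_space \<Rightarrow> real) \<Rightarrow> 'a \<Rightarrow> 'a \<Rightarrow> ('a \<Rightarrow> real) \<Rightarrow> 'a \<Rightarrow> real" where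
  "mollify \<psi> a c w x = integral (cbox a c) (\<lambda>y. w y * \<psi> (x - y))"

text \<open>Substituting \<open>x + y\<close> for \<open>y\<close> exhibits the convolution as an
  average of translates of \<open>w\<close> with weights independent of \<open>x\<close>. In this
  form Lipschitz constants and sup bounds are visibly preserved.\<close>

lemma mollify_eq_average:
  assumes w: "continuous_on UNIV w" "\<And>x. x \<notin> cbox a c \<Longrightarrow> w x = 0" and \<psi>: "smooth_fun \<psi>"
  shows "mollify \<psi> a c w x = integral\<^sup>L lborel (\<lambda>y. w (x + y) * \<psi> (- y))"
proof -
  define f where "f = (\<lambda>y. w y * \<psi> (x - y))"
  have f: "continuous_on UNIV f" unfolding f_def
    by (intro continuous_on_mult w continuous_on_compose2[OF smooth_fun_continuous[OF \<psi>]] continuous_intros) auto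
  have fm: "f \<in> borel_measurable borel" by (rule borel_measurable_continuous_onI[OF f])
  have zero: "f y = 0" if "y \<notin> cbox a c" for y using w(2)[OF that] by (simp add: f_def)
  have "integrable lebesgue f"
    by (rule integrable_continuous_compact_support[OF f compact_cbox zero])
  then have intc: "integrable (lebesgue_on (cbox a c)) f"
    by (subst integrable_lebesgue_on_supported(1)) (auto simp: zero)
  have "mollify \<psi> a c w x = integral (cbox a c) f" by (simp add: mollify_def f_def)
  also have "\<dots> = integral\<^sup>L (lebesgue_on (cbox a c)) f"
    using lebesgue_integral_eq_integral[OF intc] by simp
  also have "\<dots> = integral\<^sup>L lebesgue f"
    by (rule integrable_lebesgue_on_supported(2)) (auto simp: zero)
  also have "\<dots> = integral\<^sup>L lborel f"
    using fm by (simp add: integral_completion)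
  also have "\<dots> = integral\<^sup>L lborel (\<lambda>y. f (x + y))"
    by (rule integral_translation[OF fm, symmetric])
  finally show ?thesis by (simp add: f_def)
qed

lemma mollifier_average:
  fixes u :: "'a::euclidean_space \<Rightarrow> real"
  assumes \<psi>: "mollifier \<tau> \<psi>" and u: "continuous_on UNIV u"
  shows "integrable lborel (\<lambda>y. u y * \<psi> (- y))"
    and "(\<And>y. y \<in> cbox (- (\<tau> *\<^sub>R One)) (\<tau> *\<^sub>R One) \<Longrightarrow> \<bar>u y\<bar> \<le> B) \<Longrightarrow>
      \<bar>integral\<^sup>L lborel (\<lambda>y. u y * \<psi> (- y))\<bar> \<le> B"
proof -
  have s: "smooth_fun \<psi>" and nn: "\<And>x. 0 \<le> \<psi> x" and one: "integral\<^sup>L lborel (\<lambda>x. \<psi> (- x)) = 1"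
    and sup: "\<And>x. x \<notin> cbox (- (\<tau> *\<^sub>R One)) (\<tau> *\<^sub>R One) \<Longrightarrow> \<psi> x = 0"
    using \<psi> unfolding mollifier_def by blast+
  have cont: "continuous_on UNIV (\<lambda>y. \<psi> (- y))"
    by (intro continuous_on_compose2[OF smooth_fun_continuous[OF s]] continuous_intros) auto
  show int: "integrable lborel (\<lambda>y. u y * \<psi> (- y))"
    by (rule integrable_lborel_continuous_compact_support[OF continuous_on_mult[OF u cont] compact_cbox[of "- (\<tau> *\<^sub>R One)" "\<tau> *\<^sub>R One"]])
       (simp add: sup uminus_in_symmetric_cbox)
  assume B: "\<And>y. y \<in> cbox (- (\<tau> *\<^sub>R One)) (\<tau> *\<^sub>R One) \<Longrightarrow> \<bar>u y\<bar> \<le> B"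
  have int1: "integrable lborel (\<lambda>y. \<psi> (- y))"
    by (rule integrable_lborel_continuous_compact_support[OF cont compact_cbox[of "- (\<tau> *\<^sub>R One)" "\<tau> *\<^sub>R One"]])
       (simp add: sup uminus_in_symmetric_cbox)
  have "\<bar>integral\<^sup>L lborel (\<lambda>y. u y * \<psi> (- y))\<bar> \<le> integral\<^sup>L lborel (\<lambda>y. \<bar>u y * \<psi> (- y)\<bar>)"
    by (rule integral_abs_bound)
  also have "\<dots> \<le> integral\<^sup>L lborel (\<lambda>y. B * \<psi> (- y))"
  proof (rule integral_mono)
    fix y
    show "\<bar>u y * \<psi> (- y)\<bar> \<le> B * \<psi> (- y)"
    proof (cases "y \<in> cbox (- (\<tau> *\<^sub>R One)) (\<tau> *\<^sub>R (One::'a))")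
      case True
      then show ?thesis using B[OF True] nn[of "- y"] by (simp add: abs_mult mult_right_mono)
    next
      case False
      then show ?thesis using sup[of "- y"] by (simp add: uminus_in_symmetric_cbox)
    qed
  qed (use int int1 in auto)
  also have "\<dots> = B" using one by simp
  finally show "\<bar>integral\<^sup>L lborel (\<lambda>y. u y * \<psi> (- y))\<bar> \<le> B" .
qed

lemma mollify_lipschitz:
  assumes \<psi>: "mollifier \<tau> \<psi>" and w: "continuous_on UNIV w" "\<And>x. x \<notin> cbox a c \<Longrightarrow> w x = 0"
    and L: "\<And>x y. \<bar>w x - w y\<bar> \<le> L * norm (x - y)"
  shows "\<bar>mollify \<psi> a c w x - mollify \<psi> a c w x'\<bar> \<le> L * norm (x - x')"
proof -
  have s: "smooth_fun \<psi>" using \<psi> by (simp add: mollifier_def)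
  have cw: "continuous_on UNIV (\<lambda>y. w (x + y))" for x
    by (intro continuous_on_compose2[OF w(1)] continuous_intros) auto
  have "mollify \<psi> a c w x - mollify \<psi> a c w x' = integral\<^sup>L lborel (\<lambda>y. w (x + y) * \<psi> (- y) - w (x' + y) * \<psi> (- y))"
    using Bochner_Integration.integral_diff[OF mollifier_average(1)[OF \<psi> cw[of x]] mollifier_average(1)[OF \<psi> cw[of x']]]
      mollify_eq_average[OF w s, where a=a and c=c and x=x] mollify_eq_average[OF w s, where a=a and c=c and x=x']
    by simp
  also have "\<dots> = integral\<^sup>L lborel (\<lambda>y. (w (x + y) - w (x' + y)) * \<psi> (- y))"
    by (simp add: left_diff_distrib)
  finally have "mollify \<psi> a c w x - mollify \<psi> a c w x' = integral\<^sup>L lborel (\<lambda>y. (w (x + y) - w (x' + y)) * \<psi> (- y))" .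
  moreover have "\<bar>integral\<^sup>L lborel (\<lambda>y. (w (x + y) - w (x' + y)) * \<psi> (- y))\<bar> \<le> L * norm (x - x')"
  proof (rule mollifier_average(2)[OF \<psi> continuous_on_diff[OF cw cw]])
    show "\<bar>w (x + y) - w (x' + y)\<bar> \<le> L * norm (x - x')" for y
      using L[of "x + y" "x' + y"] by simp
  qed
  ultimately show ?thesis by simp
qed

lemma norm_le_in_cbox_One:
  assumes "y \<in> cbox (- (\<tau> *\<^sub>R One)) (\<tau> *\<^sub>R (One::'a::euclidean_space))"
  shows "norm y \<le> \<tau> * DIM('a)"
proof -
  have "norm y \<le> (\<Sum>b\<in>Basis. \<bar>y \<bullet> b\<bar>)" by (rule norm_le_l1)
  also have "\<dots> \<le> (\<Sum>b\<in>(Basis::'a set). \<tau>)"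
    using assms by (intro sum_mono) (auto simp: mem_box abs_le_iff minus_le_iff)
  finally show ?thesis by (simp add: mult.commute)
qed

lemma mollify_close:
  fixes w :: "'a::euclidean_space \<Rightarrow> real"
  assumes \<psi>: "mollifier \<tau> \<psi>" and w: "continuous_on UNIV w" "\<And>x. x \<notin> cbox a c \<Longrightarrow> w x = 0"
    and L: "\<And>x y. \<bar>w x - w y\<bar> \<le> L * norm (x - y)" and L0: "L \<ge> 0"
  shows "\<bar>mollify \<psi> a c w x - w x\<bar> \<le> L * (\<tau> * DIM('a))"
proof -
  have s: "smooth_fun \<psi>" and one: "integral\<^sup>L lborel (\<lambda>x. \<psi> (- x)) = 1" using \<psi> by (simp_all add: mollifier_def)
  have cw: "continuous_on UNIV (\<lambda>y. w (x + y))"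
    by (intro continuous_on_compose2[OF w(1)] continuous_intros) auto
  have "mollify \<psi> a c w x - w x = integral\<^sup>L lborel (\<lambda>y. w (x + y) * \<psi> (- y)) - integral\<^sup>L lborel (\<lambda>y. w x * \<psi> (- y))"
    using one by (simp add: mollify_eq_average[OF w s])
  also have "\<dots> = integral\<^sup>L lborel (\<lambda>y. w (x + y) * \<psi> (- y) - w x * \<psi> (- y))"
    by (rule Bochner_Integration.integral_diff[symmetric])
       (rule mollifier_average(1)[OF \<psi> cw], rule mollifier_average(1)[OF \<psi> continuous_on_const])
  also have "\<dots> = integral\<^sup>L lborel (\<lambda>y. (w (x + y) - w x) * \<psi> (- y))"
    by (simp add: left_diff_distrib)
  finally have "mollify \<psi> a c w x - w x = integral\<^sup>L lborel (\<lambda>y. (w (x + y) - w x) * \<psi> (- y))" .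
  moreover have "\<bar>integral\<^sup>L lborel (\<lambda>y. (w (x + y) - w x) * \<psi> (- y))\<bar> \<le> L * (\<tau> * DIM('a))"
  proof (rule mollifier_average(2)[OF \<psi> continuous_on_diff[OF cw continuous_on_const]])
    fix y :: 'a assume y: "y \<in> cbox (- (\<tau> *\<^sub>R One)) (\<tau> *\<^sub>R One)"
    have "\<bar>w (x + y) - w x\<bar> \<le> L * norm y" using L[of "x + y" x] by simp
    also have "\<dots> \<le> L * (\<tau> * DIM('a))"
      using norm_le_in_cbox_One[OF y] L0 by (intro mult_left_mono)
    finally show "\<bar>w (x + y) - w x\<bar> \<le> L * (\<tau> * DIM('a))" .
  qed
  ultimately show ?thesis by simp
qed

lemma mollify_eq_0:
  fixes w :: "'a::euclidean_space \<Rightarrow> real"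
  assumes \<psi>: "mollifier \<tau> \<psi>" and w: "continuous_on UNIV w" "\<And>x. x \<notin> cbox a c \<Longrightarrow> w x = 0"
    and zero: "\<And>y. norm y \<le> \<tau> * DIM('a) \<Longrightarrow> w (x + y) = 0"
  shows "mollify \<psi> a c w x = 0"
proof -
  have s: "smooth_fun \<psi>" using \<psi> by (simp add: mollifier_def)
  have cw: "continuous_on UNIV (\<lambda>y. w (x + y))"
    by (intro continuous_on_compose2[OF w(1)] continuous_intros) auto
  have "\<bar>integral\<^sup>L lborel (\<lambda>y. w (x + y) * \<psi> (- y))\<bar> \<le> 0"
    by (rule mollifier_average(2)[OF \<psi> cw]) (simp add: zero norm_le_in_cbox_One)
  then show ?thesis by (simp add: mollify_eq_average[OF w s])
qed

lemma smooth_fun_mollify: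
  assumes "mollifier \<tau> \<psi>" "continuous_on UNIV w"
  shows "smooth_fun (mollify \<psi> a c w)"
proof -
  have "mollify \<psi> a c w = (\<lambda>x. integral (cbox a c) (\<lambda>y. w y * \<psi> (x - y)))"
    by (simp add: mollify_def fun_eq_iff)
  then show ?thesis
    using smooth_fun_convolution(2)[OF assms(2), of \<psi> a c] assms(1) by (simp add: mollifier_def)
qed

lemma mollify_diff:
  assumes "mollifier \<tau> \<psi>" "continuous_on UNIV w" "continuous_on UNIV w'"
  shows "mollify \<psi> a c (\<lambda>x. w x - w' x) x = mollify \<psi> a c w x - mollify \<psi> a c w' x"
proof -
  have s: "smooth_fun \<psi>" using assms(1) by (simp add: mollifier_def)
  have "(\<lambda>y. w y * \<psi> (x - y)) integrable_on cbox a c" if "continuous_on UNIV w" for w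
    by (intro integrable_continuous continuous_on_mult continuous_on_subset[OF that]
        continuous_on_compose2[OF smooth_fun_continuous[OF s]] continuous_intros) auto
  then show ?thesis
    using assms(2,3) by (simp add: mollify_def left_diff_distrib Henstock_Kurzweil_Integration.integral_diff)
qed

lemma mollify_minus: "mollify \<psi> a c (\<lambda>x. - w x) x = - mollify \<psi> a c w x"
  by (simp add: mollify_def)

text \<open>Here the derivative falls on \<open>\<psi>\<close>, so a mere sup bound on
  \<open>w\<close> controls the gradient, with a constant depending on the mollifier and the box. It
  serves the continuous dependence of mollified functions on a parameter, for which the size of
  \<open>T\<close> is immaterial.\<close>

lemma mollify_gradient_sup_bound:
  fixes \<psi> :: "'a::euclidean_space \<Rightarrow> real"
  assumes \<psi>: "mollifier \<tau> \<psi>"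
  shows "\<exists>T\<ge>1. \<forall>w G x. continuous_on UNIV w \<longrightarrow> (\<forall>x. x \<notin> cbox a c \<longrightarrow> w x = 0) \<longrightarrow> (\<forall>x. \<bar>w x\<bar> \<le> G) \<longrightarrow>
    \<bar>mollify \<psi> a c w x\<bar> \<le> T * G \<and> norm (gradient (mollify \<psi> a c w) x) \<le> T * G"
proof -
  have s: "smooth_fun \<psi>" using \<psi> by (simp add: mollifier_def)
  have gz: "gradient \<psi> x = 0" if "x \<notin> cbox (- (\<tau> *\<^sub>R One)) (\<tau> *\<^sub>R One)" for x
  proof (rule gradient_zero_outside[OF s])
    have "closure {x. \<psi> x \<noteq> 0} \<subseteq> cbox (- (\<tau> *\<^sub>R One)) (\<tau> *\<^sub>R One)"
      using \<psi> unfolding mollifier_def by (intro closure_minimal) auto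
    then show "x \<notin> closure {x. \<psi> x \<noteq> 0}" using that by blast
  qed
  have "bounded (gradient \<psi> ` cbox (- (\<tau> *\<^sub>R One)) (\<tau> *\<^sub>R One))"
    by (intro compact_imp_bounded compact_continuous_image continuous_on_gradient s compact_cbox)
  then obtain B where B: "B > 0" "\<And>x. x \<in> cbox (- (\<tau> *\<^sub>R One)) (\<tau> *\<^sub>R One) \<Longrightarrow> norm (gradient \<psi> x) \<le> B"
    unfolding bounded_pos by blast
  have "norm (gradient \<psi> x) \<le> B" for x
    using B gz[of x] by (cases "x \<in> cbox (- (\<tau> *\<^sub>R One)) (\<tau> *\<^sub>R One)") auto
  then have lip: "\<bar>\<psi> x - \<psi> y\<bar> \<le> B * norm (x - y)" for x y
    by (rule lipschitz_gradient_bound[OF s])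
  define T where "T = max 1 (B * measure lborel (cbox a c))"
  have "\<bar>mollify \<psi> a c w x\<bar> \<le> T * G \<and> norm (gradient (mollify \<psi> a c w) x) \<le> T * G"
    if w: "continuous_on UNIV w" and zero: "\<forall>x. x \<notin> cbox a c \<longrightarrow> w x = 0" and G: "\<forall>x. \<bar>w x\<bar> \<le> G" for w G x
  proof
    have G0: "G \<ge> 0" using G abs_ge_zero order_trans by blast
    have cw: "continuous_on UNIV (\<lambda>y. w (x + y))"
      by (intro continuous_on_compose2[OF w] continuous_intros) auto
    have "\<bar>mollify \<psi> a c w x\<bar> \<le> G"
    proof -
      have "mollify \<psi> a c w x = integral\<^sup>L lborel (\<lambda>y. w (x + y) * \<psi> (- y))"
        by (rule mollify_eq_average[OF w _ s]) (use zero in blast)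
      moreover have "\<bar>integral\<^sup>L lborel (\<lambda>y. w (x + y) * \<psi> (- y))\<bar> \<le> G"
        by (rule mollifier_average(2)[OF \<psi> cw]) (use G in blast)
      ultimately show ?thesis by simp
    qed
    also have "\<dots> \<le> T * G" using G0 mult_right_mono[of 1 T G] by (simp add: T_def)
    finally show "\<bar>mollify \<psi> a c w x\<bar> \<le> T * G" .
    have "\<bar>mollify \<psi> a c w x - mollify \<psi> a c w x'\<bar> \<le> (T * G) * norm (x - x')" for x x'
    proof -
      have int: "(\<lambda>y. w y * \<psi> (x - y)) integrable_on cbox a c" for x
        by (intro integrable_continuous continuous_on_mult continuous_on_subset[OF w]
            continuous_on_compose2[OF smooth_fun_continuous[OF s]] continuous_intros) auto
      have "((\<lambda>y. w y * \<psi> (x - y) - w y * \<psi> (x' - y)) has_integral mollify \<psi> a c w x - mollify \<psi> a c w x') (cbox a c)"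
        unfolding mollify_def by (intro has_integral_diff integrable_integral int)
      then have "norm (mollify \<psi> a c w x - mollify \<psi> a c w x') \<le> (G * (B * norm (x - x'))) * measure lborel (cbox a c)"
      proof (rule has_integral_bound[rotated])
        fix y
        have "norm (w y * \<psi> (x - y) - w y * \<psi> (x' - y)) = \<bar>w y\<bar> * \<bar>\<psi> (x - y) - \<psi> (x' - y)\<bar>"
          by (simp add: abs_mult flip: right_diff_distrib)
        also have "\<dots> \<le> G * (B * norm (x - x'))"
          using G lip[of "x - y" "x' - y"] G0 by (intro mult_mono) auto
        finally show "norm (w y * \<psi> (x - y) - w y * \<psi> (x' - y)) \<le> G * (B * norm (x - x'))" .
      qed (use G0 B(1) in simp)
      also have "\<dots> = (B * measure lborel (cbox a c)) * (G * norm (x - x'))" by (simp add: mult_ac)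
      also have "\<dots> \<le> T * (G * norm (x - x'))"
        using G0 by (intro mult_right_mono) (auto simp: T_def)
      finally show ?thesis by (simp add: mult_ac)
    qed
    then show "norm (gradient (mollify \<psi> a c w) x) \<le> T * G"
      by (rule norm_gradient_le_lipschitz[OF smooth_fun_mollify[OF \<psi> w]])
  qed
  moreover have "T \<ge> 1" by (simp add: T_def)
  ultimately show ?thesis by blast
qed

section \<open>Odd truncations\<close>

definition clamp_fun :: "real \<Rightarrow> real \<Rightarrow> real" where
  "clamp_fun h t = max (- h) (min h t)"

text \<open>The bound is a maximum and not a sum. Hence clamping an \<open>L\<close>-Lipschitz
  function at an \<open>L\<close>-Lipschitz height does not increase the Lipschitz constant.\<close>

lemma clamp_fun_lipschitz:
  "h \<ge> 0 \<Longrightarrow> h' \<ge> 0 \<Longrightarrow> \<bar>clamp_fun h t - clamp_fun h' t'\<bar> \<le> max \<bar>h - h'\<bar> \<bar>t - t'\<bar>"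
  unfolding clamp_fun_def by linarith

lemma clamp_fun_le: "h \<ge> 0 \<Longrightarrow> \<bar>clamp_fun h t\<bar> \<le> h"
  unfolding clamp_fun_def by linarith

lemma clamp_fun_minus: "h \<ge> 0 \<Longrightarrow> clamp_fun h (- t) = - clamp_fun h t"
  unfolding clamp_fun_def by linarith

lemma clamp_fun_eq: "h \<ge> 0 \<Longrightarrow> h \<le> \<bar>t\<bar> \<Longrightarrow> \<bar>clamp_fun h t\<bar> = h"
  unfolding clamp_fun_def by linarith

text \<open>Values of modulus at most \<open>\<theta>\<close> are sent to 0 and all others move
  towards 0 by \<open>\<theta>\<close>. Unlike a sharp cut-off this is continuous and 1-Lipschitz,
  and it is odd.\<close>

definition soft_threshold :: "real \<Rightarrow> real \<Rightarrow> real" where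
  "soft_threshold \<theta> t = t - clamp_fun \<theta> t"

lemma soft_threshold_lipschitz:
  "\<theta> \<ge> 0 \<Longrightarrow> \<bar>soft_threshold \<theta> t - soft_threshold \<theta> t'\<bar> \<le> \<bar>t - t'\<bar>"
  unfolding soft_threshold_def clamp_fun_def by linarith

lemma soft_threshold_minus: "\<theta> \<ge> 0 \<Longrightarrow> soft_threshold \<theta> (- t) = - soft_threshold \<theta> t"
  by (simp add: soft_threshold_def clamp_fun_minus)

lemma soft_threshold_eq_0: "\<bar>t\<bar> \<le> \<theta> \<Longrightarrow> soft_threshold \<theta> t = 0"
  unfolding soft_threshold_def clamp_fun_def by linarith

lemma soft_threshold_ge: "\<theta> \<ge> 0 \<Longrightarrow> \<bar>t\<bar> - \<theta> \<le> \<bar>soft_threshold \<theta> t\<bar>"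
  unfolding soft_threshold_def clamp_fun_def by linarith

lemma gradient_diff:
  assumes "smooth_fun f" "smooth_fun g"
  shows "gradient (\<lambda>x. f x - g x) x = gradient f x - gradient g x"
proof -
  have "smooth_fun (\<lambda>x. -1 * g x)" by (rule smooth_fun_mult[OF smooth_fun_const assms(2)])
  then show ?thesis
    using gradient_add[OF assms(1), of "\<lambda>x. -1 * g x" x] gradient_cmul[OF assms(2), of "-1" x] by simp
qed

lemma eventually_powr_le_powr:
  fixes a b e K :: real
  assumes "0 < a" "a < b" "e > 0"
  shows "\<forall>\<^sub>F p in at_top. K * a powr p \<le> e * b powr p"
proof -
  define r where "r = a / b"
  have r: "0 < r" "r < 1" using assms by (simp_all add: r_def)
  have "((\<lambda>p. exp (ln r * p)) \<longlongrightarrow> 0) at_top"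
    by (rule filterlim_compose[OF exp_at_bot filterlim_tendsto_neg_mult_at_bot[OF tendsto_const _ filterlim_ident]])
       (use r in simp)
  then have "((\<lambda>p. K * exp (ln r * p)) \<longlongrightarrow> 0) at_top"
    by (rule tendsto_mult_right_zero)
  then have "\<forall>\<^sub>F p in at_top. K * exp (ln r * p) < e"
    using assms(3) by (rule order_tendstoD(2))
  then show ?thesis
  proof eventually_elim
    case (elim p)
    have "exp (ln r * p) = r powr p" using r by (simp add: powr_def mult.commute)
    then have "K * r powr p * b powr p \<le> e * b powr p"
      using elim by (intro mult_right_mono) auto
    moreover have "r powr p * b powr p = a powr p"
      using assms by (simp add: r_def powr_divide)
    ultimately show ?case by (simp add: mult.assoc)
  qed
qed

text \<open>For the modified functions the constraint integral is at least a constant times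
  \<open>A powr p\<close> minus a constant times \<open>E powr p\<close>, with
  \<open>E < D < A\<close> and \<open>D > L / B\<close>. For large \<open>p\<close> the constants do
  not matter and the integral exceeds \<open>D powr p\<close>, so normalisation raises the gradient
  bound \<open>L\<close> at most to \<open>L / D < B\<close>.\<close>

lemma key_estimate:
  fixes C :: "('a::euclidean_space \<Rightarrow>\<^sub>C real) set" and m :: "'a \<Rightarrow> real"
  assumes \<Omega>: "open \<Omega>" "bounded \<Omega>" and m: "continuous_on (closure \<Omega>) m"
    and C: "compact C" "C \<noteq> {}" "\<And>v. v \<in> C \<Longrightarrow> - v \<in> C" "enat k \<le> genus euclidean C"
    and L: "L > 0" "\<And>v x y. v \<in> C \<Longrightarrow> \<bar>apply_bcontfun v x - apply_bcontfun v y\<bar> \<le> L * norm (x - y)"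
    and out: "\<eta> \<ge> 0" "\<And>v x. v \<in> C \<Longrightarrow> x \<notin> \<Omega> \<Longrightarrow> \<bar>apply_bcontfun v x\<bar> \<le> \<eta>"
    and big: "\<eta> < b" "\<And>v. v \<in> C \<Longrightarrow> \<exists>y\<in>\<Omega>. m y > 0 \<and> \<bar>apply_bcontfun v y\<bar> \<ge> b"
    and B: "B > L / (b - \<eta>)"
  shows "\<forall>\<^sub>F p in at_top. \<exists>A\<in>admissible_sets \<Omega> m k p. \<forall>u\<in>A. dirichlet_energy \<Omega> p u \<le> B powr p"
proof -
  let ?n = "real DIM('a)"
  have n: "?n > 0" by simp
  have \<Omega>m: "\<Omega> \<in> lmeasurable" using \<Omega> by (simp add: lmeasurable_open)
  have \<Omega>l: "\<Omega> \<in> sets lebesgue" using \<Omega>m by (rule fmeasurableD)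
  have B0: "B > 0"
  proof -
    have "L / (b - \<eta>) > 0" using L(1) big(1) by simp
    then show ?thesis using B by linarith
  qed
  \<comment> \<open>Thus \<open>b - \<eta> = L / B + 4 e\<close>. One \<open>e\<close> is spent on
    the threshold above \<open>\<eta>\<close>, one on replacing \<open>b\<close> by
    \<open>b - e\<close> in the open cover; \<open>h0 = L / B + 2 e\<close> remains.\<close>
  define e where "e = (b - \<eta> - L / B) / 4"
  have e: "e > 0"
  proof -
    have "L / B < b - \<eta>" using B B0 big(1) by (simp add: field_simps)
    then show ?thesis by (simp add: e_def)
  qed
  define \<theta> where "\<theta> = \<eta> + e"
  have \<theta>: "\<theta> \<ge> 0" using out(1) e by (simp add: \<theta>_def)
  define h0 where "h0 = b - \<eta> - 2 * e"
  have "4 * e = b - \<eta> - L / B" by (simp add: e_def)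
  then have h0e: "h0 = L / B + 2 * e" unfolding h0_def by linarith
  have h0: "h0 > 0" using h0e e L(1) B0 by (simp add: add_pos_pos)

  define P where "P = {y \<in> \<Omega>. m y > 0}"
  \<comment> \<open>The points at which members of \<open>C\<close> are large may approach the zero
    set of \<open>m\<close>. Compactness of \<open>C\<close> in the sup norm reduces them to a
    finite set \<open>K\<close>, on which \<open>m\<close> has a positive minimum.\<close>
  define U where "U y = {v :: 'a \<Rightarrow>\<^sub>C real. b - e < \<bar>apply_bcontfun v y\<bar>}" for y
  have contev: "continuous_on UNIV (\<lambda>v :: 'a \<Rightarrow>\<^sub>C real. apply_bcontfun v y)" for y
    unfolding continuous_on_iff
  proof (intro ballI allI impI)
    fix v :: "'a \<Rightarrow>\<^sub>C real" and e :: real assume "e > 0"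
    then show "\<exists>d>0. \<forall>v'\<in>UNIV. dist v' v < d \<longrightarrow> dist (apply_bcontfun v' y) (apply_bcontfun v y) < e"
      by (intro exI[of _ e]) (auto intro: le_less_trans[OF dist_bounded])
  qed
  have openU: "open (U y)" for y
    unfolding U_def by (intro open_Collect_less continuous_on_rabs contev continuous_on_const)
  have "C \<subseteq> (\<Union>y\<in>P. U y)"
  proof
    fix v assume "v \<in> C"
    then obtain y where "y \<in> \<Omega>" "m y > 0" "\<bar>apply_bcontfun v y\<bar> \<ge> b" using big(2) by blast
    then show "v \<in> (\<Union>y\<in>P. U y)" using e by (auto simp: P_def U_def)
  qed
  then obtain K where K: "K \<subseteq> P" "finite K" "C \<subseteq> (\<Union>y\<in>K. U y)"
    using compactE_image[OF C(1), of P U] openU by blast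
  have K0: "K \<noteq> {}" using K(3) C(2) by blast

  define c where "c = Min (m ` K) / 2"
  have mK: "m y \<ge> 2 * c" if "y \<in> K" for y
    using K(2) that by (simp add: c_def)
  have c: "c > 0"
  proof -
    have "Min (m ` K) \<in> m ` K" using K(2) K0 by (intro Min_in) auto
    then show ?thesis using K(1) by (auto simp: c_def P_def)
  qed
  define W0 where "W0 = \<Omega> \<inter> m -` {c<..}"
  have "open W0"
    unfolding W0_def using \<Omega>(1) continuous_on_subset[OF m closure_subset]
    by (intro continuous_open_preimage) auto
  moreover have "K \<subseteq> W0"
  proof
    fix y assume y: "y \<in> K"
    then show "y \<in> W0" using mK[OF y] c K(1) by (auto simp: W0_def P_def)
  qed
  ultimately obtain r where r: "r > 0" "(\<Union>y\<in>K. ball y r) \<subseteq> W0"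
    using compact_subset_open_imp_ball_epsilon_subset[OF finite_imp_compact[OF K(2)]] by blast
  have compm: "compact (m ` closure \<Omega>)"
    using compact_continuous_image[OF m] \<Omega>(2) by (simp add: compact_closure)
  obtain M where M: "M > 0" "\<And>x. x \<in> closure \<Omega> \<Longrightarrow> \<bar>m x\<bar> \<le> M"
    using compact_imp_bounded[OF compm] unfolding bounded_pos by auto
  have M\<Omega>: "\<bar>m x\<bar> \<le> M" if "x \<in> \<Omega>" for x
    using M(2) closure_subset that by blast
  have m_meas: "m \<in> borel_measurable (lebesgue_on \<Omega>)"
    by (rule continuous_imp_measurable_on_sets_lebesgue[OF continuous_on_subset[OF m closure_subset] \<Omega>l])

  txt \<open>Clamping at \<open>H\<close> preserves the value \<open>h0\<close> at some point of \<open>K \<subseteq> {m > 0}\<close>, while on the part of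
    \<open>\<Omega>\<close> where \<open>m \<le> c\<close> the values stay below \<open>h0\<close> by a fixed amount, so that for large \<open>p\<close> the negative
    part of \<open>m\<close> is negligible. The soft threshold makes the support compact.\<close>
  define s where "s = Min {e / 3, L * r / 8, h0 / 8}"
  have s: "s > 0" "s \<le> e / 3" "8 * s \<le> L * r" "8 * s \<le> h0"
    using e L(1) r(1) h0 by (auto simp: s_def)
  \<comment> \<open>A ceiling of height \<open>h0\<close> on \<open>K\<close> that descends with
    slope \<open>L\<close>, the steepest slope that keeps the Lipschitz constant.\<close>
  define H where "H x = max 0 (h0 - L * infdist x K)" for x
  have H: "0 \<le> H x" "H x \<le> h0" for x
    using h0 L(1) infdist_nonneg[of x K] by (auto simp: H_def)
  have HL: "\<bar>H x - H y\<bar> \<le> L * norm (x - y)" for x y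
  proof -
    have "\<bar>infdist x K - infdist y K\<bar> \<le> norm (x - y)"
      using infdist_triangle_abs[of x K y] by (simp add: dist_norm)
    then have "L * \<bar>infdist x K - infdist y K\<bar> \<le> L * norm (x - y)"
      using L(1) by (intro mult_left_mono) auto
    moreover have "\<bar>H x - H y\<bar> \<le> \<bar>L * infdist x K - L * infdist y K\<bar>"
      unfolding H_def by linarith
    moreover have "\<bar>L * infdist x K - L * infdist y K\<bar> = L * \<bar>infdist x K - infdist y K\<bar>"
      using L(1) by (simp add: abs_mult flip: right_diff_distrib)
    ultimately show ?thesis by linarith
  qed
  define W where "W v x = clamp_fun (H x) (soft_threshold \<theta> (apply_bcontfun v x))" for v x
  have WL: "\<bar>W v x - W v y\<bar> \<le> L * norm (x - y)" if "v \<in> C" for v x y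
  proof -
    have "\<bar>W v x - W v y\<bar> \<le> max \<bar>H x - H y\<bar> \<bar>soft_threshold \<theta> (apply_bcontfun v x) - soft_threshold \<theta> (apply_bcontfun v y)\<bar>"
      unfolding W_def by (rule clamp_fun_lipschitz[OF H(1) H(1)])
    moreover have "\<bar>soft_threshold \<theta> (apply_bcontfun v x) - soft_threshold \<theta> (apply_bcontfun v y)\<bar> \<le> L * norm (x - y)"
      using soft_threshold_lipschitz[OF \<theta>] L(2)[OF that] order_trans by blast
    ultimately show ?thesis using HL[of x y] by linarith
  qed
  have WH: "\<bar>W v x\<bar> \<le> H x" for v x unfolding W_def by (rule clamp_fun_le[OF H(1)])
  have Wdist: "\<bar>W v' x - W v x\<bar> \<le> dist v' v" for v v' x
  proof -
    have "\<bar>W v' x - W v x\<bar> \<le> max \<bar>H x - H x\<bar> \<bar>soft_threshold \<theta> (apply_bcontfun v' x) - soft_threshold \<theta> (apply_bcontfun v x)\<bar>"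
      unfolding W_def by (rule clamp_fun_lipschitz[OF H(1) H(1)])
    moreover have "\<bar>soft_threshold \<theta> (apply_bcontfun v' x) - soft_threshold \<theta> (apply_bcontfun v x)\<bar> \<le> \<bar>apply_bcontfun v' x - apply_bcontfun v x\<bar>"
      by (rule soft_threshold_lipschitz[OF \<theta>])
    moreover have "\<bar>apply_bcontfun v' x - apply_bcontfun v x\<bar> \<le> dist v' v"
      using dist_bounded[of v' x v] by (simp add: dist_real_def)
    ultimately show ?thesis by simp
  qed
  have contW: "continuous_on UNIV (W v)" for v
    unfolding W_def soft_threshold_def clamp_fun_def H_def
    by (intro continuous_on_max continuous_on_min continuous_on_minus continuous_on_diff continuous_on_mult
        continuous_on_const continuous_on_infdist continuous_on_id continuous_on_apply_bcontfun)
  have Wodd: "W (- v) x = - W v x" for v x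
    by (simp add: W_def soft_threshold_minus[OF \<theta>] clamp_fun_minus[OF H(1)])
  \<comment> \<open>A nonzero value means that \<open>v\<close> exceeds \<open>\<eta> + e\<close> in
    modulus at \<open>x\<close>. Being \<open>L\<close>-Lipschitz it exceeds \<open>\<eta>\<close>
    throughout the ball of radius \<open>e / L\<close>, which is impossible off
    \<open>\<Omega>\<close>.\<close>
  have Wz: "ball x (e / L) \<subseteq> \<Omega>" if v: "v \<in> C" and nz: "W v x \<noteq> 0" for v x
  proof
    fix y assume y: "y \<in> ball x (e / L)"
    have "\<not> \<bar>apply_bcontfun v x\<bar> \<le> \<theta>"
    proof
      assume "\<bar>apply_bcontfun v x\<bar> \<le> \<theta>"
      then have "W v x = clamp_fun (H x) 0" by (simp add: W_def soft_threshold_eq_0)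
      then show False using nz H(1)[of x] by (simp add: clamp_fun_def)
    qed
    moreover have "L * norm (x - y) < e" using y L(1) by (simp add: dist_norm field_simps)
    ultimately have "\<bar>apply_bcontfun v y\<bar> > \<eta>"
      using L(2)[OF v, of x y] by (simp add: \<theta>_def)
    then show "y \<in> \<Omega>" using out(2)[OF v, of y] by fastforce
  qed

  obtain R where R: "\<Omega> \<subseteq> cbox (- R) R"
    using bounded_subset_cbox_symmetric[OF \<Omega>(2)] by blast
  have W0: "W v x = 0" if "v \<in> C" "x \<notin> cbox (- R) R" for v x
  proof (rule ccontr)
    assume "W v x \<noteq> 0"
    then have "ball x (e / L) \<subseteq> \<Omega>" by (rule Wz[OF that(1)])
    moreover have "x \<in> ball x (e / L)" using e L(1) by simp
    ultimately show False using R that(2) by blast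
  qed
  \<comment> \<open>Points of the mollifying cube have norm at most \<open>\<tau>\<close> times the
    dimension. The first bound leaves a margin between the support and the boundary, the second
    keeps the mollification error below \<open>s\<close>.\<close>
  define \<tau> where "\<tau> = min (e / (2 * L)) (s / L) / ?n"
  have \<tau>: "\<tau> > 0" "\<tau> * ?n \<le> e / (2 * L)" "L * (\<tau> * ?n) \<le> s"
  proof -
    have "min (e / (2 * L)) (s / L) > 0" using e L(1) s(1) by simp
    then show "\<tau> > 0" unfolding \<tau>_def by (rule divide_pos_pos) (rule n)
    have eq: "\<tau> * ?n = min (e / (2 * L)) (s / L)" by (simp add: \<tau>_def)
    show "\<tau> * ?n \<le> e / (2 * L)" unfolding eq by simp
    have "L * (\<tau> * ?n) \<le> L * (s / L)" unfolding eq using L(1) by (intro mult_left_mono) auto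
    then show "L * (\<tau> * ?n) \<le> s" using L(1) by simp
  qed
  obtain \<psi> :: "'a \<Rightarrow> real" where \<psi>: "mollifier \<tau> \<psi>" using mollifier_exists[OF \<tau>(1)] by blast
  define z where "z v = mollify \<psi> (- R) R (W v)" for v
  have zsmooth: "smooth_fun (z v)" for v unfolding z_def by (rule smooth_fun_mollify[OF \<psi> contW])
  have zclose: "\<bar>z v x - W v x\<bar> \<le> s" if "v \<in> C" for v x
    using mollify_close[OF \<psi> contW W0[OF that] WL[OF that], where a="- R" and c=R and x=x] \<tau>(3) L(1)
    by (simp add: z_def)
  have zL: "norm (gradient (z v) x) \<le> L" if "v \<in> C" for v x
    by (rule norm_gradient_le_lipschitz[OF zsmooth])
       (use mollify_lipschitz[OF \<psi> contW W0[OF that] WL[OF that]] in \<open>simp add: z_def\<close>)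
  \<comment> \<open>The mollified support stays at distance \<open>d\<close> from the complement,
    because \<open>e / (4 L) + e / (2 L) < e / L\<close>.\<close>
  define d where "d = e / (4 * L)"
  have d: "d > 0" using e L(1) by (simp add: d_def)
  define K2 where "K2 = {x. d \<le> infdist x (- \<Omega>)}"
  have co: "- \<Omega> \<noteq> {}" using \<Omega>(2) by (metis bounded_empty compl_eq_compl_iff Compl_UNIV_eq double_complement not_bounded_UNIV)
  have K2\<Omega>: "K2 \<subseteq> \<Omega>"
  proof
    fix x assume "x \<in> K2"
    then have "infdist x (- \<Omega>) > 0" using d by (simp add: K2_def)
    then show "x \<in> \<Omega>" using infdist_zero[of x "- \<Omega>"] by (cases "x \<in> \<Omega>") auto
  qed
  have K2: "compact K2"
  proof -
    have "closed K2" unfolding K2_def by (intro closed_Collect_le continuous_on_const continuous_on_infdist continuous_on_id)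
    moreover have "bounded K2" using K2\<Omega> \<Omega>(2) bounded_subset by blast
    ultimately show ?thesis by (simp add: compact_eq_bounded_closed)
  qed
  have z0: "z v x = 0" if v: "v \<in> C" and x: "x \<notin> K2" for v x
    unfolding z_def
  proof (rule mollify_eq_0[OF \<psi> contW W0[OF v]])
    fix y :: 'a assume y: "norm y \<le> \<tau> * ?n"
    show "W v (x + y) = 0"
    proof (rule ccontr)
      assume "W v (x + y) \<noteq> 0"
      then have sub: "ball (x + y) (e / L) \<subseteq> \<Omega>" by (rule Wz[OF v])
      have "d \<le> dist x w" if w: "w \<in> - \<Omega>" for w
      proof (rule ccontr)
        assume "\<not> d \<le> dist x w"
        then have "dist x w < e / (4 * L)" by (simp add: d_def)
        moreover have "dist (x + y) x \<le> e / (2 * L)" using y \<tau>(2) by (simp add: dist_norm)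
        moreover have "e / (4 * L) + e / (2 * L) < e / L" using e L(1) by (simp add: field_simps)
        ultimately have "dist (x + y) w < e / L" using dist_triangle[of "x + y" w x] by linarith
        then show False using sub w by auto
      qed
      then have "d \<le> infdist x (- \<Omega>)" unfolding infdist_notempty[OF co] by (intro cINF_greatest co)
      then show False using x by (simp add: K2_def)
    qed
  qed
  have ztest: "z v \<in> test_functions \<Omega>" if "v \<in> C" for v
    by (rule test_functionsI[OF zsmooth K2 K2\<Omega> z0[OF that]])
  obtain T where T: "T \<ge> 1" "\<And>w G x. continuous_on UNIV w \<Longrightarrow> (\<And>x. x \<notin> cbox (- R) R \<Longrightarrow> w x = 0) \<Longrightarrow> (\<And>x. \<bar>w x\<bar> \<le> G) \<Longrightarrow>
    \<bar>mollify \<psi> (- R) R w x\<bar> \<le> T * G \<and> norm (gradient (mollify \<psi> (- R) R w) x) \<le> T * G"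
    using mollify_gradient_sup_bound[OF \<psi>, of "- R" R] by metis
  have zdiff: "(\<lambda>x. z v' x - z v x) = mollify \<psi> (- R) R (\<lambda>x. W v' x - W v x)" for v v'
    by (simp add: fun_eq_iff z_def mollify_diff[OF \<psi> contW contW])
  have zc: "\<bar>z v' x - z v x\<bar> \<le> T * dist v' v \<and> norm (gradient (z v') x - gradient (z v) x) \<le> T * dist v' v"
    if "v \<in> C" "v' \<in> C" for v v' x
  proof -
    have "\<bar>mollify \<psi> (- R) R (\<lambda>x. W v' x - W v x) x\<bar> \<le> T * dist v' v
       \<and> norm (gradient (mollify \<psi> (- R) R (\<lambda>x. W v' x - W v x)) x) \<le> T * dist v' v"
      by (rule T(2)) (use W0 that Wdist in \<open>auto intro!: continuous_on_diff contW\<close>)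
    then show ?thesis
      using fun_cong[OF zdiff[where v=v and v'=v'], of x] gradient_diff[OF zsmooth[of v'] zsmooth[of v], of x] by (simp add: zdiff)
  qed
  have zodd: "z (- v) x = - z v x" for v x
  proof -
    have "W (- v) = (\<lambda>x. - W v x)" by (simp add: fun_eq_iff Wodd)
    then show ?thesis by (simp add: z_def mollify_minus)
  qed

  \<comment> \<open>Within distance \<open>\<sigma>\<close> of a point where \<open>W\<close> has
    modulus \<open>h0\<close> it loses at most \<open>s\<close>, and mollification at most another
    \<open>s\<close>; hence \<open>A = h0 - 2 s\<close>. The bound \<open>\<sigma> <= r\<close>
    keeps this ball where \<open>m > c\<close>.\<close>
  define \<sigma> where "\<sigma> = s / L"
  have \<sigma>: "\<sigma> > 0" "\<sigma> \<le> r" using s L(1) by (simp_all add: \<sigma>_def field_simps)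
  define \<beta> where "\<beta> = unit_ball_vol ?n * \<sigma> ^ DIM('a)"
  have \<beta>: "\<beta> > 0" using \<sigma>(1) by (simp add: \<beta>_def)
  define A where "A = h0 - 2 * s"
  define D where "D = h0 - 3 * s"
  define E where "E = h0 - 7 * s"
  have ADE: "0 < E" "E < D" "D < A" using s h0 by (auto simp: A_def D_def E_def)
  have lower: "c * A powr p * \<beta> - M * E powr p * measure lebesgue \<Omega> \<le> integral\<^sup>L (lebesgue_on \<Omega>) (\<lambda>x. m x * \<bar>z v x\<bar> powr p)"
    if v: "v \<in> C" and p: "p > 0" for v p
  proof -
    obtain y where y: "y \<in> K" "b - e < \<bar>apply_bcontfun v y\<bar>" using K(3) v by (auto simp: U_def)
    have Wy: "\<bar>W v y\<bar> = h0"
    proof -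
      have "H y = h0" using y(1) h0 by (simp add: H_def)
      moreover have "h0 \<le> \<bar>soft_threshold \<theta> (apply_bcontfun v y)\<bar>"
        using soft_threshold_ge[OF \<theta>, of "apply_bcontfun v y"] y(2) by (simp add: h0_def \<theta>_def)
      ultimately show ?thesis using clamp_fun_eq[of h0] h0 by (simp add: W_def)
    qed
    have sub: "ball y \<sigma> \<subseteq> W0"
    proof -
      have "ball y \<sigma> \<subseteq> ball y r" using \<sigma>(2) by (rule subset_ball)
      then show ?thesis using r(2) y(1) by blast
    qed
    have sub\<Omega>: "ball y \<sigma> \<subseteq> \<Omega>" using sub by (auto simp: W0_def)
    \<comment> \<open>Off the ball, points with \<open>m > 0\<close> contribute nonnegatively and
      are dropped. Points with \<open>m <= 0\<close> lie outside the \<open>r\<close>-neighbourhood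
      of \<open>K\<close>, where the ceiling \<open>H\<close> keeps \<open>z v\<close> below
      \<open>E\<close>.\<close>
    have pw: "c * A powr p * indicator (ball y \<sigma>) x - M * E powr p \<le> m x * \<bar>z v x\<bar> powr p" if x: "x \<in> \<Omega>" for x
    proof (cases "x \<in> ball y \<sigma>")
      case True
      have "L * norm (y - x) \<le> s" using True L(1) by (simp add: dist_norm \<sigma>_def field_simps)
      then have "\<bar>z v x\<bar> \<ge> A"
        using WL[OF v, of y x] zclose[OF v, of x] Wy unfolding A_def by linarith
      then have "A powr p \<le> \<bar>z v x\<bar> powr p" using ADE p by (intro powr_mono2) auto
      moreover have "c \<le> m x" using sub True by (auto simp: W0_def)
      ultimately have "c * A powr p \<le> m x * \<bar>z v x\<bar> powr p" using c by (intro mult_mono) auto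
      moreover have "0 \<le> M * E powr p" using M(1) by simp
      ultimately show ?thesis using True by simp
    next
      case False
      have ME: "0 \<le> M * E powr p" using M(1) by simp
      show ?thesis
      proof (cases "m x > 0")
        case True
        then have "0 \<le> m x * \<bar>z v x\<bar> powr p" by simp
        then show ?thesis using False ME by simp
      next
        case mneg: False
        have "r \<le> infdist x K"
          unfolding infdist_notempty[OF K0]
        proof (rule cINF_greatest[OF K0], rule ccontr)
          fix w assume w: "w \<in> K" "\<not> r \<le> dist x w"
          then have "x \<in> ball w r" by (simp add: dist_commute)
          then have "x \<in> W0" using r(2) w(1) by blast
          then show False using mneg c by (simp add: W0_def)
        qed
        then have "L * r \<le> L * infdist x K" using L(1) by (intro mult_left_mono) auto
        then have "H x \<le> h0 - 8 * s" using s by (simp add: H_def)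
        then have "\<bar>z v x\<bar> \<le> E"
          using WH[of v x] zclose[OF v, of x] unfolding E_def by linarith
        then have "\<bar>z v x\<bar> powr p \<le> E powr p" using p by (intro powr_mono2) auto
        moreover have "- m x \<le> M" using M\<Omega>[OF x] by linarith
        ultimately have "(- m x) * \<bar>z v x\<bar> powr p \<le> M * E powr p"
          using mneg M(1) by (intro mult_mono) auto
        then show ?thesis using False by simp
      qed
    qed
    interpret fin: finite_measure "lebesgue_on \<Omega>" by (rule finite_measure_lebesgue_on[OF \<Omega>m])
    have intz: "integrable (lebesgue_on \<Omega>) (\<lambda>x. m x * \<bar>z v x\<bar> powr p)"
    proof (rule Bochner_Integration.integrable_bound)
      have Lp: "z v \<in> Lp_space \<Omega> p" by (rule test_function_Lp(1)[OF \<Omega>(1) p ztest[OF v]])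
      then show "integrable (lebesgue_on \<Omega>) (\<lambda>x. M * norm (z v x) powr p)" by (simp add: Lp_space_def)
      have "z v \<in> borel_measurable (lebesgue_on \<Omega>)" using Lp by (simp add: Lp_space_def)
      with m_meas show "(\<lambda>x. m x * \<bar>z v x\<bar> powr p) \<in> borel_measurable (lebesgue_on \<Omega>)" by measurable
      show "AE x in lebesgue_on \<Omega>. norm (m x * \<bar>z v x\<bar> powr p) \<le> norm (M * norm (z v x) powr p)"
      proof (rule AE_I2)
        fix x assume "x \<in> space (lebesgue_on \<Omega>)"
        then have "\<bar>m x\<bar> \<le> M" using M\<Omega> by (simp add: space_restrict_space)
        then show "norm (m x * \<bar>z v x\<bar> powr p) \<le> norm (M * norm (z v x) powr p)"
          using M(1) by (simp add: abs_mult mult_right_mono)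
      qed
    qed
    have bm: "ball y \<sigma> \<in> sets (lebesgue_on \<Omega>)"
      using sub\<Omega> \<Omega>l by (simp add: sets_restrict_space_iff)
    have inti: "integrable (lebesgue_on \<Omega>) (\<lambda>x. indicator (ball y \<sigma>) x :: real)"
      using bm by (intro integrable_real_indicator) (auto simp: fin.emeasure_finite less_top[symmetric])
    have cap: "ball y \<sigma> \<inter> \<Omega> = ball y \<sigma>" using sub\<Omega> by blast
    have ball: "measure lebesgue (ball y \<sigma>) = \<beta>"
      using content_ball[of \<sigma> y] \<sigma>(1) by (simp add: \<beta>_def measure_completion)
    have mball: "measure (lebesgue_on \<Omega>) (ball y \<sigma>) = \<beta>"
      using measure_restrict_space[of \<Omega> lebesgue "ball y \<sigma>"] \<Omega>l sub\<Omega> ball by simp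
    have "c * A powr p * \<beta> - M * E powr p * measure lebesgue \<Omega>
       = integral\<^sup>L (lebesgue_on \<Omega>) (\<lambda>x. c * A powr p * indicator (ball y \<sigma>) x - M * E powr p)"
      using inti \<Omega>l by (simp add: ball mball cap Bochner_Integration.integral_diff measure_restrict_space)
    also have "\<dots> \<le> integral\<^sup>L (lebesgue_on \<Omega>) (\<lambda>x. m x * \<bar>z v x\<bar> powr p)"
      using inti intz pw by (intro integral_mono) (auto simp: space_restrict_space)
    finally show ?thesis .
  qed

  have "L / D < B"
  proof -
    have "L / B < D" using s h0e e by (simp add: D_def)
    then show ?thesis using B0 ADE by (simp add: field_simps)
  qed
  moreover have "L / D > 0" using L(1) ADE by simp
  ultimately have "\<forall>\<^sub>F p in at_top. measure lebesgue \<Omega> * (L / D) powr p \<le> 1 * B powr p"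
    by (intro eventually_powr_le_powr) auto
  \<comment> \<open>Half of the main term \<open>c * \<beta> * A powr p\<close> absorbs the negative
    part of the integral, the other half dominates \<open>D powr p\<close>.\<close>
  moreover have "\<forall>\<^sub>F p in at_top. (M * measure lebesgue \<Omega>) * E powr p \<le> (c * \<beta> / 2) * A powr p"
    using ADE c \<beta> by (intro eventually_powr_le_powr) auto
  moreover have "\<forall>\<^sub>F p in at_top. 1 * D powr p \<le> (c * \<beta> / 2) * A powr p"
    using ADE c \<beta> by (intro eventually_powr_le_powr) auto
  moreover have "\<forall>\<^sub>F p::real in at_top. p \<ge> 1" by (rule eventually_ge_at_top)
  ultimately show ?thesis
  proof eventually_elim
    case (elim p)
    have "\<exists>A\<in>admissible_sets \<Omega> m k p. \<forall>u\<in>A. dirichlet_energy \<Omega> p u \<le> (L / D) powr p * measure lebesgue \<Omega>"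
    proof (rule family_admissible[OF \<Omega>(1) \<Omega>m elim(4) m_meas M\<Omega> C(1) C(3) C(4), where z=z and Z="h0 + s" and L=L and T=T and D=D])
      show "z v \<in> test_functions \<Omega>" if "v \<in> C" for v by (rule ztest[OF that])
      show "z (- v) x = - z v x" if "v \<in> C" for v x by (rule zodd)
      show "\<bar>z v x\<bar> \<le> h0 + s" if "v \<in> C" for v x
        using zclose[OF that, of x] WH[of v x] H(2)[of x] by linarith
      show "norm (gradient (z v) x) \<le> L" if "v \<in> C" for v x by (rule zL[OF that])
      show "\<bar>z v' x - z v x\<bar> \<le> T * dist v' v" if "v \<in> C" "v' \<in> C" for v v' x using zc[OF that] by blast
      show "norm (gradient (z v') x - gradient (z v) x) \<le> T * dist v' v" if "v \<in> C" "v' \<in> C" for v v' x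
        using zc[OF that] by blast
      show "D powr p \<le> integral\<^sup>L (lebesgue_on \<Omega>) (\<lambda>x. m x * \<bar>z v x\<bar> powr p)" if "v \<in> C" for v
      proof -
        have "c * A powr p * \<beta> = (c * \<beta> / 2) * A powr p + (c * \<beta> / 2) * A powr p" by simp
        moreover have "M * E powr p * measure lebesgue \<Omega> = (M * measure lebesgue \<Omega>) * E powr p" by simp
        ultimately show ?thesis
          using lower[OF that, of p] elim by linarith
      qed
    qed (use L(1) h0 s T ADE in auto)
    then show ?case
      using elim(1) by (force simp: mult.commute intro: order_trans)
  qed
qed

section \<open>Averages over cubes\<close>

lemma lborel_integral_affine_euclidean:
  fixes f :: "'a::euclidean_space \<Rightarrow> real"
  assumes f: "f \<in> borel_measurable borel" and c: "c > 0"
  shows "integral\<^sup>L lborel f = c ^ DIM('a) * integral\<^sup>L lborel (\<lambda>y. f (x + c *\<^sub>R y))"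
proof -
  have m: "(\<lambda>y::'a. x + c *\<^sub>R y) \<in> borel_measurable lborel" by simp
  have "integral\<^sup>L lborel f = integral\<^sup>L (density (distr lborel borel (\<lambda>y. x + c *\<^sub>R y)) (\<lambda>_. ennreal (c ^ DIM('a)))) f"
    using lborel_affine[of c x] c by (simp add: ennreal_power)
  also have "\<dots> = integral\<^sup>L (distr lborel borel (\<lambda>y. x + c *\<^sub>R y)) (\<lambda>y. c ^ DIM('a) *\<^sub>R f y)"
    by (rule integral_density) (use f c in auto)
  also have "\<dots> = integral\<^sup>L lborel (\<lambda>y. c ^ DIM('a) *\<^sub>R f (x + c *\<^sub>R y))"
    by (rule integral_distr) (use f m in auto)
  finally show ?thesis by simp
qed

abbreviation cube :: "real \<Rightarrow> 'a::euclidean_space set" where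
  "cube \<rho> \<equiv> cbox (- (\<rho> *\<^sub>R One)) (\<rho> *\<^sub>R One)"

lemma measure_cube_pos: "\<rho> > 0 \<Longrightarrow> measure lborel (cube \<rho> :: 'a::euclidean_space set) > 0"
  unfolding content_pos_lt_eq by auto

text \<open>Dilating the cube by \<open>t\<close> costs \<open>t\<close> to the power minus the
  dimension for the integral of the \<open>q\<close>-th power. The power mean inequality on the cube
  takes the \<open>q\<close>-th root of this loss.\<close>

lemma norm_gradient_average:
  fixes \<phi> :: "'a::euclidean_space \<Rightarrow> real"
  assumes \<phi>: "smooth_fun \<phi>" "compact K" "\<And>x. x \<notin> K \<Longrightarrow> gradient \<phi> x = 0"
    and q: "q \<ge> 1" and t: "t > 0" and \<rho>: "\<rho> > 0" and G: "G > 0"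
    and le: "integral\<^sup>L lborel (\<lambda>x. norm (gradient \<phi> x) powr q) \<le> G powr q"
  shows "integral (cube \<rho>) (\<lambda>y. norm (gradient \<phi> (x + t *\<^sub>R y)))
    \<le> G * (t ^ DIM('a) * measure lborel (cube \<rho> :: 'a set)) powr (- (1 / q)) * measure lborel (cube \<rho> :: 'a set)"
proof -
  let ?Q = "cube \<rho> :: 'a set"
  define V where "V = measure lborel ?Q"
  have V: "V > 0" unfolding V_def by (rule measure_cube_pos[OF \<rho>])
  define g where "g = (\<lambda>y. norm (gradient \<phi> (x + t *\<^sub>R y)))"
  have contg: "continuous_on S g" for S
    unfolding g_def
    by (intro continuous_on_norm continuous_on_compose2[OF continuous_on_gradient[OF \<phi>(1), of UNIV]] continuous_intros) auto
  have contgq: "continuous_on S (\<lambda>y. g y powr q)" for S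
    using q by (intro continuous_on_powr' contg continuous_on_const) (auto simp: g_def)
  have contG: "continuous_on UNIV (\<lambda>y. norm (gradient \<phi> y) powr q)"
    using q by (intro continuous_on_powr' continuous_on_norm continuous_on_gradient \<phi>(1) continuous_on_const) auto
  have fin: "finite_measure (lebesgue_on ?Q)" by (rule finite_measure_lebesgue_on) simp
  have mQ: "measure (lebesgue_on ?Q) (space (lebesgue_on ?Q)) = V"
    by (simp add: V_def measure_restrict_space space_restrict_space measure_completion)
  have intg: "integrable (lebesgue_on ?Q) g" by (rule continuous_imp_integrable[OF contg])
  have intgq: "integrable (lebesgue_on ?Q) (\<lambda>y. g y powr q)" by (rule continuous_imp_integrable[OF contgq])
  define K' where "K' = (\<lambda>y. (1 / t) *\<^sub>R (y - x)) ` K"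
  have K': "compact K'"
    unfolding K'_def by (intro compact_continuous_image continuous_intros \<phi>(2))
  have g0: "g y = 0" if "y \<notin> K'" for y
  proof -
    have "x + t *\<^sub>R y \<notin> K"
    proof
      assume "x + t *\<^sub>R y \<in> K"
      then have "(1 / t) *\<^sub>R ((x + t *\<^sub>R y) - x) \<in> K'" unfolding K'_def by (rule imageI)
      then show False using that t by simp
    qed
    then show ?thesis by (simp add: g_def \<phi>(3))
  qed
  have intL: "integrable lebesgue (\<lambda>y. g y powr q)"
    by (rule integrable_continuous_compact_support[OF contgq K']) (simp add: g0)
  have "integral\<^sup>L (lebesgue_on ?Q) (\<lambda>y. g y powr q) = integral\<^sup>L lebesgue (\<lambda>y. indicator ?Q y *\<^sub>R g y powr q)"
    by (rule integral_restrict_space) simp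
  also have "\<dots> \<le> integral\<^sup>L lebesgue (\<lambda>y. g y powr q)"
    using intL by (intro integral_mono integrable_mult_indicator) (auto simp: indicator_def)
  also have "\<dots> = integral\<^sup>L lborel (\<lambda>y. g y powr q)"
    using borel_measurable_continuous_onI[OF contgq] by (simp add: integral_completion)
  also have "\<dots> \<le> G powr q / t ^ DIM('a)"
    using lborel_integral_affine_euclidean[OF borel_measurable_continuous_onI[OF contG] t, of x] le t
    by (simp add: g_def field_simps)
  also have "\<dots> = (G * (t ^ DIM('a) * V) powr (- (1 / q))) powr q * V"
  proof -
    have "((t ^ DIM('a) * V) powr (- (1 / q))) powr q = 1 / (t ^ DIM('a) * V)"
    proof -
      have eq: "- (1 / q) * q = - 1" using q by simp
      show ?thesis unfolding powr_powr eq using t V by (simp add: powr_minus_divide)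
    qed
    then show ?thesis using V t G by (simp add: powr_mult)
  qed
  finally have gq: "integral\<^sup>L (lebesgue_on ?Q) (\<lambda>y. g y powr q)
      \<le> (G * (t ^ DIM('a) * V) powr (- (1 / q))) powr q * measure (lebesgue_on ?Q) (space (lebesgue_on ?Q))"
    unfolding mQ .
  have pos: "0 < G * (t ^ DIM('a) * V) powr (- (1 / q))" using G t V by simp
  have g_nonneg: "0 \<le> g y" for y by (simp add: g_def)
  have "integral\<^sup>L (lebesgue_on ?Q) g \<le> G * (t ^ DIM('a) * V) powr (- (1 / q)) * V"
    using integral_le_of_powr_integral[OF fin q pos intg g_nonneg intgq gq] unfolding mQ .
  moreover have "integral\<^sup>L (lebesgue_on ?Q) g = integral ?Q g"
    by (rule lebesgue_integral_eq_integral[OF intg]) simp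
  ultimately show ?thesis by (simp add: g_def V_def)
qed

text \<open>General \<open>p\<close> and \<open>w\<close> cover two motions of the cube:
  translation, where \<open>w\<close> is constant, and dilation about a point, where
  \<open>w y = y\<close>.\<close>

lemma integral_along_lines_derivative:
  fixes \<phi> :: "'a::euclidean_space \<Rightarrow> real" and p w :: "'a \<Rightarrow> 'a"
  assumes \<phi>: "smooth_fun \<phi>" and p: "continuous_on UNIV p" and w: "continuous_on UNIV w"
  shows "((\<lambda>t. integral (cbox a c) (\<lambda>y. \<phi> (p y + t *\<^sub>R w y))) has_vector_derivative
    integral (cbox a c) (\<lambda>y. gradient \<phi> (p y + t *\<^sub>R w y) \<bullet> w y)) (at t)"
proof -
  have "((\<lambda>t. integral (cbox a c) (\<lambda>y. \<phi> (p y + t *\<^sub>R w y))) has_vector_derivative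
    integral (cbox a c) (\<lambda>y. gradient \<phi> (p y + t *\<^sub>R w y) \<bullet> w y)) (at t within UNIV)"
  proof (rule leibniz_rule_vector_derivative)
    fix t y
    have "((\<lambda>t. \<phi> (p y + t *\<^sub>R w y)) has_derivative (\<lambda>h. gradient \<phi> (p y + t *\<^sub>R w y) \<bullet> (h *\<^sub>R w y))) (at t within UNIV)"
    proof (rule has_derivative_compose[of "\<lambda>t. p y + t *\<^sub>R w y" "\<lambda>h. h *\<^sub>R w y" t _ \<phi>, OF _ smooth_fun_has_derivative_gradient[OF \<phi>]])
      show "((\<lambda>t. p y + t *\<^sub>R w y) has_derivative (\<lambda>h. h *\<^sub>R w y)) (at t within UNIV)"
        by (auto intro!: derivative_eq_intros)
    qed
    then show "((\<lambda>t. \<phi> (p y + t *\<^sub>R w y)) has_vector_derivative gradient \<phi> (p y + t *\<^sub>R w y) \<bullet> w y) (at t within UNIV)"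
      by (simp add: has_vector_derivative_def)
  next
    show "(\<lambda>y. \<phi> (p y + t *\<^sub>R w y)) integrable_on cbox a c" for t
      by (intro integrable_continuous continuous_on_compose2[OF smooth_fun_continuous[OF \<phi>]] continuous_on_add
          continuous_on_scaleR continuous_on_const continuous_on_subset[OF p] continuous_on_subset[OF w]) auto
    show "continuous_on (UNIV \<times> cbox a c) (\<lambda>(t, y). gradient \<phi> (p y + t *\<^sub>R w y) \<bullet> w y)"
      unfolding split_beta
      by (intro continuous_on_inner continuous_on_compose2[OF continuous_on_gradient[OF \<phi>, of UNIV]]
          continuous_on_add continuous_on_scaleR continuous_on_fst continuous_on_id
          continuous_on_compose2[OF p] continuous_on_compose2[OF w] continuous_on_snd) auto
  qed auto
  then show ?thesis by simp
qed

lemma norm_integral_gradient_inner_le: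
  fixes \<phi> :: "'a::euclidean_space \<Rightarrow> real" and p w :: "'a \<Rightarrow> 'a"
  assumes \<phi>: "smooth_fun \<phi>" and p: "continuous_on UNIV p" and w: "continuous_on UNIV w"
    and B: "\<And>y. y \<in> cbox a c \<Longrightarrow> norm (w y) \<le> B"
  shows "norm (integral (cbox a c) (\<lambda>y. gradient \<phi> (p y) \<bullet> w y)) \<le> B * integral (cbox a c) (\<lambda>y. norm (gradient \<phi> (p y)))"
proof -
  have cg: "continuous_on (cbox a c) (\<lambda>y. gradient \<phi> (p y))"
    by (rule continuous_on_compose2[OF continuous_on_gradient[OF \<phi>, of UNIV] continuous_on_subset[OF p]]) auto
  have "norm (integral (cbox a c) (\<lambda>y. gradient \<phi> (p y) \<bullet> w y)) \<le> integral (cbox a c) (\<lambda>y. B * norm (gradient \<phi> (p y)))"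
  proof (rule integral_norm_bound_integral)
    show "(\<lambda>y. gradient \<phi> (p y) \<bullet> w y) integrable_on cbox a c"
      by (intro integrable_continuous continuous_on_inner cg continuous_on_subset[OF w]) auto
    show "(\<lambda>y. B * norm (gradient \<phi> (p y))) integrable_on cbox a c"
      by (intro integrable_continuous continuous_on_mult continuous_on_const continuous_on_norm cg)
    fix y assume y: "y \<in> cbox a c"
    have "norm (gradient \<phi> (p y) \<bullet> w y) \<le> norm (gradient \<phi> (p y)) * norm (w y)"
      by (simp add: Cauchy_Schwarz_ineq2)
    also have "\<dots> \<le> norm (gradient \<phi> (p y)) * B" by (intro mult_left_mono B y) simp
    finally show "norm (gradient \<phi> (p y) \<bullet> w y) \<le> B * norm (gradient \<phi> (p y))" by (simp add: mult.commute)
  qed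
  then show ?thesis by simp
qed

text \<open>Moving the cube along a segment changes the integral at a rate bounded by the mean
  gradient norm on the moving cube, hence by its \<open>q\<close>-th power mean. After division by
  the volume the constant is \<open>G\<close> times a factor that tends to 1 as \<open>q\<close>
  grows with \<open>\<rho>\<close> fixed.\<close>

lemma cube_average_lipschitz:
  fixes \<phi> :: "'a::euclidean_space \<Rightarrow> real"
  assumes \<phi>: "smooth_fun \<phi>" "compact K" "\<And>x. x \<notin> K \<Longrightarrow> gradient \<phi> x = 0"
    and q: "q \<ge> 1" and \<rho>: "\<rho> > 0" and G: "G > 0"
    and le: "integral\<^sup>L lborel (\<lambda>x. norm (gradient \<phi> x) powr q) \<le> G powr q"
  shows "\<bar>integral (cube \<rho>) (\<lambda>y. \<phi> (x + y)) - integral (cube \<rho>) (\<lambda>y. \<phi> (x' + y))\<bar>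
    \<le> G * measure lborel (cube \<rho> :: 'a set) powr (- (1 / q)) * measure lborel (cube \<rho> :: 'a set) * norm (x - x')"
proof -
  let ?Q = "cube \<rho> :: 'a set"
  let ?c = "G * measure lborel ?Q powr (- (1 / q)) * measure lborel ?Q * norm (x - x')"
  define F where "F t = integral ?Q (\<lambda>y. \<phi> ((x' + y) + t *\<^sub>R (x - x')))" for t
  have der: "(F has_vector_derivative integral ?Q (\<lambda>y. gradient \<phi> ((x' + y) + t *\<^sub>R (x - x')) \<bullet> (x - x'))) (at t)" for t
    unfolding F_def by (rule integral_along_lines_derivative[OF \<phi>(1)]) (intro continuous_intros)+
  have "norm (F 1 - F 0) \<le> ?c * 1 - ?c * 0"
  proof (rule differentiable_bound_general)
    show "continuous_on {0..1} F"
      by (intro continuous_at_imp_continuous_on ballI has_vector_derivative_continuous[OF der])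
    show "continuous_on {0..1} (\<lambda>t. ?c * t)" by (intro continuous_intros)
    show "((\<lambda>t. ?c * t) has_vector_derivative ?c) (at t)" for t :: real
      by (auto intro!: derivative_eq_intros simp: has_real_derivative_iff_has_vector_derivative[symmetric])
    fix t :: real
    have "norm (integral ?Q (\<lambda>y. gradient \<phi> ((x' + y) + t *\<^sub>R (x - x')) \<bullet> (x - x')))
        \<le> norm (x - x') * integral ?Q (\<lambda>y. norm (gradient \<phi> ((x' + y) + t *\<^sub>R (x - x'))))"
      by (rule norm_integral_gradient_inner_le[OF \<phi>(1)]) (auto intro!: continuous_intros)
    also have "\<dots> \<le> norm (x - x') * (G * (1 ^ DIM('a) * measure lborel ?Q) powr (- (1 / q)) * measure lborel ?Q)"
      using norm_gradient_average[OF \<phi> q zero_less_one \<rho> G le, of "x' + t *\<^sub>R (x - x')"]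
      by (intro mult_left_mono) (auto simp: algebra_simps)
    finally show "norm (integral ?Q (\<lambda>y. gradient \<phi> ((x' + y) + t *\<^sub>R (x - x')) \<bullet> (x - x'))) \<le> ?c"
      by (simp add: mult_ac)
  qed (use der in auto)
  then show ?thesis by (simp add: F_def add.commute)
qed

text \<open>Morrey's inequality: differentiate \<open>\<integral> \<phi> (x + t y) dy\<close> over the cube in \<open>t\<close>. By Hoelder the
  derivative is \<open>O(t powr (- n / q))\<close>, which is integrable at 0 for \<open>q > n\<close>.\<close>

lemma cube_average_close:
  fixes \<phi> :: "'a::euclidean_space \<Rightarrow> real" and q \<rho> G :: real
  assumes \<phi>: "smooth_fun \<phi>" "compact K" "\<And>x. x \<notin> K \<Longrightarrow> gradient \<phi> x = 0"
    and q: "q \<ge> 2 * real DIM('a)" and \<rho>: "\<rho> > 0" and G: "G > 0"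
    and le: "integral\<^sup>L lborel (\<lambda>x. norm (gradient \<phi> x) powr q) \<le> G powr q"
  shows "\<bar>integral (cube \<rho>) (\<lambda>y. \<phi> (x + y)) - measure lborel (cube \<rho> :: 'a set) * \<phi> x\<bar>
    \<le> 2 * (\<rho> * DIM('a) * G * measure lborel (cube \<rho> :: 'a set) powr (- (1 / q)) * measure lborel (cube \<rho> :: 'a set))"
proof -
  let ?Q = "cube \<rho> :: 'a set"
  define V where "V = measure lborel ?Q"
  have V: "V > 0" unfolding V_def by (rule measure_cube_pos[OF \<rho>])
  have n: "real DIM('a) \<ge> 1" using DIM_positive[where 'a='a] by linarith
  have q1: "q \<ge> 1" using q n by linarith
  define c where "c = \<rho> * DIM('a) * G * V powr (- (1 / q)) * V"
  have c: "c \<ge> 0" using \<rho> G V by (simp add: c_def)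
  define F where "F t = integral ?Q (\<lambda>y. \<phi> (x + t *\<^sub>R y))" for t
  have der: "(F has_vector_derivative integral ?Q (\<lambda>y. gradient \<phi> (x + t *\<^sub>R y) \<bullet> y)) (at t)" for t
    unfolding F_def by (rule integral_along_lines_derivative[OF \<phi>(1)]) (intro continuous_intros)+
  \<comment> \<open>At \<open>t = 0\<close> the integral is the volume times
    \<open>\<phi> x\<close>. Since \<open>q\<close> is at least twice the dimension, the singular
    rate is at most \<open>c * t powr (- (1 / 2))\<close> on the unit interval, whose primitive is
    \<open>2 * c * sqrt t\<close>; only interior derivatives are compared.\<close>
  have "norm (F 1 - F 0) \<le> 2 * c * sqrt 1 - 2 * c * sqrt 0"
  proof (rule differentiable_bound_general)
    show "continuous_on {0..1} F"
      by (intro continuous_at_imp_continuous_on ballI has_vector_derivative_continuous[OF der])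
    show "continuous_on {0..1} (\<lambda>t. 2 * c * sqrt t)" by (intro continuous_intros)
    show "((\<lambda>t. 2 * c * sqrt t) has_vector_derivative c * t powr (- (1 / 2))) (at t)" if "0 < t" for t :: real
      using that unfolding has_real_derivative_iff_has_vector_derivative[symmetric]
      by (auto intro!: derivative_eq_intros simp: powr_minus_divide powr_half_sqrt field_simps)
    fix t :: real assume t: "0 < t" "t < 1"
    have "norm (integral ?Q (\<lambda>y. gradient \<phi> (x + t *\<^sub>R y) \<bullet> y))
        \<le> (\<rho> * DIM('a)) * integral ?Q (\<lambda>y. norm (gradient \<phi> (x + t *\<^sub>R y)))"
      by (rule norm_integral_gradient_inner_le[OF \<phi>(1)]) (auto intro!: continuous_intros norm_le_in_cbox_One)
    also have "\<dots> \<le> (\<rho> * DIM('a)) * (G * (t ^ DIM('a) * V) powr (- (1 / q)) * V)"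
      using norm_gradient_average[OF \<phi> q1 t(1) \<rho> G le, of x] \<rho> unfolding V_def
      by (intro mult_left_mono) auto
    also have "\<dots> = c * t powr (- (DIM('a) / q))"
      using t V by (simp add: c_def powr_mult powr_powr flip: powr_realpow)
    also have "\<dots> \<le> c * t powr (- (1 / 2))"
    proof (rule mult_left_mono[OF _ c])
      have "real DIM('a) / q \<le> 1 / 2" using q q1 by (simp add: field_simps)
      then show "t powr (- (DIM('a) / q)) \<le> t powr (- (1 / 2))"
        using t by (intro powr_mono') auto
    qed
    finally show "norm (integral ?Q (\<lambda>y. gradient \<phi> (x + t *\<^sub>R y) \<bullet> y)) \<le> c * t powr (- (1 / 2))" .
  qed (use der in auto)
  then show ?thesis by (simp add: F_def c_def V_def)
qed

section \<open>Cube averages of Sobolev functions\<close>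

lemma Lp_space_integrable:
  fixes u :: "'a::euclidean_space \<Rightarrow> real"
  assumes "\<Omega> \<in> lmeasurable" "q \<ge> 1" "u \<in> Lp_space \<Omega> q"
  shows "integrable (lebesgue_on \<Omega>) u"
proof (rule Bochner_Integration.integrable_bound)
  show "integrable (lebesgue_on \<Omega>) (\<lambda>x. 1 + norm (u x) powr q)"
    using assms(3) finite_measure.integrable_const[OF finite_measure_lebesgue_on[OF assms(1)], of "1::real"]
    by (simp add: Lp_space_def)
  show "u \<in> borel_measurable (lebesgue_on \<Omega>)" using assms(3) by (simp add: Lp_space_def)
  have "norm (u x) \<le> 1 + norm (u x) powr q" for x
  proof (cases "norm (u x) \<le> 1")
    case True
    then show ?thesis by (simp add: add_increasing2)
  next
    case False
    then have "norm (u x) powr 1 \<le> norm (u x) powr q" using assms(2) by (intro powr_mono) auto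
    then show ?thesis using False by simp
  qed
  then show "AE x in lebesgue_on \<Omega>. norm (u x) \<le> norm (1 + norm (u x) powr q)"
    by (intro AE_I2) (simp add: add_nonneg_nonneg)
qed

text \<open>Minkowski's inequality for gradients alone, so that a test function close to
  \<open>u\<close> has energy close to that of \<open>u\<close> without a contribution from the size
  of \<open>u\<close>.\<close>

lemma dirichlet_energy_add:
  assumes \<Omega>: "open \<Omega>" and p: "p \<ge> 1" and u: "u \<in> sobolev_space \<Omega> p" and v: "v \<in> sobolev_space \<Omega> p"
    and ab: "a > 0" "b > 0"
    and eu: "dirichlet_energy \<Omega> p u \<le> a powr p" and ev: "dirichlet_energy \<Omega> p v \<le> b powr p"
  shows "dirichlet_energy \<Omega> p (\<lambda>x. u x + v x) \<le> (a + b) powr p"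
proof -
  note wu = sobolev_space_weak_gradient[OF \<Omega> u] and wv = sobolev_space_weak_gradient[OF \<Omega> v]
  have "dirichlet_energy \<Omega> p (\<lambda>x. u x + v x) = integral\<^sup>L (lebesgue_on \<Omega>) (\<lambda>x. norm (weak_gradient \<Omega> u x + weak_gradient \<Omega> v x) powr p)"
    using dirichlet_energy_eq[OF \<Omega> has_weak_gradient_linear[OF \<Omega> wu(1) wv(1), of 1] Lp_space_linear[OF p wu(2) wv(2), of 1]]
    by simp
  also have "\<dots> \<le> (a + b) powr p * (a / (a + b) * (dirichlet_energy \<Omega> p u / a powr p)
            + b / (a + b) * (dirichlet_energy \<Omega> p v / b powr p))"
    using integral_powr_add_le[OF p wu(2) wv(2) ab] by (simp add: dirichlet_energy_def)
  also have "\<dots> \<le> (a + b) powr p * (a / (a + b) * 1 + b / (a + b) * 1)"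
    using eu ev ab by (intro mult_left_mono add_mono) auto
  also have "\<dots> = (a + b) powr p"
    using ab by (simp flip: add_divide_distrib)
  finally show ?thesis .
qed

text \<open>Integration over \<open>\<Omega>\<close> only extends \<open>u\<close> by 0. This
  matters because elements of the function spaces are represented with arbitrary values off
  \<open>\<Omega>\<close>.\<close>

definition cube_average :: "'a::euclidean_space set \<Rightarrow> real \<Rightarrow> ('a \<Rightarrow> real) \<Rightarrow> 'a \<Rightarrow> real" where
  "cube_average \<Omega> \<rho> u x = integral\<^sup>L (lebesgue_on \<Omega>) (\<lambda>y. indicator (cube \<rho>) (y - x) * u y) / measure lborel (cube \<rho> :: 'a set)"

lemma cube_average_test_function:
  fixes \<phi> :: "'a::euclidean_space \<Rightarrow> real"
  assumes \<Omega>: "open \<Omega>" and \<phi>: "\<phi> \<in> test_functions \<Omega>"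
  shows "cube_average \<Omega> \<rho> \<phi> x = integral (cube \<rho>) (\<lambda>y. \<phi> (x + y)) / measure lborel (cube \<rho> :: 'a set)"
proof -
  obtain K where K: "smooth_fun \<phi>" "compact K" "K \<subseteq> \<Omega>" "\<And>x. x \<notin> K \<Longrightarrow> \<phi> x = 0"
      "\<And>x. x \<notin> K \<Longrightarrow> gradient \<phi> x = 0"
    by (rule test_functionsE[OF \<phi>]) (rule that)
  let ?f = "\<lambda>y. indicator (cube \<rho>) (y - x) * \<phi> y"
  have zero: "?f y = 0" if "y \<notin> \<Omega>" for y
  proof -
    have "\<phi> y = 0" using K(3) K(4)[of y] that by blast
    then show ?thesis by simp
  qed
  have "\<phi> \<in> borel_measurable borel" by (rule borel_measurable_continuous_onI[OF smooth_fun_continuous[OF K(1)]])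
  then have fm: "?f \<in> borel_measurable borel" by measurable
  have "integral\<^sup>L (lebesgue_on \<Omega>) ?f = integral\<^sup>L lebesgue ?f"
    by (rule integrable_lebesgue_on_supported(2)) (use \<Omega> zero in auto)
  also have "\<dots> = integral\<^sup>L lborel ?f" using fm by (simp add: integral_completion)
  also have "\<dots> = integral\<^sup>L lborel (\<lambda>y. ?f (x + y))" by (rule integral_translation[OF fm, symmetric])
  also have "\<dots> = integral\<^sup>L lborel (\<lambda>y. indicator (cube \<rho>) y *\<^sub>R \<phi> (x + y))" by simp
  also have "\<dots> = integral\<^sup>L lebesgue (\<lambda>y. indicator (cube \<rho>) y *\<^sub>R \<phi> (x + y))"
  proof (rule integral_completion[symmetric])
    have "(\<lambda>y. \<phi> (x + y)) \<in> borel_measurable borel"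
      by (intro borel_measurable_continuous_onI continuous_on_compose2[OF smooth_fun_continuous[OF K(1)]] continuous_intros) auto
    then show "(\<lambda>y. indicator (cube \<rho>) y *\<^sub>R \<phi> (x + y)) \<in> borel_measurable lborel" by measurable
  qed
  also have "\<dots> = integral\<^sup>L (lebesgue_on (cube \<rho>)) (\<lambda>y. \<phi> (x + y))"
    by (rule integral_restrict_space[symmetric]) simp
  also have "\<dots> = integral (cube \<rho>) (\<lambda>y. \<phi> (x + y))"
    by (intro lebesgue_integral_eq_integral continuous_imp_integrable
        continuous_on_compose2[OF smooth_fun_continuous[OF K(1)]] continuous_intros) auto
  finally show ?thesis by (simp add: cube_average_def)
qed

text \<open>The difference of averages is at most the mean distance in \<open>L^1\<close>, which the
  power mean inequality on \<open>\<Omega>\<close> bounds through the \<open>q\<close>-th powers.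
  The estimate is uniform in \<open>x\<close>, so at fixed \<open>\<rho>\<close> averaging is
  continuous into the sup norm.\<close>

lemma cube_average_diff_le:
  fixes u v :: "'a::euclidean_space \<Rightarrow> real"
  assumes \<Omega>: "\<Omega> \<in> lmeasurable" "measure lebesgue \<Omega> > 0" and q: "q \<ge> 1"
    and u: "u \<in> Lp_space \<Omega> q" and v: "v \<in> Lp_space \<Omega> q" and \<rho>: "\<rho> > 0" and \<delta>: "\<delta> > 0"
    and le: "integral\<^sup>L (lebesgue_on \<Omega>) (\<lambda>x. \<bar>u x - v x\<bar> powr q) \<le> \<delta> powr q"
  shows "\<bar>cube_average \<Omega> \<rho> u x - cube_average \<Omega> \<rho> v x\<bar>
    \<le> \<delta> * (measure lebesgue \<Omega> powr (1 - 1 / q) / measure lborel (cube \<rho> :: 'a set))"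
proof -
  let ?Q = "cube \<rho> :: 'a set"
  let ?V = "measure lborel ?Q"
  have V: "?V > 0" by (rule measure_cube_pos[OF \<rho>])
  have \<Omega>l: "\<Omega> \<in> sets lebesgue" using \<Omega>(1) by (rule fmeasurableD)
  have mO: "measure (lebesgue_on \<Omega>) (space (lebesgue_on \<Omega>)) = measure lebesgue \<Omega>"
    using \<Omega>l by (simp add: measure_restrict_space space_restrict_space)
  \<comment> \<open>Chosen so that \<open>a powr q\<close> times the measure of
    \<open>\<Omega>\<close> equals \<open>\<delta> powr q\<close>.\<close>
  define a where "a = \<delta> * measure lebesgue \<Omega> powr (- (1 / q))"
  have a: "a > 0" using \<delta> \<Omega>(2) by (simp add: a_def)
  have aq: "a powr q * measure lebesgue \<Omega> = \<delta> powr q"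
  proof -
    have eq: "- (1 / q) * q = - 1" using q by simp
    have "(measure lebesgue \<Omega> powr (- (1 / q))) powr q = 1 / measure lebesgue \<Omega>"
      unfolding powr_powr eq using \<Omega>(2) by (simp add: powr_minus_divide)
    then show ?thesis using \<Omega>(2) \<delta> by (simp add: a_def powr_mult)
  qed
  have iu: "integrable (lebesgue_on \<Omega>) u" and iv: "integrable (lebesgue_on \<Omega>) v"
    by (rule Lp_space_integrable[OF \<Omega>(1) q u], rule Lp_space_integrable[OF \<Omega>(1) q v])
  have iq: "integrable (lebesgue_on \<Omega>) (\<lambda>x. \<bar>u x - v x\<bar> powr q)"
    using Lp_space_linear[OF q u v, of "-1"] by (simp add: Lp_space_def)
  have L1: "integral\<^sup>L (lebesgue_on \<Omega>) (\<lambda>x. \<bar>u x - v x\<bar>) \<le> a * measure lebesgue \<Omega>"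
  proof -
    have le': "integral\<^sup>L (lebesgue_on \<Omega>) (\<lambda>x. \<bar>u x - v x\<bar> powr q)
        \<le> a powr q * measure (lebesgue_on \<Omega>) (space (lebesgue_on \<Omega>))"
      unfolding mO aq by (rule le)
    have "integrable (lebesgue_on \<Omega>) (\<lambda>x. \<bar>u x - v x\<bar>)" using iu iv by simp
    from integral_le_of_powr_integral[OF finite_measure_lebesgue_on[OF \<Omega>(1)] q a this abs_ge_zero iq le']
    show ?thesis unfolding mO .
  qed
  have mi: "(\<lambda>y. indicator ?Q (y - x) :: real) \<in> borel_measurable (lebesgue_on \<Omega>)"
  proof -
    have "(\<lambda>y. indicator ?Q (y - x) :: real) \<in> borel_measurable lborel" by measurable
    then have "(\<lambda>y. indicator ?Q (y - x) :: real) \<in> borel_measurable lebesgue" by (rule measurable_completion)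
    then show ?thesis by (rule measurable_restrict_space1)
  qed
  have ii: "integrable (lebesgue_on \<Omega>) (\<lambda>y. indicator ?Q (y - x) * w y)" if "integrable (lebesgue_on \<Omega>) w" for w :: "'a \<Rightarrow> real"
  proof (rule Bochner_Integration.integrable_bound[OF that])
    show "(\<lambda>y. indicator ?Q (y - x) * w y) \<in> borel_measurable (lebesgue_on \<Omega>)"
      by (rule borel_measurable_times[OF mi borel_measurable_integrable[OF that]])
  qed (auto simp: indicator_def)
  define w where "w y = indicator ?Q (y - x) * u y - indicator ?Q (y - x) * v y" for y
  have iw: "integrable (lebesgue_on \<Omega>) w"
    unfolding w_def by (rule Bochner_Integration.integrable_diff[OF ii[OF iu] ii[OF iv]])
  have "cube_average \<Omega> \<rho> u x - cube_average \<Omega> \<rho> v x = integral\<^sup>L (lebesgue_on \<Omega>) w / ?V"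
    unfolding cube_average_def w_def
    by (simp only: Bochner_Integration.integral_diff[OF ii[OF iu] ii[OF iv]] diff_divide_distrib)
  then have "\<bar>cube_average \<Omega> \<rho> u x - cube_average \<Omega> \<rho> v x\<bar> = \<bar>integral\<^sup>L (lebesgue_on \<Omega>) w\<bar> / ?V"
    using V by (simp only: abs_divide abs_of_pos)
  also have "\<dots> \<le> (a * measure lebesgue \<Omega>) / ?V"
  proof (rule divide_right_mono[OF _ less_imp_le[OF V]])
    have "\<bar>integral\<^sup>L (lebesgue_on \<Omega>) w\<bar> \<le> integral\<^sup>L (lebesgue_on \<Omega>) (\<lambda>y. \<bar>w y\<bar>)"
      by (rule integral_abs_bound)
    also have "\<dots> \<le> integral\<^sup>L (lebesgue_on \<Omega>) (\<lambda>y. \<bar>u y - v y\<bar>)"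
    proof (rule integral_mono)
      show "integrable (lebesgue_on \<Omega>) (\<lambda>y. \<bar>w y\<bar>)" using iw by simp
      show "integrable (lebesgue_on \<Omega>) (\<lambda>y. \<bar>u y - v y\<bar>)" using iu iv by simp
      show "\<bar>w y\<bar> \<le> \<bar>u y - v y\<bar>" for y by (cases "y - x \<in> ?Q") (simp_all add: w_def)
    qed
    also note L1
    finally show "\<bar>integral\<^sup>L (lebesgue_on \<Omega>) w\<bar> \<le> a * measure lebesgue \<Omega>" .
  qed
  also have "a * measure lebesgue \<Omega> = \<delta> * measure lebesgue \<Omega> powr (1 - 1 / q)"
    using \<Omega>(2) by (simp add: a_def powr_diff powr_minus_divide)
  finally show ?thesis by (simp only: times_divide_eq_right)
qed

lemma powr_inverse_tendsto_1:
  "V > 0 \<Longrightarrow> ((\<lambda>q::real. V powr (- (1 / q))) \<longlongrightarrow> 1) at_top"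
proof -
  assume V: "V > 0"
  have "((\<lambda>q::real. V powr (- (1 / q))) \<longlongrightarrow> V powr (- 0)) at_top"
    using V by (intro tendsto_powr tendsto_const tendsto_minus tendsto_divide_0[OF tendsto_const])
      (auto simp: filterlim_at_top_imp_at_infinity filterlim_ident)
  then show ?thesis using V by simp
qed

text \<open>Averaging is odd and continuous from the Sobolev topology to the sup norm, so
  compactness, symmetry and the lower bound on the genus pass to the image. The image is nonempty
  because the empty set has genus 0.\<close>

lemma admissible_average_compact:
  fixes \<Omega> :: "'a::euclidean_space set"
  assumes \<Omega>: "open \<Omega>" "\<Omega> \<in> lmeasurable" "measure lebesgue \<Omega> > 0" and k: "k \<ge> 1"
    and q: "q \<ge> 1" and \<rho>: "\<rho> > 0" and A: "A \<in> admissible_sets \<Omega> m k q"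
    and cont: "\<forall>u\<in>A. continuous_on UNIV (cube_average \<Omega> \<rho> u)"
  defines "C \<equiv> (\<lambda>u. Bcontfun (cube_average \<Omega> \<rho> u)) ` A"
  shows "compact C" "C \<noteq> {}" "\<And>v. v \<in> C \<Longrightarrow> - v \<in> C" "enat k \<le> genus euclidean C"
    "\<And>u. u \<in> A \<Longrightarrow> apply_bcontfun (Bcontfun (cube_average \<Omega> \<rho> u)) = cube_average \<Omega> \<rho> u"
proof -
  have q0: "q > 0" using q by simp
  define V where "V = (\<lambda>u. Bcontfun (cube_average \<Omega> \<rho> u))"
  define T0 where "T0 = subtopology (sobolev_topology \<Omega> q) (sobolev_space0 \<Omega> q)"
  have A0: "A \<subseteq> sobolev_space0 \<Omega> q" "symmetric_set A" "compactin T0 A" "enat k \<le> genus T0 A"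
    using A by (auto simp: admissible_sets_def constraint_set_def T0_def)
  have AS: "A \<subseteq> sobolev_space \<Omega> q" using A0(1) sobolev_space0_subset[OF \<Omega>(1) q0] by blast
  have ALp: "u \<in> Lp_space \<Omega> q" if "u \<in> A" for u
    using AS that by (auto simp: sobolev_space_def)
  have subT: "subtopology T0 A = subtopology (sobolev_topology \<Omega> q) A"
    unfolding T0_def subtopology_subtopology using A0(1) by (simp add: Int_absorb1)
  define \<kappa> where "\<kappa> = measure lebesgue \<Omega> powr (1 - 1 / q) / measure lborel (cube \<rho> :: 'a set)"
  have \<kappa>: "\<kappa> > 0" unfolding \<kappa>_def using \<Omega>(3) measure_cube_pos[OF \<rho>, where 'a='a]
    by (intro divide_pos_pos) simp_all
  have zero: "cube_average \<Omega> \<rho> (\<lambda>x. 0) x = 0" for x by (simp add: cube_average_def)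
  have Lp0: "(\<lambda>x. 0) \<in> Lp_space \<Omega> q" by (simp add: Lp_space_def)
  have bcf: "cube_average \<Omega> \<rho> u \<in> bcontfun" if u: "u \<in> A" for u
  proof (rule bcontfun_normI[OF cont[rule_format, OF u]])
    define \<delta> where "\<delta> = sobolev_norm \<Omega> q u + 1"
    have \<delta>: "\<delta> > 0" using sobolev_norm_nonneg[of \<Omega> q u] by (simp add: \<delta>_def)
    show "norm (cube_average \<Omega> \<rho> u x) \<le> \<delta> * \<kappa>" for x
      using cube_average_diff_le[OF \<Omega>(2,3) q ALp[OF u] Lp0 \<rho> \<delta>, of x]
        Lp_norm_le_sobolev_norm[OF q0, of \<Omega> u \<delta>]
      by (simp add: zero \<kappa>_def \<delta>_def)
  qed
  then show app: "apply_bcontfun (Bcontfun (cube_average \<Omega> \<rho> u)) = cube_average \<Omega> \<rho> u" if "u \<in> A" for u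
    using that by (simp add: Bcontfun_inverse)
  have contV: "continuous_map (subtopology (sobolev_topology \<Omega> q) A) euclidean V"
  proof (rule continuous_map_from_sobolev[OF \<Omega>(1) q0 AS])
    fix u and e :: real assume u: "u \<in> A" and e: "e > 0"
    define \<delta> where "\<delta> = e / (2 * \<kappa>)"
    have \<delta>: "\<delta> > 0" using e \<kappa> by (simp add: \<delta>_def)
    have "dist (V v) (V u) < e" if v: "v \<in> A" and lt: "sobolev_norm \<Omega> q (v - u) < \<delta>" for v
    proof -
      have "dist (V v) (V u) \<le> \<delta> * \<kappa>"
      proof (rule dist_bound)
        fix x
        have "integral\<^sup>L (lebesgue_on \<Omega>) (\<lambda>x. \<bar>v x - u x\<bar> powr q) \<le> \<delta> powr q"
          using Lp_norm_le_sobolev_norm[OF q0 less_imp_le[OF lt]] by simp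
        from cube_average_diff_le[OF \<Omega>(2,3) q ALp[OF v] ALp[OF u] \<rho> \<delta> this, of x]
        show "dist (apply_bcontfun (V v) x) (apply_bcontfun (V u) x) \<le> \<delta> * \<kappa>"
          by (simp add: V_def app[OF u] app[OF v] dist_real_def \<kappa>_def)
      qed
      also have "\<dots> < e" using e \<kappa> by (simp add: \<delta>_def)
      finally show ?thesis .
    qed
    then show "\<exists>r>0. \<forall>v\<in>A. sobolev_norm \<Omega> q (v - u) < r \<longrightarrow> dist (V v) (V u) < e"
      using \<delta> by blast
  qed
  have CV: "C = V ` A" by (simp add: C_def V_def)
  have "compactin (subtopology (sobolev_topology \<Omega> q) A) A"
    using A0(3) by (simp add: T0_def compactin_subtopology)
  then have "compactin euclidean (V ` A)"
    by (rule image_compactin[OF _ contV])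
  then show "compact C" by (simp add: CV)
  have odd: "V (- u) = - V u" if u: "u \<in> A" for u
  proof (rule bcontfun_eqI)
    fix x
    have mu: "- u \<in> A" using A0(2) u by (simp add: symmetric_set_def)
    show "apply_bcontfun (V (- u)) x = apply_bcontfun (- V u) x"
      unfolding V_def by (simp add: app[OF u] app[OF mu] cube_average_def)
  qed
  show "- v \<in> C" if "v \<in> C" for v
  proof -
    obtain u where u: "u \<in> A" "v = V u" using \<open>v \<in> C\<close> unfolding CV by blast
    then have "- v = V (- u)" by (simp add: odd)
    moreover have "- u \<in> A" using A0(2) u(1) by (simp add: symmetric_set_def)
    ultimately show ?thesis unfolding CV by blast
  qed
  show gen: "enat k \<le> genus euclidean C"
    unfolding CV using A0(4) genus_le_image[of T0 A euclidean V] contV odd unfolding subT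
    by (meson order_trans)
  show "C \<noteq> {}"
  proof
    assume C0: "C = {}"
    have "genus euclidean ({} :: ('a \<Rightarrow>\<^sub>C real) set) \<le> enat 0"
      unfolding genus_def
      by (intro Inf_lower CollectI exI[of _ 0] conjI exI[of _ "\<lambda>_ _. 0"])
         (auto simp: continuous_map_def)
    then have "enat k \<le> enat 0" using gen C0 order_trans by blast
    then show False using k by simp
  qed
qed

text \<open>Only \<open>{m > 0}\<close> contributes positively to the constraint integral, so \<open>\<phi>\<close> cannot be below
  \<open>\<alpha>\<close> on all of it.\<close>

lemma test_function_large_on_positivity_set:
  fixes u \<phi> :: "'a::euclidean_space \<Rightarrow> real"
  assumes \<Omega>: "open \<Omega>" "\<Omega> \<in> lmeasurable" and q: "q \<ge> 1"
    and m: "m \<in> borel_measurable (lebesgue_on \<Omega>)" "\<And>x. x \<in> \<Omega> \<Longrightarrow> \<bar>m x\<bar> \<le> M"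
    and u: "u \<in> Lp_space \<Omega> q" "integral\<^sup>L (lebesgue_on \<Omega>) (\<lambda>x. m x * \<bar>u x\<bar> powr q) = 1"
    and \<phi>: "\<phi> \<in> Lp_space \<Omega> q" and ab: "\<alpha> > 0" "\<beta> > 0"
    and le: "integral\<^sup>L (lebesgue_on \<Omega>) (\<lambda>x. \<bar>u x - \<phi> x\<bar> powr q) \<le> \<beta> powr q"
    and small: "(\<alpha> + \<beta>) powr q * (M * (measure lebesgue \<Omega> + 1)) < 1"
  shows "\<exists>y\<in>\<Omega>. m y > 0 \<and> \<bar>\<phi> y\<bar> \<ge> \<alpha>"
proof (rule ccontr)
  assume neg: "\<not> ?thesis"
  have \<Omega>l: "\<Omega> \<in> sets lebesgue" using \<Omega>(2) by (rule fmeasurableD)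
  interpret fin: finite_measure "lebesgue_on \<Omega>" by (rule finite_measure_lebesgue_on[OF \<Omega>(2)])
  have M0: "M \<ge> 0"
  proof (rule ccontr)
    assume "\<not> M \<ge> 0"
    then have "\<Omega> = {}" using m(2) by force
    then show False using u(2) by simp
  qed
  have iq: "integrable (lebesgue_on \<Omega>) (\<lambda>x. \<bar>u x - \<phi> x\<bar> powr q)"
    using Lp_space_linear[OF q u(1) \<phi>, of "-1"] by (simp add: Lp_space_def)
  \<comment> \<open>A non-integrable function has integral 0 by convention, whereas this integral is
    1.\<close>
  have int1: "integrable (lebesgue_on \<Omega>) (\<lambda>x. m x * \<bar>u x\<bar> powr q)"
    using u(2) not_integrable_integral_eq by fastforce
  \<comment> \<open>A pointwise majorant of the constraint integrand under the assumption that
    \<open>\<phi>\<close> stays below \<open>\<alpha>\<close> on the positivity set: convexity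
    splits \<open>u\<close> into \<open>\<phi>\<close>, of size \<open>\<alpha>\<close>, and the
    remainder, measured in units of \<open>\<beta>\<close>.\<close>
  define g where "g = (\<lambda>x. (\<alpha> + \<beta>) powr q * M * (1 + \<bar>u x - \<phi> x\<bar> powr q / \<beta> powr q))"
  have intg: "integrable (lebesgue_on \<Omega>) g"
    unfolding g_def using iq by (intro integrable_mult_right Bochner_Integration.integrable_add) auto
  have pw: "m x * \<bar>u x\<bar> powr q \<le> g x" if x: "x \<in> \<Omega>" for x
  proof (cases "m x > 0")
    case True
    then have small\<phi>: "\<bar>\<phi> x\<bar> \<le> \<alpha>" using neg x by force
    have "\<bar>u x\<bar> powr q \<le> (\<bar>\<phi> x\<bar> + \<bar>u x - \<phi> x\<bar>) powr q"
      using q by (intro powr_mono2) auto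
    also have "\<dots> \<le> (\<alpha> + \<beta>) powr q * (\<alpha> / (\<alpha> + \<beta>) * (\<bar>\<phi> x\<bar> powr q / \<alpha> powr q) + \<beta> / (\<alpha> + \<beta>) * (\<bar>u x - \<phi> x\<bar> powr q / \<beta> powr q))"
      by (rule powr_add_le_weighted[OF q ab]) auto
    also have "\<dots> \<le> (\<alpha> + \<beta>) powr q * (1 * 1 + 1 * (\<bar>u x - \<phi> x\<bar> powr q / \<beta> powr q))"
    proof (intro mult_left_mono add_mono mult_mono)
      have "\<bar>\<phi> x\<bar> powr q \<le> \<alpha> powr q" using small\<phi> q by (intro powr_mono2) auto
      then show "\<bar>\<phi> x\<bar> powr q / \<alpha> powr q \<le> 1" using ab(1) by simp
    qed (use ab in auto)
    finally have "\<bar>u x\<bar> powr q \<le> (\<alpha> + \<beta>) powr q * (1 + \<bar>u x - \<phi> x\<bar> powr q / \<beta> powr q)" by simp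
    moreover have "m x \<le> M" using m(2)[OF x] by linarith
    ultimately have "m x * \<bar>u x\<bar> powr q \<le> M * ((\<alpha> + \<beta>) powr q * (1 + \<bar>u x - \<phi> x\<bar> powr q / \<beta> powr q))"
      using True M0 by (intro mult_mono) auto
    then show ?thesis by (simp add: g_def mult_ac)
  next
    case False
    then have "m x * \<bar>u x\<bar> powr q \<le> 0" by (intro mult_nonpos_nonneg) auto
    also have "0 \<le> g x" unfolding g_def using M0 ab by (intro mult_nonneg_nonneg add_nonneg_nonneg) auto
    finally show ?thesis .
  qed
  have "1 \<le> integral\<^sup>L (lebesgue_on \<Omega>) g"
    unfolding u(2)[symmetric] using int1 intg pw by (intro integral_mono) (auto simp: space_restrict_space)
  also have "\<dots> = (\<alpha> + \<beta>) powr q * M * (measure lebesgue \<Omega> + integral\<^sup>L (lebesgue_on \<Omega>) (\<lambda>x. \<bar>u x - \<phi> x\<bar> powr q) / \<beta> powr q)"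
  proof -
    have "integral\<^sup>L (lebesgue_on \<Omega>) (\<lambda>x. 1 + \<bar>u x - \<phi> x\<bar> powr q / \<beta> powr q)
      = integral\<^sup>L (lebesgue_on \<Omega>) (\<lambda>x. 1) + integral\<^sup>L (lebesgue_on \<Omega>) (\<lambda>x. \<bar>u x - \<phi> x\<bar> powr q / \<beta> powr q)"
      by (rule Bochner_Integration.integral_add) (use iq in auto)
    moreover have "integral\<^sup>L (lebesgue_on \<Omega>) (\<lambda>x. 1 :: real) = measure lebesgue \<Omega>"
      using \<Omega>l by (simp add: measure_restrict_space space_restrict_space)
    moreover have "integral\<^sup>L (lebesgue_on \<Omega>) g
        = (\<alpha> + \<beta>) powr q * M * integral\<^sup>L (lebesgue_on \<Omega>) (\<lambda>x. 1 + \<bar>u x - \<phi> x\<bar> powr q / \<beta> powr q)"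
      unfolding g_def by (rule integral_mult_right_zero)
    ultimately show ?thesis by (simp only: integral_divide_zero)
  qed
  also have "\<dots> \<le> (\<alpha> + \<beta>) powr q * M * (measure lebesgue \<Omega> + 1)"
    using le ab M0 by (intro mult_left_mono add_left_mono) (auto simp: divide_le_eq_1)
  finally show False using small by (simp add: mult.assoc)
qed

lemma integral_norm_gradient_eq:
  assumes \<Omega>: "open \<Omega>" and q: "q > 0" and \<phi>: "\<phi> \<in> test_functions \<Omega>"
  shows "integral\<^sup>L lborel (\<lambda>x. norm (gradient \<phi> x) powr q) = dirichlet_energy \<Omega> q \<phi>"
proof -
  obtain K where K: "smooth_fun \<phi>" "compact K" "K \<subseteq> \<Omega>" "\<And>x. x \<notin> K \<Longrightarrow> \<phi> x = 0"
      "\<And>x. x \<notin> K \<Longrightarrow> gradient \<phi> x = 0"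
    by (rule test_functionsE[OF \<phi>]) (rule that)
  have "continuous_on UNIV (\<lambda>y. norm (gradient \<phi> y) powr q)"
    using q by (intro continuous_on_powr' continuous_on_norm continuous_on_gradient K(1) continuous_on_const) auto
  then have meas: "(\<lambda>y. norm (gradient \<phi> y) powr q) \<in> borel_measurable lborel"
    using borel_measurable_continuous_onI by (simp only: measurable_lborel2)
  have "dirichlet_energy \<Omega> q \<phi> = integral\<^sup>L lebesgue (\<lambda>x. norm (gradient \<phi> x) powr q)"
    unfolding dirichlet_energy_test_function[OF \<Omega> q \<phi>]
  proof (rule integrable_lebesgue_on_supported(2))
    show "\<Omega> \<in> sets lebesgue" using \<Omega> by auto
    show "norm (gradient \<phi> x) powr q = 0" if "x \<notin> \<Omega>" for x
    proof -
      have "gradient \<phi> x = 0" using K(3) K(5)[of x] that by blast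
      then show ?thesis by simp
    qed
  qed
  also have "\<dots> = integral\<^sup>L lborel (\<lambda>x. norm (gradient \<phi> x) powr q)"
    by (rule integral_completion[OF meas])
  finally show ?thesis by simp
qed

text \<open>The order of the choices matters. The relative error \<open>\<mu>\<close> and the side
  length \<open>\<rho>\<close> depend only on \<open>G\<close> and \<open>e\<close>; then
  \<open>q\<close> is taken so large that the volume of that cube has \<open>q\<close>-th root close
  to 1. Only test functions are estimated directly, and each \<open>u\<close> inherits the bounds
  from test functions approximating it.\<close>

lemma admissible_limit_step:
  fixes \<Omega> :: "'a::euclidean_space set" and G e :: real
  assumes \<Omega>: "open \<Omega>" "bounded \<Omega>" "\<Omega> \<noteq> {}" and m: "continuous_on (closure \<Omega>) m"
    and k: "k \<ge> 1" and G: "G > 0" and e: "e > 0"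
  shows "\<forall>\<^sub>F q in at_top. \<forall>A\<in>admissible_sets \<Omega> m k q. (\<forall>u\<in>A. dirichlet_energy \<Omega> q u \<le> G powr q) \<longrightarrow>
    (\<forall>\<^sub>F p in at_top. \<exists>A'\<in>admissible_sets \<Omega> m k p. \<forall>u\<in>A'. dirichlet_energy \<Omega> p u \<le> (G + e) powr p)"
proof -
  let ?n = "real DIM('a)"
  have n: "?n > 0" by simp
  have \<Omega>m: "\<Omega> \<in> lmeasurable" using \<Omega> by (simp add: lmeasurable_open)
  have \<Omega>l: "\<Omega> \<in> sets lebesgue" using \<Omega>m by (rule fmeasurableD)
  have \<Omega>pos: "measure lebesgue \<Omega> > 0"
    using open_not_negligible[OF \<Omega>(1,3)] negligible_iff_measure0[OF \<Omega>m]
    by (simp add: order_less_le)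
  have compm: "compact (m ` closure \<Omega>)"
    using compact_continuous_image[OF m] \<Omega>(2) by (simp add: compact_closure)
  obtain M where M: "M > 0" "\<And>x. x \<in> closure \<Omega> \<Longrightarrow> \<bar>m x\<bar> \<le> M"
    using compact_imp_bounded[OF compm] unfolding bounded_pos by auto
  have M\<Omega>: "\<bar>m x\<bar> \<le> M" if "x \<in> \<Omega>" for x
    using M(2) closure_subset that by blast
  have m_meas: "m \<in> borel_measurable (lebesgue_on \<Omega>)"
    by (rule continuous_imp_measurable_on_sets_lebesgue[OF continuous_on_subset[OF m closure_subset] \<Omega>l])
  \<comment> \<open>With this value \<open>\<mu> * (G + e) = e / 16\<close>, so the five losses of
    relative size \<open>\<mu>\<close>, the extra \<open>e / 4\<close> in \<open>G1\<close> and the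
    factor \<open>1 + \<mu>\<close> together fit below \<open>e\<close>.\<close>
  define \<mu> where "\<mu> = e / (16 * (G + e))"
  have \<mu>G: "\<mu> * (G + e) = e / 16"
  proof -
    have "(e / (16 * s)) * s = e / 16" if "s > 0" for s :: real using that by simp
    then show ?thesis unfolding \<mu>_def using G e by (simp only: add_pos_pos)
  qed
  have \<mu>: "0 < \<mu>" "\<mu> \<le> 1 / 16" using G e by (simp_all add: \<mu>_def field_simps)
  define G1 where "G1 = G + e / 4"
  have G1: "G1 > 0" using G e by (simp add: G1_def)
  define L where "L = G1 * (1 + \<mu>)"
  have L: "L > 0" using G1 \<mu> by (simp add: L_def)
  \<comment> \<open>\<open>1 - 3 * \<mu>\<close> will be the value reached where
    \<open>m > 0\<close>: one \<open>\<mu>\<close> is lost for the test function, one for averaging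
    it, one for passing to the average of \<open>u\<close>. Off \<open>\<Omega>\<close> the test
    function is 0 and the last two losses give \<open>2 * \<mu>\<close>.\<close>
  have Lb: "L / ((1 - 3 * \<mu>) - 2 * \<mu>) < G + e"
  proof -
    have "\<mu> * G \<le> \<mu> * (G + e)" "\<mu> * e \<le> \<mu> * (G + e)"
      using \<mu>(1) G e by (intro mult_left_mono; simp)+
    moreover have "L = G + e / 4 + \<mu> * G + \<mu> * e / 4" by (simp add: L_def G1_def algebra_simps)
    moreover have "(G + e) * ((1 - 3 * \<mu>) - 2 * \<mu>) = G + e - 5 * (\<mu> * (G + e))" by (simp add: algebra_simps)
    ultimately have "L < (G + e) * ((1 - 3 * \<mu>) - 2 * \<mu>)" using \<mu>G e by linarith
    then show ?thesis using \<mu> by (simp add: pos_divide_less_eq)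
  qed
  \<comment> \<open>Makes the Morrey bound \<open>2 * \<rho> * n * L\<close> on the difference
    between a function and its averages equal to \<open>\<mu>\<close>.\<close>
  define \<rho> where "\<rho> = \<mu> / (2 * ?n * L)"
  have \<rho>: "\<rho> > 0" using \<mu> n L by (simp add: \<rho>_def)
  have \<rho>L: "2 * (\<rho> * ?n * L) = \<mu>" using n L by (simp add: \<rho>_def)
  define V where "V = measure lborel (cube \<rho> :: 'a set)"
  have V: "V > 0" unfolding V_def by (rule measure_cube_pos[OF \<rho>])
  have ev1: "\<forall>\<^sub>F q in at_top. V powr (- (1 / q)) < 1 + \<mu>"
    by (rule order_tendstoD(2)[OF powr_inverse_tendsto_1[OF V]]) (use \<mu> in simp)
  \<comment> \<open>For such \<open>q\<close> a test function within \<open>\<mu> / 2\<close> of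
    \<open>u\<close> cannot stay below \<open>1 - \<mu>\<close> on all of the positivity set; the
    base \<open>1 - \<mu> / 2\<close> is the sum of these two numbers.\<close>
  have ev2: "\<forall>\<^sub>F q in at_top. (M * (measure lebesgue \<Omega> + 1)) * (1 - \<mu> / 2) powr q \<le> 1 / 2 * 1 powr q"
    by (rule eventually_powr_le_powr) (use \<mu> in auto)
  have ev3: "\<forall>\<^sub>F q in at_top. q \<ge> max 1 (2 * ?n)" by (rule eventually_ge_at_top)
  show ?thesis
    using ev1 ev2 ev3
  proof eventually_elim
    case (elim q)
    have q: "q \<ge> 1" "q > 0" "q \<ge> 2 * ?n" using elim(3) by auto
    show ?case
    proof (intro ballI impI)
      fix A assume A: "A \<in> admissible_sets \<Omega> m k q" and AG: "\<forall>u\<in>A. dirichlet_energy \<Omega> q u \<le> G powr q"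
      define \<kappa> where "\<kappa> = measure lebesgue \<Omega> powr (1 - 1 / q) / V"
      have \<kappa>: "\<kappa> > 0" unfolding \<kappa>_def using \<Omega>pos V by (intro divide_pos_pos) simp_all
      have approx: "\<exists>\<phi>\<in>test_functions \<Omega>.
          integral\<^sup>L lborel (\<lambda>x. norm (gradient \<phi> x) powr q) \<le> G1 powr q \<and>
          (\<exists>y\<in>\<Omega>. m y > 0 \<and> \<bar>\<phi> y\<bar> \<ge> 1 - \<mu>) \<and>
          (\<forall>x. \<bar>cube_average \<Omega> \<rho> u x - cube_average \<Omega> \<rho> \<phi> x\<bar> \<le> \<epsilon>)"
        if u: "u \<in> A" and \<epsilon>: "\<epsilon> > 0" for u \<epsilon>
      proof -
        have u0: "u \<in> sobolev_space0 \<Omega> q" and uint: "integral\<^sup>L (lebesgue_on \<Omega>) (\<lambda>x. m x * \<bar>u x\<bar> powr q) = 1"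
          using A u by (auto simp: admissible_sets_def constraint_set_def)
        have us: "u \<in> sobolev_space \<Omega> q" using u0 sobolev_space0_subset[OF \<Omega>(1) q(2)] by blast
        have uL: "u \<in> Lp_space \<Omega> q" using us by (simp add: sobolev_space_def)
        \<comment> \<open>The three bounds keep the energy of the test function below
          \<open>G1 powr q\<close>, serve the lower bound on the positivity set, and make the
          averages \<open>\<epsilon>\<close>-close.\<close>
        define \<delta> where "\<delta> = min (min (e / 4) (\<mu> / 2)) (\<epsilon> / \<kappa>)"
        have \<delta>: "\<delta> > 0" "\<delta> \<le> e / 4" "\<delta> \<le> \<mu> / 2" "\<delta> * \<kappa> \<le> \<epsilon>"
        proof -
          show "\<delta> > 0" using e \<mu>(1) \<epsilon> \<kappa> by (simp add: \<delta>_def)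
          show "\<delta> \<le> e / 4" "\<delta> \<le> \<mu> / 2" unfolding \<delta>_def by linarith+
          have "\<delta> \<le> \<epsilon> / \<kappa>" by (simp add: \<delta>_def)
          then show "\<delta> * \<kappa> \<le> \<epsilon>" using \<kappa> by (simp add: pos_le_divide_eq)
        qed
        obtain \<phi> where \<phi>: "\<phi> \<in> test_functions \<Omega>" "sobolev_norm \<Omega> q (\<phi> - u) < \<delta>"
          using sobolev_space0_approx[OF \<Omega>(1) q(2) u0 \<delta>(1)] by blast
        have \<phi>s: "\<phi> \<in> sobolev_space \<Omega> q"
          using \<phi>(1) test_functions_subset_sobolev_space[OF \<Omega>(1) q(2)] by blast
        have \<phi>L: "\<phi> \<in> Lp_space \<Omega> q" by (rule test_function_Lp(1)[OF \<Omega>(1) q(2) \<phi>(1)])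
        have diff: "integral\<^sup>L (lebesgue_on \<Omega>) (\<lambda>x. \<bar>u x - \<phi> x\<bar> powr q) \<le> \<delta> powr q"
          using Lp_norm_le_sobolev_norm[OF q(2) less_imp_le[OF \<phi>(2)]] by (simp add: abs_minus_commute)
        have "dirichlet_energy \<Omega> q (\<phi> - u) \<le> (e / 4) powr q"
          using dirichlet_energy_le_norm[OF q(2), of \<Omega> "\<phi> - u" "e / 4"] \<phi>(2) \<delta>(2) by simp
        then have "dirichlet_energy \<Omega> q (\<lambda>x. u x + (\<phi> - u) x) \<le> (G + e / 4) powr q"
          using AG u G e
          by (intro dirichlet_energy_add[OF \<Omega>(1) q(1) us sobolev_space_diff[OF \<Omega>(1) q(1) \<phi>s us]]) auto
        moreover have "(\<lambda>x. u x + (\<phi> - u) x) = \<phi>" by (simp add: fun_eq_iff)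
        ultimately have "integral\<^sup>L lborel (\<lambda>x. norm (gradient \<phi> x) powr q) \<le> G1 powr q"
          unfolding integral_norm_gradient_eq[OF \<Omega>(1) q(2) \<phi>(1)] by (simp add: G1_def)
        moreover have "\<exists>y\<in>\<Omega>. m y > 0 \<and> \<bar>\<phi> y\<bar> \<ge> 1 - \<mu>"
        proof (rule test_function_large_on_positivity_set[OF \<Omega>(1) \<Omega>m q(1) m_meas M\<Omega> uL uint \<phi>L])
          show "1 - \<mu> > 0" "\<mu> / 2 > 0" using \<mu> by auto
          have "\<delta> powr q \<le> (\<mu> / 2) powr q" using \<delta> q by (intro powr_mono2) auto
          then show "integral\<^sup>L (lebesgue_on \<Omega>) (\<lambda>x. \<bar>u x - \<phi> x\<bar> powr q) \<le> (\<mu> / 2) powr q"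
            using diff by linarith
          have "1 - \<mu> + \<mu> / 2 = 1 - \<mu> / 2" by simp
          then show "(1 - \<mu> + \<mu> / 2) powr q * (M * (measure lebesgue \<Omega> + 1)) < 1"
            using elim(2) by (simp add: mult.commute)
        qed
        moreover have "\<bar>cube_average \<Omega> \<rho> u x - cube_average \<Omega> \<rho> \<phi> x\<bar> \<le> \<epsilon>" for x
          using cube_average_diff_le[OF \<Omega>m \<Omega>pos q(1) uL \<phi>L \<rho> \<delta>(1) diff, of x] \<delta>(4)
          unfolding \<kappa>_def V_def by linarith
        ultimately show ?thesis using \<phi>(1) by blast
      qed
      have avg: "\<bar>cube_average \<Omega> \<rho> \<phi> x - \<phi> x\<bar> \<le> \<mu>"
        "\<bar>cube_average \<Omega> \<rho> \<phi> x - cube_average \<Omega> \<rho> \<phi> x'\<bar> \<le> L * norm (x - x')"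
        if \<phi>: "\<phi> \<in> test_functions \<Omega>" and le: "integral\<^sup>L lborel (\<lambda>x. norm (gradient \<phi> x) powr q) \<le> G1 powr q" for \<phi> x x'
      proof -
        obtain K where K: "smooth_fun \<phi>" "compact K" "K \<subseteq> \<Omega>" "\<And>x. x \<notin> K \<Longrightarrow> \<phi> x = 0"
            "\<And>x. x \<notin> K \<Longrightarrow> gradient \<phi> x = 0"
          by (rule test_functionsE[OF \<phi>]) (rule that)
        have GV: "G1 * V powr (- (1 / q)) \<le> L"
          unfolding L_def using elim(1) G1 by (intro mult_left_mono) auto
        have eq: "cube_average \<Omega> \<rho> \<phi> x = integral (cube \<rho>) (\<lambda>y. \<phi> (x + y)) / V" for x
          unfolding V_def by (rule cube_average_test_function[OF \<Omega>(1) \<phi>])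
        have "\<bar>integral (cube \<rho>) (\<lambda>y. \<phi> (x + y)) - V * \<phi> x\<bar> \<le> 2 * (\<rho> * ?n * (G1 * V powr (- (1 / q)))) * V"
          using cube_average_close[OF K(1,2,5) q(3) \<rho> G1 le, of x] by (simp add: V_def mult.assoc)
        also have "\<dots> \<le> 2 * (\<rho> * ?n * L) * V"
          using GV \<rho> n V by (intro mult_right_mono mult_left_mono) auto
        finally have "\<bar>integral (cube \<rho>) (\<lambda>y. \<phi> (x + y)) - V * \<phi> x\<bar> \<le> \<mu> * V" unfolding \<rho>L .
        moreover have "cube_average \<Omega> \<rho> \<phi> x - \<phi> x = (integral (cube \<rho>) (\<lambda>y. \<phi> (x + y)) - V * \<phi> x) / V"
          unfolding eq using V by (simp only: diff_divide_distrib) simp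
        ultimately show "\<bar>cube_average \<Omega> \<rho> \<phi> x - \<phi> x\<bar> \<le> \<mu>"
          using V by (simp add: abs_divide pos_divide_le_eq)
        have "\<bar>integral (cube \<rho>) (\<lambda>y. \<phi> (x + y)) - integral (cube \<rho>) (\<lambda>y. \<phi> (x' + y))\<bar>
            \<le> (G1 * V powr (- (1 / q))) * norm (x - x') * V"
          using cube_average_lipschitz[OF K(1,2,5) q(1) \<rho> G1 le, of x x'] by (simp add: V_def mult_ac)
        also have "\<dots> \<le> L * norm (x - x') * V"
          using GV V by (intro mult_right_mono) auto
        finally have "\<bar>integral (cube \<rho>) (\<lambda>y. \<phi> (x + y)) - integral (cube \<rho>) (\<lambda>y. \<phi> (x' + y))\<bar> \<le> L * norm (x - x') * V" .
        moreover have "cube_average \<Omega> \<rho> \<phi> x - cube_average \<Omega> \<rho> \<phi> x'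
            = (integral (cube \<rho>) (\<lambda>y. \<phi> (x + y)) - integral (cube \<rho>) (\<lambda>y. \<phi> (x' + y))) / V"
          unfolding eq by (simp only: diff_divide_distrib)
        ultimately show "\<bar>cube_average \<Omega> \<rho> \<phi> x - cube_average \<Omega> \<rho> \<phi> x'\<bar> \<le> L * norm (x - x')"
          using V by (simp add: abs_divide pos_divide_le_eq)
      qed
      have lip: "\<bar>cube_average \<Omega> \<rho> u x - cube_average \<Omega> \<rho> u x'\<bar> \<le> L * norm (x - x')" if u: "u \<in> A" for u x x'
      proof (rule field_le_epsilon)
        fix \<epsilon> :: real assume \<epsilon>: "\<epsilon> > 0"
        then have "\<epsilon> / 2 > 0" by simp
        then obtain \<phi> where \<phi>: "\<phi> \<in> test_functions \<Omega>" "integral\<^sup>L lborel (\<lambda>x. norm (gradient \<phi> x) powr q) \<le> G1 powr q"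
          "\<forall>x. \<bar>cube_average \<Omega> \<rho> u x - cube_average \<Omega> \<rho> \<phi> x\<bar> \<le> \<epsilon> / 2"
          using approx[OF u, of "\<epsilon> / 2"] by blast
        show "\<bar>cube_average \<Omega> \<rho> u x - cube_average \<Omega> \<rho> u x'\<bar> \<le> L * norm (x - x') + \<epsilon>"
          using avg(2)[OF \<phi>(1,2), of x x'] \<phi>(3)[rule_format, of x] \<phi>(3)[rule_format, of x'] by linarith
      qed
      have cont: "\<forall>u\<in>A. continuous_on UNIV (cube_average \<Omega> \<rho> u)"
        unfolding continuous_on_iff
      proof (intro ballI allI impI)
        fix u and x :: 'a and \<epsilon> :: real assume u: "u \<in> A" and \<epsilon>: "\<epsilon> > 0"
        have "dist (cube_average \<Omega> \<rho> u x') (cube_average \<Omega> \<rho> u x) < \<epsilon>" if "dist x' x < \<epsilon> / L" for x'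
        proof -
          have "L * norm (x' - x) < \<epsilon>" using that L by (simp add: dist_norm pos_less_divide_eq mult.commute)
          then show ?thesis using lip[OF u, of x' x] by (simp add: dist_real_def)
        qed
        then show "\<exists>d>0. \<forall>x'\<in>UNIV. dist x' x < d \<longrightarrow> dist (cube_average \<Omega> \<rho> u x') (cube_average \<Omega> \<rho> u x) < \<epsilon>"
          using \<epsilon> L by (intro exI[of _ "\<epsilon> / L"]) auto
      qed
      define C where "C = (\<lambda>u. Bcontfun (cube_average \<Omega> \<rho> u)) ` A"
      note comp = admissible_average_compact[OF \<Omega>(1) \<Omega>m \<Omega>pos k q(1) \<rho> A cont, folded C_def]
      show "\<forall>\<^sub>F p in at_top. \<exists>A'\<in>admissible_sets \<Omega> m k p. \<forall>u\<in>A'. dirichlet_energy \<Omega> p u \<le> (G + e) powr p"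
      proof (rule key_estimate[OF \<Omega>(1,2) m comp(1,2) _ comp(4) L])
        show "- v \<in> C" if "v \<in> C" for v by (rule comp(3)[OF that])
        show "0 \<le> 2 * \<mu>" "2 * \<mu> < 1 - 3 * \<mu>" using \<mu> by auto
        show "L / (1 - 3 * \<mu> - 2 * \<mu>) < G + e" by (rule Lb)
        fix v assume "v \<in> C"
        then obtain u where u: "u \<in> A" "v = Bcontfun (cube_average \<Omega> \<rho> u)" unfolding C_def by blast
        have v: "apply_bcontfun v = cube_average \<Omega> \<rho> u" using comp(5)[OF u(1)] u(2) by simp
        show "\<bar>apply_bcontfun v x - apply_bcontfun v y\<bar> \<le> L * norm (x - y)" for x y
          unfolding v by (rule lip[OF u(1)])
        obtain \<phi> where \<phi>: "\<phi> \<in> test_functions \<Omega>" "integral\<^sup>L lborel (\<lambda>x. norm (gradient \<phi> x) powr q) \<le> G1 powr q"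
          "\<exists>y\<in>\<Omega>. m y > 0 \<and> \<bar>\<phi> y\<bar> \<ge> 1 - \<mu>" "\<forall>x. \<bar>cube_average \<Omega> \<rho> u x - cube_average \<Omega> \<rho> \<phi> x\<bar> \<le> \<mu>"
          using approx[OF u(1) \<mu>(1)] by blast
        show "\<bar>apply_bcontfun v x\<bar> \<le> 2 * \<mu>" if x: "x \<notin> \<Omega>" for x
        proof -
          obtain K where K: "smooth_fun \<phi>" "compact K" "K \<subseteq> \<Omega>" "\<And>x. x \<notin> K \<Longrightarrow> \<phi> x = 0"
              "\<And>x. x \<notin> K \<Longrightarrow> gradient \<phi> x = 0"
            by (rule test_functionsE[OF \<phi>(1)]) (rule that)
          have "\<phi> x = 0" using K(3) K(4)[of x] x by blast
          then show ?thesis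
            unfolding v using avg(1)[OF \<phi>(1,2), of x] \<phi>(4)[rule_format, of x] by linarith
        qed
        obtain y where y: "y \<in> \<Omega>" "m y > 0" "\<bar>\<phi> y\<bar> \<ge> 1 - \<mu>" using \<phi>(3) by blast
        have "1 - 3 * \<mu> \<le> \<bar>apply_bcontfun v y\<bar>"
          unfolding v using avg(1)[OF \<phi>(1,2), of y] \<phi>(4)[rule_format, of y] y(3) by linarith
        then show "\<exists>y\<in>\<Omega>. m y > 0 \<and> 1 - 3 * \<mu> \<le> \<bar>apply_bcontfun v y\<bar>" using y by blast
      qed
    qed
  qed
qed

section \<open>Eigenvalues and ball packings\<close>

lemma admissible_set_nonempty:
  assumes A: "A \<in> admissible_sets \<Omega> m k p" and k: "k \<ge> 1"
  shows "A \<noteq> {}"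
proof
  assume A0: "A = {}"
  let ?T = "subtopology (sobolev_topology \<Omega> p) (sobolev_space0 \<Omega> p)"
  have "genus ?T {} \<le> enat 0"
    unfolding genus_def
    by (intro Inf_lower CollectI exI[of _ 0] conjI exI[of _ "\<lambda>_ _. 0"])
       (auto simp: continuous_map_def)
  moreover have "enat k \<le> genus ?T {}" using A A0 by (simp add: admissible_sets_def)
  ultimately have "enat k \<le> enat 0" by (rule order_trans[rotated])
  then show False using k by simp
qed

text \<open>Compact sets are norm bounded, so the supremum of energies over an admissible set is a
  true supremum and not the unspecified value of an unbounded one.\<close>

lemma bdd_above_dirichlet_energy:
  assumes \<Omega>: "open \<Omega>" and p: "p \<ge> 1" and A: "A \<in> admissible_sets \<Omega> m k p"
  shows "bdd_above (dirichlet_energy \<Omega> p ` A)"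
proof -
  have "compactin (sobolev_topology \<Omega> p) A"
    using A by (simp add: admissible_sets_def compactin_subtopology)
  then obtain B where B: "\<forall>u\<in>A. sobolev_norm \<Omega> p u \<le> B"
    using compactin_sobolev_bounded[OF \<Omega> p] by blast
  have "dirichlet_energy \<Omega> p u \<le> B powr p" if "u \<in> A" for u
    by (rule dirichlet_energy_le_norm) (use p B that in auto)
  then show ?thesis by (intro bdd_aboveI2) auto
qed

lemma SUP_dirichlet_energy_nonneg:
  assumes \<Omega>: "open \<Omega>" and p: "p \<ge> 1" and A: "A \<in> admissible_sets \<Omega> m k p" and k: "k \<ge> 1"
  shows "0 \<le> (SUP u\<in>A. dirichlet_energy \<Omega> p u)"
proof -
  obtain u where u: "u \<in> A" using admissible_set_nonempty[OF A k] by blast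
  have "dirichlet_energy \<Omega> p u \<le> (SUP u\<in>A. dirichlet_energy \<Omega> p u)"
    by (rule cSUP_upper[OF u bdd_above_dirichlet_energy[OF \<Omega> p A]])
  then show ?thesis using dirichlet_energy_nonneg[of \<Omega> p u] by linarith
qed

lemma variational_eigenvalue_nonneg:
  assumes "open \<Omega>" "p \<ge> 1" "admissible_sets \<Omega> m k p \<noteq> {}" "k \<ge> 1"
  shows "0 \<le> variational_eigenvalue \<Omega> m k p"
  unfolding variational_eigenvalue_def
  by (rule cINF_greatest[OF assms(3)]) (rule SUP_dirichlet_energy_nonneg[OF assms(1,2) _ assms(4)])

lemma variational_eigenvalue_le:
  assumes \<Omega>: "open \<Omega>" and p: "p \<ge> 1" and A: "A \<in> admissible_sets \<Omega> m k p" and k: "k \<ge> 1"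
    and E: "\<And>u. u \<in> A \<Longrightarrow> dirichlet_energy \<Omega> p u \<le> E"
  shows "variational_eigenvalue \<Omega> m k p \<le> E"
proof -
  have "variational_eigenvalue \<Omega> m k p \<le> (SUP u\<in>A. dirichlet_energy \<Omega> p u)"
    unfolding variational_eigenvalue_def
    by (rule cINF_lower[OF _ A]) (rule bdd_belowI2, rule SUP_dirichlet_energy_nonneg[OF \<Omega> p _ k])
  also have "\<dots> \<le> E" by (rule cSUP_least[OF admissible_set_nonempty[OF A k] E])
  finally show ?thesis .
qed

lemma variational_eigenvalue_less:
  assumes \<Omega>: "open \<Omega>" and p: "p \<ge> 1" and ne: "admissible_sets \<Omega> m k p \<noteq> {}"
    and less: "variational_eigenvalue \<Omega> m k p < E"
  shows "\<exists>A\<in>admissible_sets \<Omega> m k p. \<forall>u\<in>A. dirichlet_energy \<Omega> p u \<le> E"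
proof -
  have "\<exists>A\<in>admissible_sets \<Omega> m k p. (SUP u\<in>A. dirichlet_energy \<Omega> p u) < E"
  proof (rule ccontr)
    assume "\<not> ?thesis"
    then have "E \<le> variational_eigenvalue \<Omega> m k p"
      unfolding variational_eigenvalue_def by (intro cINF_greatest[OF ne]) force
    then show False using less by simp
  qed
  then obtain A where A: "A \<in> admissible_sets \<Omega> m k p" "(SUP u\<in>A. dirichlet_energy \<Omega> p u) < E" by blast
  have "dirichlet_energy \<Omega> p u \<le> E" if u: "u \<in> A" for u
    using cSUP_upper[OF u bdd_above_dirichlet_energy[OF \<Omega> p A(1)]] A(2) by linarith
  then show ?thesis using A(1) by blast
qed

lemma eigenvalue_root_le:
  assumes "open \<Omega>" "p \<ge> 1" "k \<ge> 1" "B \<ge> 0"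
    and ex: "\<exists>A\<in>admissible_sets \<Omega> m k p. \<forall>u\<in>A. dirichlet_energy \<Omega> p u \<le> B powr p"
  shows "variational_eigenvalue \<Omega> m k p powr (1 / p) \<le> B"
proof -
  obtain A where A: "A \<in> admissible_sets \<Omega> m k p" "\<forall>u\<in>A. dirichlet_energy \<Omega> p u \<le> B powr p" using ex by blast
  have "variational_eigenvalue \<Omega> m k p \<le> B powr p"
    by (rule variational_eigenvalue_le[OF assms(1,2) A(1) assms(3)]) (use A(2) in blast)
  moreover have "0 \<le> variational_eigenvalue \<Omega> m k p"
    using variational_eigenvalue_nonneg[OF assms(1,2) _ assms(3)] A(1) by blast
  ultimately have "variational_eigenvalue \<Omega> m k p powr (1 / p) \<le> (B powr p) powr (1 / p)"
    using assms(2) by (intro powr_mono2) auto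
  then show ?thesis using assms(2,4) by (simp add: powr_powr)
qed

lemma eigenvalue_root_less:
  assumes "open \<Omega>" "p \<ge> 1" "k \<ge> 1" "admissible_sets \<Omega> m k p \<noteq> {}"
    and less: "variational_eigenvalue \<Omega> m k p powr (1 / p) < B"
  shows "\<exists>A\<in>admissible_sets \<Omega> m k p. \<forall>u\<in>A. dirichlet_energy \<Omega> p u \<le> B powr p"
proof (rule variational_eigenvalue_less[OF assms(1,2,4)])
  let ?l = "variational_eigenvalue \<Omega> m k p"
  have l: "0 \<le> ?l" by (rule variational_eigenvalue_nonneg[OF assms(1,2,4,3)])
  have "(?l powr (1 / p)) powr p < B powr p"
    using less assms(2) by (intro powr_less_mono2) auto
  then show "?l < B powr p" using l assms(2) by (simp add: powr_powr)
qed

section \<open>Combinations of tents on disjoint balls\<close>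

definition tent :: "real \<Rightarrow> 'a::euclidean_space \<Rightarrow> 'a \<Rightarrow> real" where
  "tent r c x = max 0 (r - norm (x - c))"

lemma tent_bcontfun: "tent r c \<in> bcontfun"
proof (rule bcontfun_normI)
  show "continuous_on UNIV (tent r c)" unfolding tent_def by (intro continuous_intros)
  show "norm (tent r c x) \<le> max 0 r" for x
    unfolding tent_def real_norm_def using norm_ge_zero[of "x - c"] by linarith
qed

text \<open>Inside one ball a single tent is scaled by a factor of modulus at most 1. For points in
  different balls the two heights add up to at most their distance, because the centres are at least
  \<open>2 r\<close> apart; so opposite signs do no harm.\<close>

lemma disjoint_tents_lipschitz:
  fixes c :: "nat \<Rightarrow> 'a::euclidean_space"
  assumes disj: "\<And>i j. i < k \<Longrightarrow> j < k \<Longrightarrow> i \<noteq> j \<Longrightarrow> ball (c i) r \<inter> ball (c j) r = {}"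
    and a: "\<And>i. i < k \<Longrightarrow> \<bar>a i\<bar> \<le> 1"
  shows "\<bar>(\<Sum>i<k. a i * tent r (c i) x) - (\<Sum>i<k. a i * tent r (c i) y)\<bar> \<le> norm (x - y)"
proof -
  define f where "f x = (\<Sum>i<k. a i * tent r (c i) x)" for x
  have tent0: "tent r (c i) x = 0" if "x \<notin> ball (c i) r" for i x
    using that by (simp add: tent_def dist_norm norm_minus_commute)
  have one: "f x = a i * tent r (c i) x" if i: "i < k" and x: "x \<in> ball (c i) r" for i x
  proof -
    have "a j * tent r (c j) x = 0" if "j \<in> {..<k} - {i}" for j
    proof -
      have "x \<notin> ball (c j) r" using disj[of i j] i that x by blast
      then show ?thesis by (simp add: tent0)
    qed
    then have "f x = (\<Sum>j\<in>{i}. a j * tent r (c j) x)"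
      unfolding f_def using i by (intro sum.mono_neutral_right) auto
    then show ?thesis by simp
  qed
  have none: "f x = 0" if "\<forall>i<k. x \<notin> ball (c i) r" for x
    unfolding f_def using that by (intro sum.neutral) (simp add: tent0)
  have tl: "\<bar>tent r (c i) x - tent r (c i) y\<bar> \<le> norm (x - y)" for i x y
  proof -
    have "\<bar>norm (x - c i) - norm (y - c i)\<bar> \<le> norm ((x - c i) - (y - c i))" by (rule norm_triangle_ineq3)
    then have "\<bar>norm (x - c i) - norm (y - c i)\<bar> \<le> norm (x - y)" by simp
    then show ?thesis unfolding tent_def by linarith
  qed
  have half: "\<bar>f x - f y\<bar> \<le> norm (x - y)" if i: "i < k" "x \<in> ball (c i) r" and out: "\<forall>j<k. y \<notin> ball (c j) r" for x y i
  proof -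
    have "\<bar>f x\<bar> \<le> tent r (c i) x"
      using a[OF i(1)] by (simp add: one[OF i] abs_mult tent_def mult_left_le_one_le)
    moreover have "tent r (c i) y = 0" using tent0 out i(1) by blast
    moreover have "f y = 0" by (rule none[OF out])
    ultimately show ?thesis using tl[of i x y] by linarith
  qed
  consider (none) "\<forall>i<k. x \<notin> ball (c i) r" "\<forall>i<k. y \<notin> ball (c i) r"
    | (x) i where "i < k" "x \<in> ball (c i) r" "\<forall>i<k. y \<notin> ball (c i) r"
    | (y) i where "i < k" "y \<in> ball (c i) r" "\<forall>i<k. x \<notin> ball (c i) r"
    | (same) i where "i < k" "x \<in> ball (c i) r" "y \<in> ball (c i) r"
    | (different) i j where "i < k" "j < k" "i \<noteq> j" "x \<in> ball (c i) r" "y \<in> ball (c j) r"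
    by blast
  then have "\<bar>f x - f y\<bar> \<le> norm (x - y)"
  proof cases
    case none
    then show ?thesis using \<open>\<And>x. \<forall>i<k. x \<notin> ball (c i) r \<Longrightarrow> f x = 0\<close> by simp
  next
    case (x i)
    then show ?thesis by (rule half)
  next
    case (y i)
    then show ?thesis using half[of i y x] by (simp add: abs_minus_commute norm_minus_commute)
  next
    case (same i)
    have "f x - f y = a i * (tent r (c i) x - tent r (c i) y)"
      using one same by (simp add: right_diff_distrib)
    then have "\<bar>f x - f y\<bar> = \<bar>a i\<bar> * \<bar>tent r (c i) x - tent r (c i) y\<bar>" by (simp add: abs_mult)
    also have "\<dots> \<le> 1 * norm (x - y)" using a[OF same(1)] tl by (intro mult_mono) auto
    finally show ?thesis by simp
  next
    case (different i j)
    \<comment> \<open>Otherwise the midpoint of the two centres would lie in both balls.\<close>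
    have dij: "2 * r \<le> dist (c i) (c j)"
    proof (rule ccontr)
      assume "\<not> 2 * r \<le> dist (c i) (c j)"
      then have "midpoint (c i) (c j) \<in> ball (c i) r \<inter> ball (c j) r"
        by (simp add: dist_midpoint)
      then show False using disj[OF different(1-3)] by blast
    qed
    have "dist (c i) (c j) \<le> dist (c i) x + dist x y + dist y (c j)"
      using dist_triangle[of "c i" "c j" x] dist_triangle[of x "c j" y] by linarith
    moreover have "\<bar>f x\<bar> \<le> tent r (c i) x" "\<bar>f y\<bar> \<le> tent r (c j) y"
      using a[OF different(1)] a[OF different(2)]
      by (simp_all add: one[OF different(1,4)] one[OF different(2,5)] abs_mult tent_def mult_left_le_one_le)
    moreover have "tent r (c i) x = r - dist (c i) x" "tent r (c j) y = r - dist y (c j)"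
      using different(4,5) by (simp_all add: tent_def dist_norm norm_minus_commute)
    ultimately show ?thesis using dij by (simp add: dist_norm)
  qed
  then show ?thesis by (simp add: f_def)
qed

text \<open>The boundary of a cube rather than a round sphere, so that some coefficient has modulus
  1 and every combination contains a tent of full height.\<close>

definition cube_boundary :: "nat \<Rightarrow> (nat \<Rightarrow> real) set" where
  "cube_boundary k = {a. (\<forall>i. a i \<in> {-1..1}) \<and> (\<forall>i\<ge>k. a i = 0) \<and> (\<exists>i<k. \<bar>a i\<bar> = 1)}"

text \<open>A closed subset of a product of compact intervals, hence compact by Tychonoff in the
  topology of coordinatewise convergence.\<close>

lemma compact_cube_boundary: "compact (cube_boundary k)"
proof -
  have coord: "continuous_on UNIV (\<lambda>a :: nat \<Rightarrow> real. a i)" for i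
    by (rule continuous_on_product_coordinates)
  have "compactin (powertop_real UNIV) (UNIV \<rightarrow>\<^sub>E {-1..1})"
    by (simp add: compactin_PiE)
  then have 1: "compact (UNIV \<rightarrow>\<^sub>E {-1..1} :: (nat \<Rightarrow> real) set)"
    by (simp add: euclidean_product_topology)
  have 2: "closed ((\<Inter>i\<in>{k..}. {a :: nat \<Rightarrow> real. a i = 0}) \<inter> (\<Union>i\<in>{..<k}. {a. \<bar>a i\<bar> = 1}))"
    by (intro closed_Int closed_INT closed_UN ballI finite_lessThan closed_Collect_eq continuous_on_rabs coord continuous_on_const)
  have "cube_boundary k = (UNIV \<rightarrow>\<^sub>E {-1..1}) \<inter> ((\<Inter>i\<in>{k..}. {a. a i = 0}) \<inter> (\<Union>i\<in>{..<k}. {a. \<bar>a i\<bar> = 1}))"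
    by (auto simp: cube_boundary_def PiE_def Pi_def extensional_def)
  then show ?thesis using compact_Int_closed[OF 1 2] by simp
qed

text \<open>Any odd map from \<open>C\<close> into the punctured \<open>j\<close>-space, composed
  with \<open>f\<close>, is an odd map between punctured Euclidean spaces, so Borsuk-Ulam gives
  \<open>k <= j\<close>.\<close>

lemma genus_ge_of_odd_map:
  fixes C :: "'c::{topological_space, uminus} set"
  assumes cont: "continuous_on (topspace (Euclidean_space k) - {\<lambda>_. 0}) f"
    and im: "\<And>t. t \<in> topspace (Euclidean_space k) \<Longrightarrow> t \<noteq> (\<lambda>_. 0) \<Longrightarrow> f t \<in> C"
    and odd: "\<And>t. t \<in> topspace (Euclidean_space k) \<Longrightarrow> t \<noteq> (\<lambda>_. 0) \<Longrightarrow> f (- t) = - f t"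
  shows "enat k \<le> genus euclidean C"
  unfolding genus_def
proof (rule Inf_greatest)
  fix g assume "g \<in> {enat j |j. \<exists>\<phi>. continuous_map (subtopology euclidean C) (subtopology (Euclidean_space j) (- {\<lambda>_. 0})) \<phi> \<and>
     (\<forall>v\<in>C. \<phi> (- v) = - \<phi> v)}"
  then obtain j \<phi> where g: "g = enat j"
    and \<phi>: "continuous_map (subtopology euclidean C) (subtopology (Euclidean_space j) (- {\<lambda>_. 0})) \<phi>"
      "\<forall>v\<in>C. \<phi> (- v) = - \<phi> v"
    by blast
  let ?S = "topspace (Euclidean_space k) - {\<lambda>_. 0}"
  have X: "subtopology (Euclidean_space k) (- {\<lambda>_. 0}) = top_of_set ?S"
    unfolding Euclidean_space_def euclidean_product_topology subtopology_subtopology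
    by (rule arg_cong[where f="subtopology euclidean"]) auto
  have "continuous_map (top_of_set ?S) euclidean f" using cont by simp
  then have "continuous_map (top_of_set ?S) (subtopology euclidean C) f"
    by (rule continuous_map_into_subtopology) (use im in auto)
  then have "continuous_map (subtopology (Euclidean_space k) (- {\<lambda>_. 0})) (subtopology (Euclidean_space j) (- {\<lambda>_. 0})) (\<phi> \<circ> f)"
    unfolding X by (rule continuous_map_compose[OF _ \<phi>(1)])
  then have "k \<le> j"
    by (rule borsuk_ulam) (use odd im \<phi>(2) in auto)
  then show "enat k \<le> g" by (simp add: g)
qed

lemma packing_upper_bound:
  fixes \<Omega> :: "'a::euclidean_space set"
  assumes \<Omega>: "open \<Omega>" "bounded \<Omega>" and m: "continuous_on (closure \<Omega>) m" and k: "k \<ge> 1"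
    and r: "r > 0" and c: "\<And>i. i < k \<Longrightarrow> c i \<in> positivity_set \<Omega> m" "\<And>i. i < k \<Longrightarrow> ball (c i) r \<subseteq> \<Omega>"
    and disj: "\<And>i j. i < k \<Longrightarrow> j < k \<Longrightarrow> i \<noteq> j \<Longrightarrow> ball (c i) r \<inter> ball (c j) r = {}"
    and B: "B > 1 / r"
  shows "\<forall>\<^sub>F p in at_top. \<exists>A\<in>admissible_sets \<Omega> m k p. \<forall>u\<in>A. dirichlet_energy \<Omega> p u \<le> B powr p"
proof -
  define D where "D i = Bcontfun (tent r (c i))" for i
  have D: "apply_bcontfun (D i) = tent r (c i)" for i
    by (simp add: D_def Bcontfun_inverse tent_bcontfun)
  define F where "F a = (\<Sum>i<k. a i *\<^sub>R D i)" for a :: "nat \<Rightarrow> real"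
  have apply_F: "apply_bcontfun (F a) x = (\<Sum>i<k. a i * tent r (c i) x)" for a x
  proof -
    have "apply_bcontfun (\<Sum>i\<in>I. a i *\<^sub>R D i) x = (\<Sum>i\<in>I. a i * tent r (c i) x)" if "finite I" for I
      using that by (induction I rule: finite_induct) (simp_all add: D plus_bcontfun.rep_eq zero_bcontfun.rep_eq scaleR_bcontfun.rep_eq)
    then show ?thesis by (simp add: F_def)
  qed
  have F_minus: "F (- a) = - F a" for a by (simp add: F_def sum_negf)
  define C where "C = F ` cube_boundary k"
  have coord: "continuous_on S (\<lambda>a :: nat \<Rightarrow> real. a i)" for i S
    by (rule continuous_on_subset[OF continuous_on_product_coordinates]) simp
  have compC: "compact C"
    unfolding C_def F_def
    by (intro compact_continuous_image compact_cube_boundary continuous_on_sum continuous_on_scaleR coord continuous_on_const)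
  have unit: "unit_vec 0 \<in> cube_boundary k"
    using k by (auto simp: cube_boundary_def)
  have symC: "- v \<in> C" if v: "v \<in> C" for v
  proof -
    obtain a where a: "a \<in> cube_boundary k" "v = F a" using v unfolding C_def by blast
    have "- a \<in> cube_boundary k" using a(1) by (auto simp: cube_boundary_def fun_Compl_def minus_le_iff)
    then show ?thesis unfolding C_def a(2) F_minus[symmetric] by blast
  qed
  have genC: "enat k \<le> genus euclidean C"
  proof (rule genus_ge_of_odd_map)
    define s where "s t = (\<Sum>i<k. \<bar>t i\<bar>)" for t :: "nat \<Rightarrow> real"
    \<comment> \<open>An odd continuous map onto the cube boundary without a maximum in the
      denominator: the largest \<open>\<bar>t i\<bar>\<close> is at least the average
      \<open>s t / k\<close>, so after this rescaling it has modulus at least 1 and is clamped to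
      exactly 1.\<close>
    define b where "b t i = clamp_fun 1 (real k * t i / s t)" for t :: "nat \<Rightarrow> real" and i
    have s: "s t > 0" if t: "t \<in> topspace (Euclidean_space k)" "t \<noteq> (\<lambda>_. 0)" for t
    proof -
      obtain i where "t i \<noteq> 0" using t(2) by blast
      moreover have "i < k" using t(1) \<open>t i \<noteq> 0\<close> by (auto simp: topspace_Euclidean_space) (meson not_less)
      ultimately show ?thesis unfolding s_def by (intro sum_pos2[of _ i]) auto
    qed
    have contb: "continuous_on (topspace (Euclidean_space k) - {\<lambda>_. 0}) (\<lambda>t. b t i)" for i
      unfolding b_def clamp_fun_def s_def
      by (intro continuous_on_max continuous_on_min continuous_on_divide continuous_on_mult continuous_on_const
          continuous_on_sum continuous_on_rabs coord continuous_on_minus ballI)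
         (use s in \<open>auto simp: s_def less_le\<close>)
    show "continuous_on (topspace (Euclidean_space k) - {\<lambda>_. 0}) (\<lambda>t. F (b t))"
      unfolding F_def by (intro continuous_on_sum continuous_on_scaleR contb continuous_on_const)
    fix t assume t: "t \<in> topspace (Euclidean_space k)" "t \<noteq> (\<lambda>_. 0)"
    have "b t \<in> cube_boundary k"
    proof -
      have "\<exists>i<k. s t \<le> k * \<bar>t i\<bar>"
      proof (rule ccontr)
        assume "\<not> ?thesis"
        then have "k * \<bar>t i\<bar> < s t" if "i < k" for i using that by force
        then have "(\<Sum>i<k. k * \<bar>t i\<bar>) < (\<Sum>i<k. s t)"
          using k by (intro sum_strict_mono) (auto simp: lessThan_empty_iff)
        then show False by (simp add: s_def flip: sum_distrib_left)
      qed
      then obtain i where i: "i < k" "s t \<le> k * \<bar>t i\<bar>" by blast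
      have "1 \<le> \<bar>k * t i / s t\<bar>" using i(2) s[OF t] by (simp add: abs_mult pos_le_divide_eq)
      then have "\<bar>b t i\<bar> = 1" unfolding b_def by (intro clamp_fun_eq) auto
      moreover have "b t j \<in> {-1..1}" for j
        using clamp_fun_le[of 1 "k * t j / s t"] by (auto simp: b_def abs_le_iff)
      moreover have "b t j = 0" if "j \<ge> k" for j
        using t(1) that by (simp add: b_def topspace_Euclidean_space clamp_fun_def)
      ultimately show ?thesis using i(1) unfolding cube_boundary_def by blast
    qed
    then show "F (b t) \<in> C" unfolding C_def by blast
    have "b (- t) = - b t"
      by (simp add: fun_eq_iff b_def s_def clamp_fun_minus)
    then show "F (b (- t)) = - F (b t)" by (simp only: F_minus)
  qed
  \<comment> \<open>Chosen so that \<open>1 / (r - \<delta>)\<close> is the arithmetic mean of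
    \<open>1 / r\<close> and \<open>B\<close>. A positive \<open>\<delta>\<close> is required
    because the centres lie only in the closure of the positivity region; the height is measured at
    a nearby point of the region itself.\<close>
  define \<delta> where "\<delta> = r - 2 / (1 / r + B)"
  have "0 < 1 / r" using r by simp
  then have B0: "B > 0" using B by (rule less_trans)
  have rd: "r - \<delta> = 2 / (1 / r + B)" by (simp add: \<delta>_def)
  have rd0: "r - \<delta> > 0" unfolding rd using r B0 by (simp add: add_pos_pos)
  have \<delta>: "\<delta> > 0"
  proof -
    have "2 / (1 / r + B) < 2 / (1 / r + 1 / r)"
      using r B B0 by (intro divide_strict_left_mono mult_pos_pos add_pos_pos add_strict_left_mono) auto
    also have "\<dots> = r" using r by simp
    finally show ?thesis by (simp add: \<delta>_def)
  qed
  show ?thesis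
  proof (rule key_estimate[OF \<Omega> m compC _ symC genC, where L=1 and \<eta>=0 and b="r - \<delta>"])
    show "C \<noteq> {}" using unit unfolding C_def by blast
    have "1 / (r - \<delta>) = (1 / r + B) / 2" unfolding rd by simp
    then show "1 / (r - \<delta> - 0) < B" using B by simp
    show "0 < r - \<delta>" by (rule rd0)
    fix v assume "v \<in> C"
    then obtain a where a: "a \<in> cube_boundary k" "v = F a" unfolding C_def by blast
    have a1: "\<bar>a i\<bar> \<le> 1" for i
    proof -
      have "a i \<in> {-1..1}" using a(1) unfolding cube_boundary_def by blast
      then show ?thesis by (auto simp: abs_le_iff)
    qed
    show "\<bar>apply_bcontfun v x - apply_bcontfun v y\<bar> \<le> 1 * norm (x - y)" for x y
      using disjoint_tents_lipschitz[of k c r a x y, OF disj a1] by (simp add: a(2) apply_F)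
    show "\<bar>apply_bcontfun v x\<bar> \<le> 0" if x: "x \<notin> \<Omega>" for x
    proof -
      have "tent r (c i) x = 0" if "i < k" for i
      proof -
        have "x \<notin> ball (c i) r" using c(2)[OF that] x by blast
        then show ?thesis by (simp add: tent_def dist_norm norm_minus_commute)
      qed
      then show ?thesis by (simp add: a(2) apply_F)
    qed
    obtain i where i: "i < k" "\<bar>a i\<bar> = 1" using a(1) unfolding cube_boundary_def by blast
    have "\<forall>e>0. \<exists>y\<in>{x \<in> \<Omega>. m x > 0}. dist y (c i) < e"
      using c(1)[OF i(1)] unfolding positivity_set_def closure_approachable .
    then obtain y where y: "y \<in> \<Omega>" "m y > 0" "dist y (c i) < min \<delta> r"
      using \<delta> r by (metis (mono_tags, lifting) mem_Collect_eq min_less_iff_conj)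
    have "(\<Sum>j<k. a j * tent r (c j) y) = (\<Sum>j\<in>{i}. a j * tent r (c j) y)"
    proof (rule sum.mono_neutral_right)
      show "\<forall>j\<in>{..<k} - {i}. a j * tent r (c j) y = 0"
      proof
        fix j assume j: "j \<in> {..<k} - {i}"
        have "y \<in> ball (c i) r" using y(3) by (simp add: dist_commute)
        then have "y \<notin> ball (c j) r" using disj[of i j] i(1) j by blast
        then show "a j * tent r (c j) y = 0" by (simp add: tent_def dist_norm norm_minus_commute)
      qed
    qed (use i(1) in auto)
    then have "\<bar>apply_bcontfun v y\<bar> = tent r (c i) y"
      using i(2) by (simp add: a(2) apply_F abs_mult tent_def)
    moreover have "tent r (c i) y \<ge> r - \<delta>" using y(3) by (simp add: tent_def dist_norm)
    ultimately show "\<exists>y\<in>\<Omega>. m y > 0 \<and> r - \<delta> \<le> \<bar>apply_bcontfun v y\<bar>" using y(1,2) by force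
  qed auto
qed

section \<open>Existence and boundedness of packing radii\<close>

lemma packing_exists:
  fixes \<Omega> :: "'a::euclidean_space set"
  assumes \<Omega>: "open \<Omega>" and m: "continuous_on (closure \<Omega>) m" and pos: "{x \<in> \<Omega>. m x > 0} \<noteq> {}"
  shows "\<exists>r>0. \<exists>c :: nat \<Rightarrow> 'a. (\<forall>i\<in>{1..k}. c i \<in> positivity_set \<Omega> m \<and> ball (c i) r \<subseteq> \<Omega>) \<and>
    disjoint_family_on (\<lambda>i. ball (c i) r) {1..k}"
proof -
  have "open (\<Omega> \<inter> m -` {0<..})"
    using \<Omega> continuous_on_subset[OF m closure_subset] by (intro continuous_open_preimage) auto
  moreover obtain y where y: "y \<in> \<Omega> \<inter> m -` {0<..}" using pos by auto
  ultimately obtain e where e: "e > 0" "ball y e \<subseteq> \<Omega> \<inter> m -` {0<..}"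
    using open_contains_ball by blast
  obtain b :: 'a where b: "b \<in> Basis" using nonempty_Basis by blast
  \<comment> \<open>\<open>k\<close> equally spaced centres along one coordinate direction, starting
    near \<open>y\<close>; with spacing \<open>e / (k + 1)\<close> and half of it as radius all
    balls stay in \<open>ball y e\<close>.\<close>
  define t where "t = e / (real k + 1)"
  have t: "t > 0" using e(1) by (simp add: t_def)
  define c where "c i = y + (real i * t) *\<^sub>R b" for i
  have dc: "dist (c i) (c j) = \<bar>real i - real j\<bar> * t" for i j
  proof -
    have "c i - c j = ((real i - real j) * t) *\<^sub>R b" by (simp add: c_def algebra_simps)
    then show ?thesis using b t by (simp add: dist_norm abs_mult)
  qed
  have sub: "ball (c i) (t / 2) \<subseteq> ball y e" if i: "i \<le> k" for i
  proof
    fix x assume x: "x \<in> ball (c i) (t / 2)"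
    have "dist y x \<le> dist (c 0) (c i) + dist (c i) x" using dist_triangle[of y x "c i"] by (simp add: c_def)
    also have "\<dots> < real i * t + t" using x t by (simp add: dc)
    also have "\<dots> \<le> (real k + 1) * t"
      using i t mult_right_mono[of "real i" "real k" t] by (simp add: distrib_right)
    also have "\<dots> = e" by (simp add: t_def add_pos_pos)
    finally show "x \<in> ball y e" by simp
  qed
  have "c i \<in> positivity_set \<Omega> m \<and> ball (c i) (t / 2) \<subseteq> \<Omega>" if i: "i \<in> {1..k}" for i
  proof
    have "c i \<in> ball (c i) (t / 2)" using t by simp
    moreover have "ball (c i) (t / 2) \<subseteq> \<Omega> \<inter> m -` {0<..}" using subset_trans[OF sub e(2)] i by simp
    ultimately have "c i \<in> \<Omega> \<inter> m -` {0<..}" by (rule subsetD[rotated])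
    then have "c i \<in> {x \<in> \<Omega>. m x > 0}" by auto
    then show "c i \<in> positivity_set \<Omega> m" unfolding positivity_set_def by (rule subsetD[OF closure_subset])
    show "ball (c i) (t / 2) \<subseteq> \<Omega>" using subset_trans[OF sub e(2)] i by simp
  qed
  moreover have "disjoint_family_on (\<lambda>i. ball (c i) (t / 2)) {1..k}"
    unfolding disjoint_family_on_def
  proof (intro ballI impI)
    fix i j :: nat assume "i \<noteq> j"
    then have "1 \<le> \<bar>real i - real j\<bar>" by linarith
    then have "t \<le> dist (c i) (c j)" using t by (simp add: dc)
    then show "ball (c i) (t / 2) \<inter> ball (c j) (t / 2) = {}" by (intro disjoint_ballI) simp
  qed
  ultimately show ?thesis using t by (intro exI[of _ "t / 2"] conjI exI[of _ c]) auto
qed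

lemma packing_radii_bounded:
  fixes \<Omega> :: "'a::euclidean_space set"
  assumes \<Omega>: "bounded \<Omega>" and k: "k \<ge> 1"
  shows "bdd_above {r. r > 0 \<and> (\<exists>c :: nat \<Rightarrow> 'a.
            (\<forall>i\<in>{1..k}. c i \<in> positivity_set \<Omega> m \<and> ball (c i) r \<subseteq> \<Omega>) \<and>
            disjoint_family_on (\<lambda>i. ball (c i) r) {1..k})}"
proof (rule bdd_aboveI)
  fix r assume "r \<in> {r. r > 0 \<and> (\<exists>c :: nat \<Rightarrow> 'a.
            (\<forall>i\<in>{1..k}. c i \<in> positivity_set \<Omega> m \<and> ball (c i) r \<subseteq> \<Omega>) \<and>
            disjoint_family_on (\<lambda>i. ball (c i) r) {1..k})}"
  then obtain c :: "nat \<Rightarrow> 'a" where r: "r > 0" and c: "\<forall>i\<in>{1..k}. ball (c i) r \<subseteq> \<Omega>" by blast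
  have "ball (c 1) r \<subseteq> \<Omega>" using c k by auto
  then have "diameter (ball (c 1) r) \<le> diameter \<Omega>" using \<Omega> by (rule diameter_subset)
  then show "r \<le> diameter \<Omega>" using r by (simp add: diameter_ball)
qed

theorem theorem1p2:
  fixes \<Omega> :: "(real ^ 'n) set" and m :: "real ^ 'n \<Rightarrow> real" and k :: nat
  assumes "smooth_bounded_domain \<Omega>"
    and "continuous_on (closure \<Omega>) m"
    and "changes_sign \<Omega> m"
    and "k \<ge> 1"
  shows "\<exists>L. ((\<lambda>p. variational_eigenvalue \<Omega> m k p powr (1 / p)) \<longlongrightarrow> L) at_top \<and>
             L \<le> 1 / packing_radius \<Omega> m k"
proof -
  have \<Omega>: "open \<Omega>" "bounded \<Omega>" "\<Omega> \<noteq> {}"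
    using assms(1) by (auto simp: smooth_bounded_domain_def)
  note m = assms(2) and k = assms(4)
  have pos: "{x \<in> \<Omega>. m x > 0} \<noteq> {}" using assms(3) by (simp add: changes_sign_def)
  define S where "S = {r. r > 0 \<and> (\<exists>c :: nat \<Rightarrow> real ^ 'n.
            (\<forall>i\<in>{1..k}. c i \<in> positivity_set \<Omega> m \<and> ball (c i) r \<subseteq> \<Omega>) \<and>
            disjoint_family_on (\<lambda>i. ball (c i) r) {1..k})}"
  have R: "packing_radius \<Omega> m k = Sup S" by (simp add: packing_radius_def S_def)
  have S_pos: "r > 0" if "r \<in> S" for r using that unfolding S_def by (elim CollectE conjE)
  have S0: "S \<noteq> {}" using packing_exists[OF \<Omega>(1) m pos, of k] unfolding S_def by blast
  have Sbdd: "bdd_above S" unfolding S_def by (rule packing_radii_bounded[OF \<Omega>(2) k])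
  define f where "f p = variational_eigenvalue \<Omega> m k p powr (1 / p)" for p
  have f0: "f p \<ge> 0" for p by (simp add: f_def)
  have ev1: "\<forall>\<^sub>F p::real in at_top. p \<ge> 1" by (rule eventually_ge_at_top)
  have upper: "\<forall>\<^sub>F p in at_top. f p \<le> B"
    if B: "B \<ge> 0" and ev: "\<forall>\<^sub>F p in at_top. \<exists>A\<in>admissible_sets \<Omega> m k p. \<forall>u\<in>A. dirichlet_energy \<Omega> p u \<le> B powr p" for B
    using ev ev1
  proof eventually_elim
    case (elim p)
    then show ?case unfolding f_def by (intro eigenvalue_root_le[OF \<Omega>(1) _ k B])
  qed
  have ball: "\<forall>\<^sub>F p in at_top. \<exists>A\<in>admissible_sets \<Omega> m k p. \<forall>u\<in>A. dirichlet_energy \<Omega> p u \<le> B powr p"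
    if r: "r \<in> S" and B: "B > 1 / r" for r B
  proof -
    obtain c :: "nat \<Rightarrow> real ^ 'n" where c: "r > 0" "\<forall>i\<in>{1..k}. c i \<in> positivity_set \<Omega> m \<and> ball (c i) r \<subseteq> \<Omega>"
      "disjoint_family_on (\<lambda>i. ball (c i) r) {1..k}"
      using r unfolding S_def by (elim CollectE conjE exE) (rule that)
    show ?thesis
    proof (rule packing_upper_bound[OF \<Omega>(1,2) m k c(1) _ _ _ B, where c="\<lambda>i. c (Suc i)"])
      fix i assume "i < k"
      then have "Suc i \<in> {1..k}" by simp
      then show "c (Suc i) \<in> positivity_set \<Omega> m" "ball (c (Suc i)) r \<subseteq> \<Omega>" using c(2) by blast+
    next
      fix i j assume "i < k" "j < k" "i \<noteq> j"
      then have "Suc i \<in> {1..k}" "Suc j \<in> {1..k}" "Suc i \<noteq> Suc j" by simp_all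
      then show "ball (c (Suc i)) r \<inter> ball (c (Suc j)) r = {}"
        using c(3) unfolding disjoint_family_on_def by blast
    qed
  qed
  \<comment> \<open>The eventual upper bounds of \<open>f\<close>. Their infimum is the upper limit,
    and the two halves \<open>above\<close> and \<open>below\<close> show that it is the
    limit.\<close>
  define U where "U = {b. b \<ge> 0 \<and> (\<forall>\<^sub>F p in at_top. f p \<le> b)}"
  have Ubdd: "bdd_below U" by (rule bdd_belowI[of _ 0]) (simp add: U_def)
  have rU: "B \<in> U" if "r \<in> S" "B > 1 / r" for r B
  proof -
    have "0 < 1 / r" using S_pos[OF that(1)] by simp
    then have "0 < B" using that(2) by (rule less_trans)
    then have "B \<ge> 0" by simp
    then show ?thesis using upper[OF _ ball[OF that]] by (simp add: U_def)
  qed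
  obtain r0 where r0: "r0 \<in> S" using S0 by blast
  have U0: "U \<noteq> {}" using rU[OF r0, of "1 / r0 + 1"] by auto
  have ne: "\<forall>\<^sub>F p in at_top. admissible_sets \<Omega> m k p \<noteq> {}"
  proof -
    have "\<forall>\<^sub>F p in at_top. \<exists>A\<in>admissible_sets \<Omega> m k p. \<forall>u\<in>A. dirichlet_energy \<Omega> p u \<le> (1 / r0 + 1) powr p"
      by (rule ball[OF r0]) simp
    then show ?thesis by (rule eventually_mono) blast
  qed
  define L where "L = Inf U"
  have L0: "L \<ge> 0" unfolding L_def by (rule cInf_greatest[OF U0]) (simp add: U_def)
  have above: "\<forall>\<^sub>F p in at_top. f p < L + e" if e: "e > 0" for e
  proof -
    have "Inf U < L + e" using e by (simp add: L_def)
    then obtain b where b: "b \<in> U" "b < L + e" using cInf_lessD[OF U0] by blast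
    then have "\<forall>\<^sub>F p in at_top. f p \<le> b" by (simp add: U_def)
    then show ?thesis by (rule eventually_mono) (use b(2) in linarith)
  qed
  have below: "\<forall>\<^sub>F p in at_top. L - e < f p" if e: "e > 0" for e
  proof (rule ccontr)
    assume "\<not> ?thesis"
    then have freq: "\<exists>\<^sub>F p in at_top. f p \<le> L - e" by (simp add: not_eventually not_less)
    \<comment> \<open>Strictly above \<open>L - e\<close>, so that at the chosen exponent some
      admissible set has energies at most \<open>G powr q\<close>, and still
      \<open>G + e / 4 < L\<close>. Transfer to all large exponents then yields an eventual bound
      below the infimum of all such bounds.\<close>
    define G where "G = L - e / 2"
    obtain p where "f p \<le> L - e" using frequently_ex[OF freq] by (elim exE) (rule that)
    then have "L - e \<ge> 0" using f0[of p] by linarith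
    then have G: "G > 0" using e by (simp add: G_def)
    have step: "\<forall>\<^sub>F q in at_top. \<forall>A\<in>admissible_sets \<Omega> m k q. (\<forall>u\<in>A. dirichlet_energy \<Omega> q u \<le> G powr q) \<longrightarrow>
      (\<forall>\<^sub>F p in at_top. \<exists>A'\<in>admissible_sets \<Omega> m k p. \<forall>u\<in>A'. dirichlet_energy \<Omega> p u \<le> (G + e / 4) powr p)"
      by (rule admissible_limit_step[OF \<Omega> m k G]) (use e in simp)
    have "\<forall>\<^sub>F q in at_top. q \<ge> 1 \<and> admissible_sets \<Omega> m k q \<noteq> {} \<and>
      (\<forall>A\<in>admissible_sets \<Omega> m k q. (\<forall>u\<in>A. dirichlet_energy \<Omega> q u \<le> G powr q) \<longrightarrow>
      (\<forall>\<^sub>F p in at_top. \<exists>A'\<in>admissible_sets \<Omega> m k p. \<forall>u\<in>A'. dirichlet_energy \<Omega> p u \<le> (G + e / 4) powr p))"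
      (is "eventually ?Q _")
      by (intro eventually_conj ev1 ne step)
    from frequently_ex[OF frequently_eventually_frequently[OF freq this]]
    obtain q where q: "f q \<le> L - e" "?Q q" by (elim exE conjE[where P="f _ \<le> L - e"]) (rule that)
    note q2 = q(2)[THEN conjunct1] and q3 = q(2)[THEN conjunct2, THEN conjunct1]
      and stepq = q(2)[THEN conjunct2, THEN conjunct2]
    have "variational_eigenvalue \<Omega> m k q powr (1 / q) < G" using q(1) e by (simp add: f_def G_def)
    from eigenvalue_root_less[OF \<Omega>(1) q2 k q3 this]
    obtain A where A: "A \<in> admissible_sets \<Omega> m k q" "\<forall>u\<in>A. dirichlet_energy \<Omega> q u \<le> G powr q"
      by (elim bexE) (rule that)
    have "\<forall>\<^sub>F p in at_top. f p \<le> G + e / 4"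
      by (rule upper) (use G e in simp, rule stepq[rule_format, OF A(1)], use A(2) in simp)
    then have "G + e / 4 \<in> U" using G e by (simp add: U_def)
    then have "L \<le> G + e / 4" unfolding L_def by (rule cInf_lower[OF _ Ubdd])
    then show False using e by (simp add: G_def)
  qed
  have "(f \<longlongrightarrow> L) at_top"
  proof (rule tendstoI)
    fix e :: real assume "e > 0"
    from above[OF this] below[OF this] show "\<forall>\<^sub>F p in at_top. dist (f p) L < e"
      by eventually_elim (simp add: dist_real_def abs_less_iff)
  qed
  moreover have "L \<le> 1 / packing_radius \<Omega> m k"
  proof -
    \<comment> \<open>Every \<open>B > 1 / r\<close> is an eventual bound, so the estimate survives
      letting \<open>B\<close> decrease to \<open>1 / r\<close>; taking the supremum over
      \<open>r\<close> afterwards needs no packing that attains it.\<close>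
    have Lr: "L \<le> 1 / r" if r: "r \<in> S" for r
    proof (rule field_le_epsilon)
      fix e :: real assume "e > 0"
      then have "1 / r + e \<in> U" using rU[OF r] by simp
      then show "L \<le> 1 / r + e" unfolding L_def by (rule cInf_lower[OF _ Ubdd])
    qed
    have "r0 > 0" by (rule S_pos[OF r0])
    moreover have "r0 \<le> Sup S" by (rule cSup_upper[OF r0 Sbdd])
    ultimately have Rpos: "Sup S > 0" by linarith
    show ?thesis
    proof (cases "L = 0")
      case True
      then show ?thesis using Rpos by (simp add: R)
    next
      case False
      then have L: "L > 0" using L0 by simp
      have "Sup S \<le> 1 / L"
      proof (rule cSup_least[OF S0])
        fix r assume r: "r \<in> S"
        from S_pos[OF r] show "r \<le> 1 / L" using Lr[OF r] L by (simp add: pos_le_divide_eq mult.commute)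
      qed
      then show ?thesis using L Rpos by (simp add: R pos_le_divide_eq mult.commute)
    qed
  qed
  ultimately show ?thesis unfolding f_def by (intro exI[of _ L] conjI)
qed

end
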